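(* Let $l_0,l_1\in\mathbb{Z}_{\ge0}$, and let $m$ be a non-negative integer. There exists $\epsilon\in\mathbb{R}_{>0}$ such that if $|p|<\epsilon$ then there exist an eigenvalue $E_m(p)$ and an eigenfunction $g_m(x,p)$ of the Hamiltonian $H$ (the $BC_1$ Inozemtsev Hamiltonian with $l_2=l_3=0$, with $p=\exp(2\pi\sqrt{-1}\tau)$) such that, as $p\to0$, $$E_m(p)\to\pi^2(l_0+l_1+2+2m)^2-\frac{\pi^2}{3}\bigl(l_0(l_0+1)+l_1(l_1+1)\bigr),$$ $$g_m(x,p)\to\Phi(x)\psi_m(x)\quad\text{uniformly on compact sets},$$ and $g_m(x,p)$ is square-integrable, i.e. $\int_0^1|g_m(x,p)|^2dx<\infty$. The functions $E_m(p)$ and $g_m(x,p)$ are holomorphic in $p$ for $|p|<\epsilon$.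
   Context: Put $\omega_1=1/2$, $\omega_3=\tau/2$ with $\tau$ in the upper half plane, $p=\exp(2\pi\sqrt{-1}\tau)$, and let $\wp$ be the Weierstrass function with periods $(1,\tau)$. The Hamiltonian with $l_2=l_3=0$ is $$H=-\frac{d^2}{dx^2}+l_0(l_0+1)\wp(x)+l_1(l_1+1)\wp\bigl(x+\tfrac12\bigr).$$ Since $\wp(x)=\frac{\pi^2}{\sin^2\pi x}-\frac{\pi^2}{3}-8\pi^2\sum_{n\ge1}\frac{np^n}{1-p^n}(\cos2n\pi x-1)$, the operator $H$ depends on $\tau$ only through $p$, and it extends to $p=0$ as $H_T-C_T$, where $H_T=-\frac{d^2}{dx^2}+l_0(l_0+1)\frac{\pi^2}{\sin^2\pi x}+l_1(l_1+1)\frac{\pi^2}{\cos^2\pi x}$ and $C_T=\frac{\pi^2}{3}(l_0(l_0+1)+l_1(l_1+1))$. $\Phi(x)=(\sin\pi x)^{l_0+1}(\cos\pi x)^{l_1+1}$, and $$\psi_m(x)=\tilde c_m\;{}_2F_1\!\Bigl(-m,\,l_0+l_1+2+m;\,\tfrac{2l_0+3}{2};\,\tfrac{1-\cos2\pi x}{2}\Bigr)$$ (a Jacobi polynomial), where the constant $\tilde c_m$ is chosen so that $\psi_m(x)=(\cos2\pi x)^m+(\text{lower degree terms in }\cos2\pi x)$. *)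

theory Defs
  imports "HOL-Complex_Analysis.Complex_Analysis"
begin

definition period_lattice :: "complex \<Rightarrow> complex set" where
  "period_lattice \<tau> = {of_int a + of_int b * \<tau> | a b. True}"

text \<open>The Weierstrass function with periods \<open>1\<close> and \<open>\<tau>\<close>. The lattice sum converges
  absolutely when \<open>\<tau>\<close> is not real and \<open>z\<close> is not a period; at the periods the value is
  meaningless.\<close>

definition wp :: "complex \<Rightarrow> complex \<Rightarrow> complex" where
  "wp \<tau> z = 1 / z ^ 2 + (\<Sum>\<^sub>\<infinity>\<omega>\<in>period_lattice \<tau> - {0}. 1 / (z - \<omega>) ^ 2 - 1 / \<omega> ^ 2)"

definition hamiltonian :: "nat \<Rightarrow> nat \<Rightarrow> complex \<Rightarrow> (complex \<Rightarrow> complex) \<Rightarrow> complex \<Rightarrow> complex" where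
  "hamiltonian l0 l1 \<tau> f x =
     - (deriv ^^ 2) f x
     + (of_nat (l0 * (l0 + 1)) * wp \<tau> x + of_nat (l1 * (l1 + 1)) * wp \<tau> (x + 1/2)) * f x"

definition hamiltonian_T :: "nat \<Rightarrow> nat \<Rightarrow> (complex \<Rightarrow> complex) \<Rightarrow> complex \<Rightarrow> complex" where
  "hamiltonian_T l0 l1 f x =
     - (deriv ^^ 2) f x
     + (of_nat (l0 * (l0 + 1)) * (of_real pi ^ 2 / sin (of_real pi * x) ^ 2)
        + of_nat (l1 * (l1 + 1)) * (of_real pi ^ 2 / cos (of_real pi * x) ^ 2)) * f x"

definition const_T :: "nat \<Rightarrow> nat \<Rightarrow> real" where
  "const_T l0 l1 = pi ^ 2 / 3 * real (l0 * (l0 + 1) + l1 * (l1 + 1))"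

text \<open>The extension of the Hamiltonian to \<open>p = 0\<close>.\<close>

definition hamiltonian_0 :: "nat \<Rightarrow> nat \<Rightarrow> (complex \<Rightarrow> complex) \<Rightarrow> complex \<Rightarrow> complex" where
  "hamiltonian_0 l0 l1 f x = hamiltonian_T l0 l1 f x - of_real (const_T l0 l1) * f x"

text \<open>For \<open>p = exp (2 \<pi> \<i> \<tau>)\<close> this is the strip \<open>\<bar>Im x\<bar> < Im \<tau>\<close>, and for \<open>p = 0\<close> it is the
  whole plane. The only singularities of the potential in it are the points \<open>n / 2\<close> with
  \<open>n\<close> an integer. It contains the real line whenever \<open>norm p < 1\<close>.\<close>

definition strip :: "complex \<Rightarrow> complex set" where
  "strip p = {x. norm p < exp (- 2 * pi * \<bar>Im x\<bar>)}"

definition half_integers :: "complex set" where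
  "half_integers = {of_int n / 2 | n. True}"

text \<open>The differential equation is imposed away from the singularities of the potential; the
  eigenfunction itself is required to be holomorphic also there.\<close>

definition eigenfunction_on ::
    "complex set \<Rightarrow> ((complex \<Rightarrow> complex) \<Rightarrow> complex \<Rightarrow> complex) \<Rightarrow> complex \<Rightarrow> (complex \<Rightarrow> complex) \<Rightarrow> bool" where
  "eigenfunction_on U H E f \<longleftrightarrow>
     f holomorphic_on U \<and> (\<exists>x\<in>U. f x \<noteq> 0) \<and> (\<forall>x\<in>U - half_integers. H f x = E * f x)"

definition Phi :: "nat \<Rightarrow> nat \<Rightarrow> complex \<Rightarrow> complex" where
  "Phi l0 l1 x = sin (of_real pi * x) ^ (l0 + 1) * cos (of_real pi * x) ^ (l1 + 1)"

definition hyp2F1 :: "complex \<Rightarrow> complex \<Rightarrow> complex \<Rightarrow> complex \<Rightarrow> complex" where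
  "hyp2F1 a b c z =
     (\<Sum>n. pochhammer a n * pochhammer b n / (pochhammer c n * fact n) * z ^ n)"

definition jacobi :: "nat \<Rightarrow> nat \<Rightarrow> nat \<Rightarrow> complex \<Rightarrow> complex" where
  "jacobi l0 l1 m x =
     hyp2F1 (- of_nat m) (of_nat (l0 + l1 + 2 + m)) (of_nat (2 * l0 + 3) / 2)
       ((1 - cos (2 * of_real pi * x)) / 2)"

definition jacobi_const :: "nat \<Rightarrow> nat \<Rightarrow> nat \<Rightarrow> complex" where
  "jacobi_const l0 l1 m =
     (THE c. \<exists>a :: nat \<Rightarrow> complex. \<forall>x. c * jacobi l0 l1 m x =
        cos (2 * of_real pi * x) ^ m + (\<Sum>k<m. a k * cos (2 * of_real pi * x) ^ k))"

definition psi :: "nat \<Rightarrow> nat \<Rightarrow> nat \<Rightarrow> complex \<Rightarrow> complex" where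
  "psi l0 l1 m x = jacobi_const l0 l1 m * jacobi l0 l1 m x"

end

theory Submission
  imports Defs
begin

text \<open>
  Conjugation by the ground state \<open>Phi\<close> turns the trigonometric Hamiltonian into an operator without
  singular potential, which acts on the cosines \<open>cos (2 \<pi> k x)\<close> by a triangular matrix: the diagonal
  grows like \<open>k\<^sup>2\<close>, the other entries grow only like \<open>k\<close> (\<open>gauged_cos_mode\<close>, \<open>hamiltonian_T_gauge\<close>). Its
  eigenvectors are the coefficients of the Jacobi polynomials (\<open>jacobi_cos_expansion\<close>). By the Fourier
  expansion of the Weierstrass function (\<open>wp_fourier\<close>) the rest of the potential is, up to a constant,
  a cosine series with coefficients of size \<open>n * norm p ^ n\<close>, and multiplication by it is a matrix
  concentrated near the diagonal.

  An eigenfunction \<open>Phi x * (\<Sum>k. a k * cos (2 \<pi> k x))\<close> of the Hamiltonian is therefore the same as a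
  rapidly decreasing eigenvector of an infinite matrix. For small \<open>p\<close> such an eigenvector is found by a
  contraction that starts at the Jacobi polynomial (\<open>eigenpair_iteration\<close>, \<open>hill_eigenpair\<close>). The
  iterates are holomorphic in \<open>p\<close> and converge uniformly, so eigenvalue and coefficients are holomorphic
  in \<open>p\<close>.

  The contraction yields decay of \<open>a k\<close> at one fixed exponential rate, hence a solution in a strip of
  fixed width only. Because the diagonal dominates every row of large index, decay at the fixed rate
  improves to decay at every rate below \<open>1 / norm p\<close> (\<open>decay_improvement\<close>, \<open>mode_decay\<close>). The series
  then converges on the full strip between the singularities of the potential off the real line, locally
  uniformly in \<open>x\<close> and \<open>p\<close>; this gives the differential equation (\<open>cos_series_ode\<close>), holomorphy in both
  variables, and convergence to \<open>Phi * psi\<close> uniformly on compact sets. Square integrability is clear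
  since the eigenfunction is continuous on the real line.
\<close>

section \<open>Holomorphic perturbation of an eigenvector of an infinite matrix\<close>

lemma holomorphic_on_suminf:
  fixes f :: "nat \<Rightarrow> complex \<Rightarrow> complex"
  assumes S: "open S" and hol: "\<And>n. f n holomorphic_on S"
    and bound: "\<And>n z. z \<in> S \<Longrightarrow> norm (f n z) \<le> M n" and M: "summable M"
  shows "(\<lambda>z. \<Sum>n. f n z) holomorphic_on S"
proof (rule holomorphic_uniform_sequence[OF S])
  show "(\<lambda>z. \<Sum>n<N. f n z) holomorphic_on S" for N
    by (intro holomorphic_on_sum hol)
  fix z assume "z \<in> S"
  then obtain d where d: "d > 0" "cball z d \<subseteq> S"
    using S open_contains_cball by blast
  have "uniform_limit (cball z d) (\<lambda>N z. \<Sum>n<N. f n z) (\<lambda>z. \<Sum>n. f n z) sequentially"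
    by (rule Weierstrass_m_test[OF _ M]) (use bound d in auto)
  with d show "\<exists>d>0. cball z d \<subseteq> S \<and>
      uniform_limit (cball z d) (\<lambda>N z. \<Sum>n<N. f n z) (\<lambda>z. \<Sum>n. f n z) sequentially"
    by blast
qed

lemma summable_mult_bounded:
  fixes r a :: "nat \<Rightarrow> complex"
  assumes "summable G" "\<And>j. norm (r j) \<le> G j" "\<And>j. norm (a j) \<le> B"
  shows "summable (\<lambda>j. r j * a j)" "norm (\<Sum>j. r j * a j) \<le> (\<Sum>j. G j) * B"
proof -
  have le: "norm (r j * a j) \<le> G j * B" for j
    unfolding norm_mult using assms(2)[of j] assms(3)[of j] by (intro mult_mono) (auto intro: order_trans[OF norm_ge_zero])
  have s: "summable (\<lambda>j. G j * B)" using assms(1) by (rule summable_mult2)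
  have n: "summable (\<lambda>j. norm (r j * a j))"
    by (rule summable_comparison_test'[OF s, of 0]) (use le in auto)
  then show "summable (\<lambda>j. r j * a j)" by (rule summable_norm_cancel)
  have "norm (\<Sum>j. r j * a j) \<le> (\<Sum>j. norm (r j * a j))" using n by (rule summable_norm)
  also have "\<dots> \<le> (\<Sum>j. G j * B)" by (intro suminf_le le n s)
  also have "\<dots> = (\<Sum>j. G j) * B" using suminf_mult2[OF assms(1)] by simp
  finally show "norm (\<Sum>j. r j * a j) \<le> (\<Sum>j. G j) * B" .
qed

text \<open>The equation studied is \<open>\<mu> k * a k + (\<Sum>j. R p k j * a j) = e * a k\<close> for a bounded sequence
  \<open>a\<close> and a number \<open>e\<close>. At \<open>p = 0\<close> it is solved by \<open>a = b\<close>, \<open>e = 0\<close>. All estimates are row sums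
  in the supremum norm, so no exchange of summations is needed. The rows are small compared with
  \<open>\<mu> k\<close>, already at \<open>p = 0\<close>; it is this smallness, and not the smallness of \<open>R p - R 0\<close>, that makes
  the iteration below converge.\<close>
locale eigenpair_iteration =
  fixes S :: "complex set" and R :: "complex \<Rightarrow> nat \<Rightarrow> nat \<Rightarrow> complex"
    and \<mu> b :: "nat \<Rightarrow> complex" and G :: "nat \<Rightarrow> nat \<Rightarrow> real" and m :: nat
  assumes S: "open S" "0 \<in> S"
    and hol_R: "\<And>k j. (\<lambda>p. R p k j) holomorphic_on S"
    and R_le: "\<And>p k j. p \<in> S \<Longrightarrow> norm (R p k j) \<le> G k j"
    and G_summable: "\<And>k. summable (G k)"
    and row_m: "(\<Sum>j. G m j) \<le> 1/10"
    and row: "\<And>k. k \<noteq> m \<Longrightarrow> (\<Sum>j. G k j) \<le> norm (\<mu> k) / 10"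
    and \<mu>_m: "\<mu> m = 0" and \<mu>_ge: "\<And>k. k \<noteq> m \<Longrightarrow> 1 \<le> norm (\<mu> k)"
    and b_m: "b m = 1" and b_le: "\<And>k. norm (b k) \<le> 1"
    and eigen_0: "\<And>k. \<mu> k * b k + (\<Sum>j. R 0 k j * b j) = 0"
begin

text \<open>With the normalisation \<open>a m = 1\<close> the row of index \<open>m\<close> reads \<open>e = shift p a\<close>, because \<open>\<mu> m = 0\<close>,
  and every other row can be divided by \<open>\<mu> k\<close>. The eigenvalue equation thereby becomes the fixed point
  equation \<open>a = step p a\<close>.\<close>
definition shift :: "complex \<Rightarrow> (nat \<Rightarrow> complex) \<Rightarrow> complex" where
  "shift p a = (\<Sum>j. R p m j * a j)"

definition step :: "complex \<Rightarrow> (nat \<Rightarrow> complex) \<Rightarrow> nat \<Rightarrow> complex" where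
  "step p a k = (if k = m then 1 else (shift p a * a k - (\<Sum>j. R p k j * a j)) / \<mu> k)"

primrec iter :: "nat \<Rightarrow> complex \<Rightarrow> nat \<Rightarrow> complex" where
  "iter 0 p = b"
| "iter (Suc n) p = step p (iter n p)"

lemma row_sum_summable:
  assumes "p \<in> S" "\<And>j. norm (a j) \<le> B"
  shows "summable (\<lambda>j. R p k j * a j)"
  using summable_mult_bounded(1)[OF G_summable R_le[OF assms(1)] assms(2)] .

lemma B_nonneg: "(\<And>j::nat. norm (a j :: complex) \<le> B) \<Longrightarrow> 0 \<le> B"
  using order_trans[OF norm_ge_zero] by blast

lemma row_sum_le:
  assumes "p \<in> S" "\<And>j. norm (a j) \<le> B" "k \<noteq> m"
  shows "norm (\<Sum>j. R p k j * a j) \<le> norm (\<mu> k) / 10 * B"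
  using summable_mult_bounded(2)[where a = a, OF G_summable R_le[OF assms(1)] assms(2), of k]
    mult_right_mono[OF row[OF assms(3)] B_nonneg[of a, OF assms(2)]] by linarith

lemma shift_le:
  assumes "p \<in> S" "\<And>j. norm (a j) \<le> B"
  shows "norm (shift p a) \<le> B / 10"
  unfolding shift_def
  using summable_mult_bounded(2)[where a = a, OF G_summable R_le[OF assms(1)] assms(2), of m]
    mult_right_mono[OF row_m B_nonneg[of a, OF assms(2)]] by linarith

lemma div_le:
  assumes "norm x \<le> A + norm (\<mu> k) * C" "0 \<le> A" "k \<noteq> m"
  shows "norm (x / \<mu> k) \<le> A + C"
proof -
  have "norm x \<le> (A + C) * norm (\<mu> k)"
    using assms mult_left_mono[OF \<mu>_ge[OF assms(3)] assms(2)] by (simp add: algebra_simps)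
  moreover have "0 < norm (\<mu> k)" using \<mu>_ge[OF assms(3)] by linarith
  ultimately show ?thesis by (simp add: norm_divide pos_divide_le_eq)
qed

text \<open>On the ball of radius 2 the quadratic term \<open>shift p a * a k\<close> has Lipschitz constant at most
  \<open>2/10 + 2/10\<close> and the linear term at most \<open>1/10\<close>, after division by \<open>\<mu> k\<close>.\<close>
lemma step_contracts:
  assumes p: "p \<in> S" and a: "\<And>j. norm (a j) \<le> 2" and a': "\<And>j. norm (a' j) \<le> 2"
    and d: "\<And>j. norm (a j - a' j) \<le> \<delta>"
  shows "norm (step p a k - step p a' k) \<le> \<delta> / 2"
proof (cases "k = m")
  case True
  then show ?thesis using B_nonneg[OF d] by (simp add: step_def)
next
  case False
  note d0 = B_nonneg[OF d]
  have diff: "(\<Sum>j. R p i j * a j) - (\<Sum>j. R p i j * a' j) = (\<Sum>j. R p i j * (a j - a' j))" for i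
    using suminf_diff[OF row_sum_summable[of p a 2 i] row_sum_summable[of p a' 2 i]] p a a'
    by (simp add: algebra_simps)
  have e: "norm (shift p a - shift p a') \<le> \<delta> / 10"
    using shift_le[OF p d] by (simp add: shift_def diff)
  have "norm (shift p a * (a k - a' k)) \<le> (2/10) * \<delta>"
    unfolding norm_mult by (intro mult_mono shift_le[OF p a] d) auto
  moreover have "norm ((shift p a - shift p a') * a' k) \<le> \<delta> / 10 * 2"
    unfolding norm_mult by (intro mult_mono e a') (use d0 in auto)
  moreover have "norm (\<Sum>j. R p k j * (a j - a' j)) \<le> norm (\<mu> k) / 10 * \<delta>"
    by (rule row_sum_le[OF p d False])
  moreover have "norm (x + y - z) \<le> norm x + norm y + norm z" for x y z :: complex by norm
  note this[of "shift p a * (a k - a' k)" "(shift p a - shift p a') * a' k" "\<Sum>j. R p k j * (a j - a' j)"]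
  ultimately have "norm (shift p a * (a k - a' k) + (shift p a - shift p a') * a' k
      - (\<Sum>j. R p k j * (a j - a' j))) \<le> 4/10 * \<delta> + norm (\<mu> k) * (\<delta>/10)"
    by simp
  then have "norm ((shift p a * (a k - a' k) + (shift p a - shift p a') * a' k
      - (\<Sum>j. R p k j * (a j - a' j))) / \<mu> k) \<le> 4/10 * \<delta> + \<delta>/10"
    by (rule div_le) (use False d0 in auto)
  moreover have "step p a k - step p a' k = (shift p a * (a k - a' k) + (shift p a - shift p a') * a' k
      - (\<Sum>j. R p k j * (a j - a' j))) / \<mu> k"
    unfolding diff[symmetric] using False by (simp add: step_def ring_distribs flip: diff_divide_distrib)
  ultimately show ?thesis by simp
qed

lemma step_b:
  assumes p: "p \<in> S"
  shows "norm (step p b k - b k) \<le> 1/2"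
proof (cases "k = m")
  case True
  then show ?thesis by (simp add: step_def b_m)
next
  case False
  have b_k: "b k = - (\<Sum>j. R 0 k j * b j) / \<mu> k"
    using eigen_0[of k] \<mu>_ge[OF False] by (auto simp: field_simps add_eq_0_iff)
  have "norm (shift p b * b k) \<le> (1/10) * 1"
    unfolding norm_mult by (intro mult_mono shift_le[OF p b_le] b_le) auto
  moreover have "norm (\<Sum>j. R p k j * b j) \<le> norm (\<mu> k) / 10 * 1"
    "norm (\<Sum>j. R 0 k j * b j) \<le> norm (\<mu> k) / 10 * 1"
    by (rule row_sum_le[OF _ b_le False]; use p S in simp)+
  moreover have "norm (x - y + z) \<le> norm x + norm y + norm z" for x y z :: complex by norm
  note this[of "shift p b * b k" "\<Sum>j. R p k j * b j" "\<Sum>j. R 0 k j * b j"]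
  ultimately have "norm (shift p b * b k - (\<Sum>j. R p k j * b j) + (\<Sum>j. R 0 k j * b j))
      \<le> 1/10 + norm (\<mu> k) * (2/10)"
    by linarith
  then have "norm ((shift p b * b k - (\<Sum>j. R p k j * b j) + (\<Sum>j. R 0 k j * b j)) / \<mu> k)
      \<le> 1/10 + 2/10"
    by (rule div_le) (use False in auto)
  moreover have "step p b k - b k
      = (shift p b * b k - (\<Sum>j. R p k j * b j) + (\<Sum>j. R 0 k j * b j)) / \<mu> k"
    using False b_k by (simp add: step_def add_divide_distrib diff_divide_distrib)
  ultimately show ?thesis by simp
qed

text \<open>Both bounds are proved by one induction: the first keeps the iterates in the ball on which the
  step is a contraction, and it is itself the geometric sum of the second.\<close>
lemma iter_bounds:
  assumes p: "p \<in> S"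
  shows "norm (iter n p k - b k) \<le> 1 - (1/2) ^ n"
    and "norm (iter (Suc n) p k - iter n p k) \<le> (1/2) ^ Suc n"
proof -
  have le2: "norm (a k) \<le> 2" if "norm (a k - b k) \<le> 1 - (1/2) ^ n" for a :: "nat \<Rightarrow> complex" and k n
  proof -
    have "norm (a k) \<le> norm (a k - b k) + norm (b k)" by norm
    also have "\<dots> \<le> 2" using that b_le[of k] by (smt (verit) zero_le_power zero_le_divide_1_iff)
    finally show ?thesis .
  qed
  have "\<forall>k. norm (iter n p k - b k) \<le> 1 - (1/2) ^ n \<and> norm (iter (Suc n) p k - iter n p k) \<le> (1/2) ^ Suc n"
  proof (induction n)
    case 0
    then show ?case using step_b[OF p] by simp
  next
    case (Suc n)
    have A: "norm (iter (Suc n) p k - b k) \<le> 1 - (1/2) ^ Suc n" for k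
    proof -
      have "norm (iter (Suc n) p k - b k) \<le> norm (iter (Suc n) p k - iter n p k) + norm (iter n p k - b k)"
        by norm
      also have "\<dots> \<le> (1/2) ^ Suc n + (1 - (1/2) ^ n)" using Suc.IH by (intro add_mono) blast+
      finally show ?thesis by simp
    qed
    have "norm (step p (iter (Suc n) p) k - step p (iter n p) k) \<le> (1/2) ^ Suc n / 2" for k
      by (rule step_contracts[OF p]) (use A Suc.IH le2 in blast)+
    with A show ?case by simp
  qed
  then show "norm (iter n p k - b k) \<le> 1 - (1/2) ^ n"
    and "norm (iter (Suc n) p k - iter n p k) \<le> (1/2) ^ Suc n" by blast+
qed

lemma iter_le:
  assumes "p \<in> S" shows "norm (iter n p k) \<le> 2"
proof -
  have "norm (iter n p k) \<le> norm (iter n p k - b k) + norm (b k)" by norm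
  also have "\<dots> \<le> 2" using iter_bounds(1)[OF assms, of n k] b_le[of k]
    by (smt (verit) zero_le_power zero_le_divide_1_iff)
  finally show ?thesis .
qed

lemma holomorphic_row:
  assumes "\<And>j. (\<lambda>p. a p j) holomorphic_on S" "\<And>p j. p \<in> S \<Longrightarrow> norm (a p j) \<le> B"
  shows "(\<lambda>p. \<Sum>j. R p k j * a p j) holomorphic_on S"
proof (rule holomorphic_on_suminf[OF S(1)])
  show "(\<lambda>p. R p k j * a p j) holomorphic_on S" for j by (intro holomorphic_on_mult hol_R assms)
  show "norm (R p k j * a p j) \<le> G k j * B" if "p \<in> S" for p j
    unfolding norm_mult using R_le[OF that] assms(2)[OF that]
    by (intro mult_mono) (auto intro: order_trans[OF norm_ge_zero])
  show "summable (\<lambda>j. G k j * B)" using G_summable by (rule summable_mult2)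
qed

lemma holomorphic_iter: "(\<lambda>p. iter n p k) holomorphic_on S"
proof (induction n arbitrary: k)
  case 0
  show ?case by simp
next
  case (Suc n)
  have "(\<lambda>p. shift p (iter n p)) holomorphic_on S" "(\<lambda>p. \<Sum>j. R p k j * iter n p j) holomorphic_on S"
    unfolding shift_def by (rule holomorphic_row[OF Suc.IH iter_le]; assumption)+
  then show ?case using Suc.IH \<mu>_ge[of k]
    by (cases "k = m") (auto simp: step_def intro!: holomorphic_intros)
qed

definition eigenvector :: "complex \<Rightarrow> nat \<Rightarrow> complex" where
  "eigenvector p k = b k + (\<Sum>n. iter (Suc n) p k - iter n p k)"

lemma iter_eq_sum: "iter n p k = b k + (\<Sum>i<n. iter (Suc i) p k - iter i p k)"
  by (subst sum_lessThan_telescope) simp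

lemma geometric_tail: "(\<lambda>i. (1/2::real) ^ Suc (i + n)) sums (1/2) ^ n"
  using sums_mult[OF power_half_series, of "(1/2) ^ n"] by (simp add: power_add mult.commute)

text \<open>The rate of convergence does not depend on \<open>p\<close> and \<open>k\<close>, which allows the step to be passed to
  the limit.\<close>
lemma eigenvector_approx:
  assumes p: "p \<in> S"
  shows "norm (eigenvector p k - iter n p k) \<le> (1/2) ^ n"
    and "(\<lambda>n. iter n p k) \<longlonglongrightarrow> eigenvector p k"
proof -
  let ?d = "\<lambda>i. iter (Suc i) p k - iter i p k"
  have "summable ?d"
    by (rule summable_comparison_test'[OF sums_summable[OF geometric_tail[of 0]], of 0])
       (use iter_bounds(2)[OF p] in simp)
  then have "eigenvector p k - iter n p k = (\<Sum>i. ?d (i + n))"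
    unfolding eigenvector_def iter_eq_sum[of n] suminf_minus_initial_segment[OF \<open>summable ?d\<close>] by simp
  moreover have "norm (\<Sum>i. ?d (i + n)) \<le> (\<Sum>i. (1/2) ^ Suc (i + n))"
    by (rule norm_suminf_le[OF iter_bounds(2)[OF p] sums_summable[OF geometric_tail]])
  ultimately show "norm (eigenvector p k - iter n p k) \<le> (1/2) ^ n"
    using geometric_tail[of n] by (simp add: sums_iff)
  show "(\<lambda>n. iter n p k) \<longlonglongrightarrow> eigenvector p k"
    unfolding eigenvector_def using tendsto_add[OF tendsto_const summable_LIMSEQ[OF \<open>summable ?d\<close>], of "b k"]
    by (simp only: iter_eq_sum[symmetric])
qed

lemma eigenvector_le: "p \<in> S \<Longrightarrow> norm (eigenvector p k) \<le> 2"
  using LIMSEQ_le_const2[OF tendsto_norm[OF eigenvector_approx(2)]] iter_le by blast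

lemma holomorphic_eigenvector: "(\<lambda>p. eigenvector p k) holomorphic_on S"
  unfolding eigenvector_def
proof (intro holomorphic_on_add holomorphic_on_const holomorphic_on_suminf[OF S(1)])
  show "(\<lambda>p. iter (Suc n) p k - iter n p k) holomorphic_on S" for n
    by (intro holomorphic_on_diff holomorphic_iter)
  show "norm (iter (Suc n) p k - iter n p k) \<le> (1/2) ^ Suc (n + 0)" if "p \<in> S" for n p
    using iter_bounds(2)[OF that] by simp
  show "summable (\<lambda>n. (1/2::real) ^ Suc (n + 0))" by (rule sums_summable[OF geometric_tail])
qed

lemma eigenvector_fixed:
  assumes p: "p \<in> S"
  shows "step p (eigenvector p) k = eigenvector p k"
proof -
  have "norm (step p (eigenvector p) k - iter (Suc n) p k) \<le> (1/2) ^ n / 2" for n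
    unfolding iter.simps
    by (rule step_contracts[OF p eigenvector_le[OF p] iter_le[OF p] eigenvector_approx(1)[OF p]])
  then have "\<forall>\<^sub>F n in sequentially. norm (step p (eigenvector p) k - iter (Suc n) p k) \<le> (1/2) ^ n / 2"
    by (rule always_eventually[OF allI])
  moreover have "(\<lambda>n. (1/2::real) ^ n / 2) \<longlonglongrightarrow> 0"
    by (rule tendsto_divide_zero[OF LIMSEQ_realpow_zero]) auto
  ultimately have "(\<lambda>n. step p (eigenvector p) k - iter (Suc n) p k) \<longlonglongrightarrow> 0"
    by (rule Lim_null_comparison)
  then have "(\<lambda>n. step p (eigenvector p) k - (step p (eigenvector p) k - iter (Suc n) p k))
      \<longlonglongrightarrow> step p (eigenvector p) k - 0"
    by (intro tendsto_diff tendsto_const)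
  then have "(\<lambda>n. iter (Suc n) p k) \<longlonglongrightarrow> step p (eigenvector p) k"
    by simp
  then show ?thesis
    using LIMSEQ_unique LIMSEQ_Suc[OF eigenvector_approx(2)[OF p]] by blast
qed

lemma step_0_b: "step 0 b = b"
proof
  fix k
  have "shift 0 b = 0" using eigen_0[of m] \<mu>_m by (simp add: shift_def)
  then show "step 0 b k = b k"
    using eigen_0[of k] \<mu>_ge[of k] b_m by (auto simp: step_def field_simps add_eq_0_iff)
qed

theorem holomorphic_eigenpair:
  obtains e a where "e holomorphic_on S" "\<And>k. (\<lambda>p. a p k) holomorphic_on S"
    "\<And>p k. p \<in> S \<Longrightarrow> norm (a p k) \<le> 2" "\<And>p. p \<in> S \<Longrightarrow> norm (e p) \<le> 1" "e 0 = 0" "a 0 = b"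
    "\<And>p. p \<in> S \<Longrightarrow> a p m = 1"
    "\<And>p k. p \<in> S \<Longrightarrow> \<mu> k * a p k + (\<Sum>j. R p k j * a p j) = e p * a p k"
proof
  show "(\<lambda>p. shift p (eigenvector p)) holomorphic_on S"
    unfolding shift_def by (rule holomorphic_row[OF holomorphic_eigenvector eigenvector_le])
  show "norm (shift p (eigenvector p)) \<le> 1" if "p \<in> S" for p
    using shift_le[of p "eigenvector p", OF that eigenvector_le[OF that]] by simp
  have "iter n 0 = b" for n by (induction n) (use step_0_b in auto)
  then show b: "eigenvector 0 = b" unfolding eigenvector_def by (simp del: iter.simps)
  show "shift 0 (eigenvector 0) = 0" using eigen_0[of m] \<mu>_m by (simp add: shift_def b)
  show "eigenvector p m = 1" if "p \<in> S" for p
    using eigenvector_fixed[OF that, of m] by (simp add: step_def)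
  then show "\<mu> k * eigenvector p k + (\<Sum>j. R p k j * eigenvector p j) = shift p (eigenvector p) * eigenvector p k"
    if "p \<in> S" for p k
  proof (cases "k = m")
    case False
    then have "\<mu> k \<noteq> 0" using \<mu>_ge[of k] by auto
    then show ?thesis using eigenvector_fixed[OF that, of k] False
      by (simp add: step_def divide_eq_eq) (simp add: algebra_simps)
  qed (use that \<mu>_m in \<open>simp add: shift_def\<close>)
  show "(\<lambda>p. eigenvector p k) holomorphic_on S" for k by (rule holomorphic_eigenvector)
  show "norm (eigenvector p k) \<le> 2" if "p \<in> S" for p k by (rule eigenvector_le[OF that])
qed

end

section \<open>Exponential decay of eigenvectors\<close>

text \<open>A bootstrap. Only decay at the rate \<open>\<sigma>\<close> is known at first, but far down the rows are dominated by
  their diagonal even when the entries below the diagonal are weighted with the better rate \<open>\<rho>\<close>.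
  Measured in such weights, the tail of the sequence is at most half of the largest weighted entry,
  so the head controls everything. The bound \<open>B\<close> depends on the head alone.\<close>
lemma decay_improvement:
  fixes a c :: "nat \<Rightarrow> complex" and R :: "nat \<Rightarrow> nat \<Rightarrow> complex"
  assumes \<rho>: "0 < \<sigma>" "\<sigma> \<le> \<rho>"
    and a0: "\<And>k. norm (a k) * \<sigma> ^ k \<le> A"
    and eq: "\<And>k. k \<ge> N \<Longrightarrow> c k * a k = (\<Sum>j. R k j * a j)"
    and up: "\<And>k j. k \<ge> N \<Longrightarrow> k \<le> j \<Longrightarrow> norm (R k j) \<le> G k j * \<sigma> ^ (j - k)"
    and low: "\<And>k j. k \<ge> N \<Longrightarrow> j \<le> k \<Longrightarrow> norm (R k j) * \<rho> ^ (k - j) \<le> G k j"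
    and G: "\<And>k. k \<ge> N \<Longrightarrow> summable (G k)" "\<And>k. k \<ge> N \<Longrightarrow> (\<Sum>j. G k j) \<le> norm (c k) / 2"
    and c: "\<And>k. k \<ge> N \<Longrightarrow> c k \<noteq> 0"
    and head: "\<And>k. k < N \<Longrightarrow> norm (a k) * \<rho> ^ k \<le> B" and B: "0 \<le> B"
  shows "norm (a K) * \<rho> ^ K \<le> B"
proof -
  \<comment> \<open>The weights grow like \<open>\<rho> ^ k\<close> only up to \<open>K\<close> and like \<open>\<sigma> ^ k\<close> afterwards, so that the weighted
    supremum is finite by the known decay; the resulting bound does not depend on \<open>K\<close>.\<close>
  define c' where "c' = \<rho> / \<sigma>"
  define w where "w k = c' ^ min k K * \<sigma> ^ k" for k
  have c': "1 \<le> c'" "\<rho> = c' * \<sigma>" using \<rho> by (simp_all add: c'_def)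
  have w_pos: "w k > 0" for k using \<rho> c' by (simp add: w_def)
  have w_le: "w k \<le> \<rho> ^ k" for k
    unfolding c'(2) power_mult_distrib w_def using \<rho> c' by (intro mult_right_mono power_increasing) auto
  have w_up: "\<sigma> ^ (j - k) * w k \<le> w j" if "k \<le> j" for k j
  proof -
    have "\<sigma> ^ j = \<sigma> ^ (j - k) * \<sigma> ^ k" using that by (simp flip: power_add)
    then have "\<sigma> ^ (j - k) * w k = c' ^ min k K * \<sigma> ^ j" by (simp add: w_def)
    also have "\<dots> \<le> c' ^ min j K * \<sigma> ^ j"
      using \<rho> c' that by (intro mult_right_mono power_increasing) auto
    finally show ?thesis by (simp add: w_def)
  qed
  have w_low: "w k \<le> \<rho> ^ (k - j) * w j" if "j \<le> k" for k j
  proof -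
    have "w k \<le> c' ^ ((k - j) + min j K) * \<sigma> ^ k"
      unfolding w_def using \<rho> c' that by (intro mult_right_mono power_increasing) auto
    also have "\<sigma> ^ k = \<sigma> ^ (k - j) * \<sigma> ^ j" using that by (simp flip: power_add)
    finally show ?thesis by (simp add: w_def c'(2) power_mult_distrib power_add mult_ac)
  qed
  have Rw: "norm (R k j) * w k \<le> G k j * w j" if "k \<ge> N" for k j
  proof (cases "k \<le> j")
    case True
    have Gn: "0 \<le> G k j"
      using order_trans[OF norm_ge_zero up[OF that True]] \<rho>
      by (meson zero_le_mult_iff zero_less_power not_le)
    have "norm (R k j) * w k \<le> (G k j * \<sigma> ^ (j - k)) * w k"
      by (intro mult_right_mono up that True less_imp_le w_pos)
    also have "\<dots> \<le> G k j * w j" using mult_left_mono[OF w_up[OF True] Gn] by (simp add: mult_ac)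
    finally show ?thesis .
  next
    case False
    have "norm (R k j) * w k \<le> norm (R k j) * (\<rho> ^ (k - j) * w j)"
      using False by (intro mult_left_mono w_low) auto
    also have "\<dots> \<le> G k j * w j"
      using mult_right_mono[OF low[OF that, of j] less_imp_le[OF w_pos]] False by (simp add: mult_ac)
    finally show ?thesis .
  qed
  define s where "s = (SUP k. norm (a k) * w k)"
  have bdd: "bdd_above (range (\<lambda>k. norm (a k) * w k))"
  proof (rule bdd_aboveI2)
    fix k
    have "norm (a k) * w k = c' ^ min k K * (norm (a k) * \<sigma> ^ k)" by (simp add: w_def)
    also have "\<dots> \<le> c' ^ K * A"
      using a0[of k] \<rho> c' by (intro mult_mono power_increasing) auto
    finally show "norm (a k) * w k \<le> c' ^ K * A" .
  qed
  have le_s: "norm (a k) * w k \<le> s" for k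
    unfolding s_def by (intro cSUP_upper bdd) auto
  have tail: "norm (a k) * w k \<le> s / 2" if k: "k \<ge> N" for k
  proof -
    have ineq: "norm (R k j * a j) * w k \<le> G k j * s" for j
    proof -
      have "0 \<le> G k j * w j" by (rule order_trans[OF _ Rw[OF k]]) (simp add: less_imp_le w_pos)
      then have Gn: "0 \<le> G k j" using w_pos[of j] by (simp add: zero_le_mult_iff)
      have "norm (R k j * a j) * w k = (norm (R k j) * w k) * norm (a j)" by (simp add: norm_mult)
      also have "\<dots> \<le> (G k j * w j) * norm (a j)" by (intro mult_right_mono Rw k) auto
      also have "\<dots> = G k j * (norm (a j) * w j)" by simp
      also have "\<dots> \<le> G k j * s" by (intro mult_left_mono le_s Gn)
      finally show ?thesis .
    qed
    have sG: "summable (\<lambda>j. G k j * s)" using G(1)[OF k] by (rule summable_mult2)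
    have sR': "summable (\<lambda>j. norm (R k j * a j) * w k)"
      by (rule summable_comparison_test'[OF sG, of 0]) (use ineq w_pos in \<open>auto simp: less_imp_le\<close>)
    then have sR: "summable (\<lambda>j. norm (R k j * a j))"
      using w_pos[of k] summable_mult_D[of "w k" "\<lambda>j. norm (R k j * a j)"] by (simp add: mult.commute)
    have "norm (c k) * (norm (a k) * w k) = norm (\<Sum>j. R k j * a j) * w k"
      by (simp add: norm_mult flip: eq[OF k])
    also have "\<dots> \<le> (\<Sum>j. norm (R k j * a j)) * w k"
      by (intro mult_right_mono summable_norm sR less_imp_le w_pos)
    also have "\<dots> = (\<Sum>j. norm (R k j * a j) * w k)" by (rule suminf_mult2[OF sR])
    also have "\<dots> \<le> (\<Sum>j. G k j * s)" by (intro suminf_le ineq sR' sG)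
    also have "\<dots> = (\<Sum>j. G k j) * s" using suminf_mult2[OF G(1)[OF k]] by simp
    also have "\<dots> \<le> norm (c k) / 2 * s"
      using G(2)[OF k] order_trans[OF _ le_s[of 0]] w_pos[of 0] by (intro mult_right_mono) auto
    finally show ?thesis using c[OF k] by simp
  qed
  have "s \<le> max B (s / 2)"
    unfolding s_def
  proof (rule cSUP_least, simp)
    fix k :: nat
    have "norm (a k) * w k \<le> B" if "k < N"
      using mult_left_mono[OF w_le[of k], of "norm (a k)"] head[OF that] by simp
    then show "norm (a k) * w k \<le> max B ((SUP k. norm (a k) * w k) / 2)"
      using tail[of k] unfolding s_def by (cases "k < N") auto
  qed
  then have "s \<le> B" using B by auto
  with le_s[of K] show ?thesis by (simp add: w_def c'(2) power_mult_distrib)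
qed

section \<open>Summation lemmas\<close>

lemma double_series_swap:
  fixes f :: "nat \<Rightarrow> nat \<Rightarrow> complex"
  assumes col: "\<And>j. summable (\<lambda>i. norm (f i j))" "\<And>j. (\<Sum>i. norm (f i j)) \<le> H j" and H: "summable H"
  shows "(\<lambda>i. \<Sum>j. f i j) sums (\<Sum>j. \<Sum>i. f i j)" and "summable (\<lambda>j. norm (f i j))"
    and "summable (\<lambda>j. \<Sum>i. f i j)"
proof -
  have infsum_suminf: "infsum g UNIV = suminf g" if "g summable_on UNIV" for g :: "nat \<Rightarrow> 'a::banach"
    using has_sum_imp_sums[OF has_sum_infsum[OF that]] by (simp add: sums_iff)
  have n_col: "(\<lambda>i. norm (f i j)) summable_on UNIV" for j
    using col(1) by (subst summable_on_UNIV_nonneg_real_iff) auto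
  have n_tot: "(\<lambda>j. \<Sum>i. norm (f i j)) summable_on UNIV"
  proof (subst summable_on_UNIV_nonneg_real_iff)
    show "summable (\<lambda>j. \<Sum>i. norm (f i j))"
      by (rule summable_comparison_test'[OF H, of 0]) (use col in \<open>auto simp: suminf_nonneg\<close>)
  qed (use col in \<open>auto simp: suminf_nonneg\<close>)
  have S: "(\<lambda>x. norm ((\<lambda>(j, i). f i j) x)) summable_on UNIV \<times> UNIV"
    unfolding Infinite_Sum.abs_summable_on_Sigma_iff
    using n_col n_tot by (simp add: infsum_suminf suminf_nonneg col)
  have S': "(\<lambda>x. norm ((\<lambda>(i, j). f i j) x)) summable_on UNIV \<times> UNIV"
    by (subst product_swap[symmetric], subst summable_on_reindex) (use S in \<open>auto simp: o_def case_prod_beta\<close>)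
  have n_row: "(\<lambda>j. norm (f i j)) summable_on UNIV" for i
    using S' unfolding Infinite_Sum.abs_summable_on_Sigma_iff by simp
  then show "summable (\<lambda>j. norm (f i j))" by (rule summable_on_imp_summable)
  have row: "(f i) summable_on UNIV" for i using n_row by (rule abs_summable_summable)
  have col': "(\<lambda>i. f i j) summable_on UNIV" for j using n_col by (rule abs_summable_summable)
  have sum1: "(\<lambda>i. infsum (f i) UNIV) summable_on UNIV"
    using summable_on_Sigma_banach[OF abs_summable_summable[OF S']] by simp
  have sum2: "(\<lambda>j. infsum (\<lambda>i. f i j) UNIV) summable_on UNIV"
    using summable_on_Sigma_banach[OF abs_summable_summable[OF S]] by simp
  have "((\<lambda>i. infsum (f i) UNIV) has_sum (\<Sum>\<^sub>\<infinity>j. \<Sum>\<^sub>\<infinity>i. f i j)) UNIV"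
    using has_sum_infsum[OF sum1] infsum_swap_banach[OF abs_summable_summable[OF S']] by simp
  from has_sum_imp_sums[OF this] show "(\<lambda>i. \<Sum>j. f i j) sums (\<Sum>j. \<Sum>i. f i j)"
    using infsum_suminf[OF row] infsum_suminf[OF col'] infsum_suminf[OF sum2] by simp
  show "summable (\<lambda>j. \<Sum>i. f i j)"
    using summable_on_imp_summable[OF sum2] infsum_suminf[OF col'] by simp
qed

lemma sums_nat_mult_power:
  fixes z :: "'a::{real_normed_field,banach}"
  assumes "norm z < 1"
  shows "(\<lambda>n. of_nat n * z ^ n) sums (z / (1 - z) ^ 2)"
proof -
  have "(\<lambda>n. of_nat (Suc n) * z ^ Suc n) sums (z / (1 - z) ^ 2)"
    using sums_mult[OF geometric_deriv_sums[OF assms], of z] by (simp add: mult_ac)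
  then show ?thesis using sums_Suc_iff[of "\<lambda>n. of_nat n * z ^ n" "z / (1 - z) ^ 2"] by simp
qed

lemma summable_nat_mult_power: "\<bar>s\<bar> < 1 \<Longrightarrow> summable (\<lambda>n. real n * s ^ n)" for s :: real
  using sums_summable[OF sums_nat_mult_power[of s]] by simp

lemma has_sum_int_from_nat:
  fixes f :: "int \<Rightarrow> 'a::{comm_monoid_add,topological_comm_monoid_add}"
  assumes "((\<lambda>n. f (int n)) has_sum A) UNIV" "((\<lambda>n. f (- int (Suc n))) has_sum B) UNIV"
  shows "(f has_sum (A + B)) UNIV"
proof -
  have 1: "(f has_sum A) (range int)"
    using assms(1) by (subst has_sum_reindex) (auto simp: o_def)
  have 2: "(f has_sum B) (range (\<lambda>n. - int (Suc n)))"
    using assms(2) by (subst has_sum_reindex) (auto simp: o_def inj_on_def)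
  have "n \<in> range int \<union> range (\<lambda>n. - int (Suc n))" for n :: int
    by (cases n rule: int_cases) auto
  then have U: "range int \<union> range (\<lambda>n. - int (Suc n)) = UNIV" by blast
  have "range int \<inter> range (\<lambda>n. - int (Suc n)) = {}" by auto
  from has_sum_Un_disjoint[OF 1 2 this] show ?thesis by (simp only: U)
qed

section \<open>Fourier expansion of the Weierstrass function\<close>

lemma nonpos_Ints_imp_Ints: "z \<in> \<int>\<^sub>\<le>\<^sub>0 \<Longrightarrow> z \<in> \<int>"
  by (auto elim!: nonpos_Ints_cases)

text \<open>The second logarithmic derivative of the reflection formula
  \<open>\<Gamma>(z) \<Gamma>(1 - z) = \<pi> / sin (\<pi> z)\<close>. It is the partial fraction expansion of the squared cosecant in
  disguise, since \<open>Polygamma 1\<close> is the sum of \<open>1 / (z + n)\<^sup>2\<close> over the natural numbers \<open>n\<close>.\<close>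
lemma Polygamma_1_reflection:
  fixes z :: complex
  assumes "z \<notin> \<int>"
  shows "Polygamma 1 z + Polygamma 1 (1 - z) = of_real pi ^ 2 / sin (of_real pi * z) ^ 2"
proof -
  have nz: "z \<notin> \<int>\<^sub>\<le>\<^sub>0" "1 - z \<notin> \<int>\<^sub>\<le>\<^sub>0" "sin (of_real pi * z) \<noteq> 0" if "z \<notin> \<int>" for z :: complex
  proof -
    show "z \<notin> \<int>\<^sub>\<le>\<^sub>0" using that nonpos_Ints_imp_Ints by blast
    show "1 - z \<notin> \<int>\<^sub>\<le>\<^sub>0"
    proof
      assume "1 - z \<in> \<int>\<^sub>\<le>\<^sub>0"
      from Ints_diff[OF Ints_1 nonpos_Ints_imp_Ints[OF this]] show False using that by simp
    qed
    show "sin (of_real pi * z) \<noteq> 0"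
    proof
      assume "sin (of_real pi * z) = 0"
      then obtain n :: int where "of_real pi * z = of_real (of_int n * pi)" using sin_eq_0 by blast
      then have "of_real pi * z = of_real pi * of_int n" by simp
      then have "z = of_int n" by simp
      then show False using that by simp
    qed
  qed
  have op: "open (- \<int> :: complex set)" using closed_Ints by (rule open_Compl)
  have digamma: "Digamma z - Digamma (1 - z) = - of_real pi * (cos (of_real pi * z) / sin (of_real pi * z))"
    if z: "z \<notin> \<int>" for z :: complex
  proof -
    have "((\<lambda>z. Gamma z * Gamma (1 - z)) has_field_derivative
        Gamma z * Digamma z * Gamma (1 - z) - Gamma z * (Gamma (1 - z) * Digamma (1 - z))) (at z)"
      by (rule derivative_eq_intros refl | use nz[OF z] in blast)+ (simp add: algebra_simps)
    then have 1: "((\<lambda>z. of_real pi / sin (of_real pi * z)) has_field_derivative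
        Gamma z * Gamma (1 - z) * (Digamma z - Digamma (1 - z))) (at z)"
      unfolding Gamma_reflection_complex[symmetric] by (simp add: algebra_simps)
    have 2: "((\<lambda>z. of_real pi / sin (of_real pi * z)) has_field_derivative
        - (of_real pi * (cos (of_real pi * z) * of_real pi)) / sin (of_real pi * z) ^ 2) (at z)"
      by (rule derivative_eq_intros refl | use nz[OF z] in \<open>simp add: power2_eq_square\<close>)+
    have "of_real pi / sin (of_real pi * z) * (Digamma z - Digamma (1 - z)) =
        - (of_real pi * (cos (of_real pi * z) * of_real pi)) / sin (of_real pi * z) ^ 2"
      using DERIV_unique[OF 1 2] by (simp add: Gamma_reflection_complex)
    note eq = this
    have alg: "x = - P * (c / s)" if "P / s * x = - (P * (c * P)) / s ^ 2" "s \<noteq> 0" "P \<noteq> 0" for P s c x :: complex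
    proof -
      have "x * s = (P / s * x) * (s ^ 2 / P)" using that(2,3) by (simp add: power2_eq_square)
      also have "\<dots> = (- (P * (c * P)) / s ^ 2) * (s ^ 2 / P)" by (simp only: that(1))
      also have "\<dots> = - (c * P)" using that(2,3) by (simp add: power2_eq_square)
      finally have "x * s = - P * c" by simp
      then have "x = - P * c / s" using that(2) nonzero_eq_divide_eq by blast
      then show ?thesis by simp
    qed
    show ?thesis by (rule alg[OF eq nz(3)[OF z]]) simp
  qed
  have 1: "((\<lambda>z. Digamma z - Digamma (1 - z)) has_field_derivative
      Polygamma 1 z + Polygamma 1 (1 - z)) (at z)"
    by (rule derivative_eq_intros refl | use nz[OF assms] in blast)+ simp
  define c s where "c = cos (of_real pi * z)" and "s = sin (of_real pi * z)"
  have "((\<lambda>z. - of_real pi * (cos (of_real pi * z) / sin (of_real pi * z))) has_field_derivative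
      - of_real pi * ((- s * of_real pi * s - c * (c * of_real pi)) / (s * s))) (at z)"
    unfolding c_def s_def by (rule derivative_eq_intros refl | use nz[OF assms] in blast)+ simp
  moreover have "- of_real pi * ((- s * of_real pi * s - c * (c * of_real pi)) / (s * s)) = of_real pi ^ 2 / s ^ 2"
  proof -
    have "- s * of_real pi * s - c * (c * of_real pi) = - of_real pi * (s ^ 2 + c ^ 2)"
      by (simp add: algebra_simps power2_eq_square)
    also have "s ^ 2 + c ^ 2 = 1" unfolding c_def s_def by (rule sin_cos_squared_add)
    finally show ?thesis by (simp add: power2_eq_square)
  qed
  ultimately have 2: "((\<lambda>z. - of_real pi * (cos (of_real pi * z) / sin (of_real pi * z))) has_field_derivative
      of_real pi ^ 2 / sin (of_real pi * z) ^ 2) (at z)"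
    by (simp only: s_def)
  have 3: "((\<lambda>z. Digamma z - Digamma (1 - z)) has_field_derivative
      of_real pi ^ 2 / sin (of_real pi * z) ^ 2) (at z)"
    by (rule has_field_derivative_transform_within_open[OF 2 op]) (use assms digamma in auto)
  show ?thesis by (rule DERIV_unique[OF 1 3])
qed

lemma summable_inverse_squares_shift: "summable (\<lambda>n. norm (inverse ((z + of_nat n) ^ 2 :: complex)))"
proof (rule summable_comparison_test_ev)
  have "summable (\<lambda>n. inverse (real n ^ 2))" by (rule inverse_power_summable) simp
  then show "summable (\<lambda>n. 4 * inverse (real n ^ 2))" by (rule summable_mult)
  show "\<forall>\<^sub>F n in sequentially. norm (norm (inverse ((z + of_nat n) ^ 2))) \<le> 4 * inverse (real n ^ 2)"
    using eventually_ge_at_top[of "nat \<lceil>2 * norm z\<rceil> + 1"]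
  proof eventually_elim
    case (elim n)
    then have n: "real n \<ge> 2 * norm z" "real n > 0" by linarith+
    have "real n \<le> norm (z + of_nat n) + norm z" using norm_triangle_ineq4[of "z + of_nat n" z] by simp
    then have "real n / 2 \<le> norm (z + of_nat n)" using n by simp
    then have "(real n / 2) ^ 2 \<le> norm (z + of_nat n) ^ 2" using n by (intro power_mono) auto
    then have "inverse (norm (z + of_nat n) ^ 2) \<le> inverse ((real n / 2) ^ 2)"
      using n by (intro le_imp_inverse_le) auto
    then have "inverse (norm (z + of_nat n) ^ 2) \<le> 4 / real n ^ 2" by (simp add: power_divide)
    also have "\<dots> = 4 * inverse (real n ^ 2)" by (rule divide_inverse)
    finally show ?case by (simp only: norm_inverse norm_power real_norm_def abs_norm_cancel abs_inverse power_abs)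
  qed
qed

lemma has_sum_inverse_squares_int:
  fixes z :: complex
  assumes "z \<notin> \<int>"
  shows "((\<lambda>a::int. 1 / (z - of_int a) ^ 2) has_sum (of_real pi ^ 2 / sin (of_real pi * z) ^ 2)) UNIV"
proof -
  have P: "((\<lambda>n::nat. 1 / (w + of_nat n) ^ 2) has_sum Polygamma 1 w) UNIV" if "w \<notin> \<int>" for w :: complex
  proof (rule norm_summable_imp_has_sum)
    show "summable (\<lambda>n. norm (1 / (w + of_nat n) ^ 2))"
      using summable_inverse_squares_shift[of w] by (simp add: inverse_eq_divide)
    show "(\<lambda>n. 1 / (w + of_nat n) ^ 2) sums Polygamma 1 w"
      using Polygamma_LIMSEQ[of w 1] that by (cases "w = 0") (auto simp: inverse_eq_divide numeral_2_eq_2)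
  qed
  have "1 - z \<notin> \<int>" using assms Ints_diff[of 1 "1 - z"] by auto
  from P[OF this] have 1: "((\<lambda>n. 1 / (z - of_int (int (Suc n))) ^ 2) has_sum Polygamma 1 (1 - z)) UNIV"
    by (simp add: power2_commute algebra_simps)
  from P[OF assms] have 2: "((\<lambda>n. 1 / (z + of_int (int n)) ^ 2) has_sum Polygamma 1 z) UNIV" by simp
  have "((\<lambda>a. 1 / (z - of_int (- a)) ^ 2) has_sum (Polygamma 1 z + Polygamma 1 (1 - z))) UNIV"
    by (rule has_sum_int_from_nat) (use 1 2 in \<open>simp_all add: add.commute\<close>)
  then have "((\<lambda>a. 1 / (z - of_int a) ^ 2) has_sum (Polygamma 1 z + Polygamma 1 (1 - z))) UNIV"
    using has_sum_reindex[of "uminus :: int \<Rightarrow> int" UNIV "\<lambda>a. 1 / (z - of_int a) ^ 2"] by (simp add: o_def)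
  then show ?thesis using Polygamma_1_reflection[OF assms] by simp
qed

text \<open>The term of index 0 is \<open>1 / 0 = 0\<close>, hence the value is \<open>2 * \<zeta>(2)\<close>.\<close>
lemma has_sum_zeta_2_int:
  "((\<lambda>a::int. 1 / (of_int a) ^ 2 :: complex) has_sum (of_real pi ^ 2 / 3)) UNIV"
proof -
  have "(\<lambda>n. of_real (1 / (real n + 1) ^ 2) :: complex) sums of_real (pi ^ 2 / 6)"
    by (subst sums_of_real_iff) (use inverse_squares_sums in \<open>simp add: add.commute\<close>)
  then have s: "(\<lambda>n. 1 / (of_nat (Suc n)) ^ 2 :: complex) sums (of_real pi ^ 2 / 6)" by (simp add: add.commute)
  have n: "summable (\<lambda>n. norm (1 / (of_nat (Suc n)) ^ 2 :: complex))"
    using summable_inverse_squares_shift[of 1] by (simp add: inverse_eq_divide)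
  have 1: "((\<lambda>n. 1 / (of_nat (Suc n)) ^ 2 :: complex) has_sum (of_real pi ^ 2 / 6)) UNIV"
    by (rule norm_summable_imp_has_sum[OF n s])
  have s0: "(\<lambda>n. 1 / (of_nat n) ^ 2 :: complex) sums (of_real pi ^ 2 / 6)"
    using s sums_Suc_iff[of "\<lambda>n. 1 / (of_nat n) ^ 2 :: complex"] by simp
  have n0: "summable (\<lambda>n. norm (1 / (of_nat n) ^ 2 :: complex))"
    using n summable_Suc_iff[of "\<lambda>n. norm (1 / (of_nat n) ^ 2 :: complex)"] by simp
  have 2: "((\<lambda>n. 1 / (of_nat n) ^ 2 :: complex) has_sum (of_real pi ^ 2 / 6)) UNIV"
    by (rule norm_summable_imp_has_sum[OF n0 s0])
  have "((\<lambda>a::int. 1 / (of_int a) ^ 2 :: complex) has_sum (of_real pi ^ 2 / 6 + of_real pi ^ 2 / 6)) UNIV"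
    by (rule has_sum_int_from_nat)
       (use 1 2 in \<open>simp_all add: power2_commute[of "- 1"] flip: of_nat_Suc del: of_nat_Suc add: minus_add_distrib\<close>)
  then show ?thesis by simp
qed

text \<open>In terms of \<open>q = exp (2 \<pi> \<i> z)\<close> the right-hand side is \<open>q / (1 - q)\<^sup>2\<close>, the generating function
  of the natural numbers.\<close>
lemma inverse_sin_sq_expansion:
  fixes z :: complex
  assumes "Im z > 0"
  shows "(\<lambda>n. of_nat n * exp (2 * of_real pi * \<i> * z) ^ n) sums
    (- 1 / (4 * sin (of_real pi * z) ^ 2))"
proof -
  define w where "w = exp (\<i> * (of_real pi * z))"
  define q where "q = exp (2 * of_real pi * \<i> * z)"
  have q: "q = w ^ 2" by (simp add: q_def w_def mult_ac flip: exp_double)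
  have w0: "w \<noteq> 0" by (simp add: w_def)
  have q0: "q \<noteq> 0" by (simp add: q_def)
  have nq: "norm q < 1" using assms by (simp add: q_def)
  then have q1: "q \<noteq> 1" by auto
  note 1 = sums_nat_mult_power[OF nq]
  have e: "exp (- (\<i> * (of_real pi * z))) = 1 / w" by (simp add: w_def exp_minus divide_inverse)
  have "sin (of_real pi * z) = (w - 1 / w) / (2 * \<i>)"
    unfolding sin_exp_eq e by (simp add: w_def)
  also have "\<dots> = (q - 1) / (2 * \<i> * w)" using w0 by (simp add: q field_simps power2_eq_square)
  finally have "sin (of_real pi * z) ^ 2 = - ((1 - q) ^ 2 / (4 * q))"
    by (simp add: power_divide power_mult_distrib q power2_commute)
  then have "- 1 / (4 * sin (of_real pi * z) ^ 2) = q / (1 - q) ^ 2"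
    using q1 q0 by simp
  with 1 show ?thesis by (simp add: q_def)
qed

lemma summable_on_int_powr:
  "(\<lambda>a::int. (1 + \<bar>real_of_int a\<bar>) powr (- (3/2))) summable_on UNIV"
proof -
  have s: "summable (\<lambda>n::nat. real (Suc n) powr (- (3/2)))"
    by (subst summable_Suc_iff) (simp add: summable_real_powr_iff)
  have s': "summable (\<lambda>n::nat. real (Suc (Suc n)) powr (- (3/2)))"
    using s by (subst summable_Suc_iff)
  have 1: "(\<lambda>n::nat. real (Suc n) powr (- (3/2))) summable_on UNIV"
    using s by (subst summable_on_UNIV_nonneg_real_iff) auto
  have 2: "(\<lambda>n::nat. real (Suc (Suc n)) powr (- (3/2))) summable_on UNIV"
    using s' by (subst summable_on_UNIV_nonneg_real_iff) auto
  have "((\<lambda>a::int. (1 + \<bar>real_of_int a\<bar>) powr (- (3/2))) has_sum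
    ((\<Sum>\<^sub>\<infinity>n. real (Suc n) powr (- (3/2))) + (\<Sum>\<^sub>\<infinity>n. real (Suc (Suc n)) powr (- (3/2))))) UNIV"
    by (rule has_sum_int_from_nat) (use has_sum_infsum[OF 1] has_sum_infsum[OF 2] in \<open>simp_all add: add.commute\<close>)
  then show ?thesis by (rule has_sum_imp_summable)
qed

text \<open>Since \<open>1 + \<bar>a\<bar>\<close> and \<open>1 + \<bar>b\<bar>\<close> are both at most \<open>1 + \<bar>a\<bar> + \<bar>b\<bar>\<close>, the summand is dominated by the
  product of their powers with exponent \<open>-3/2\<close>, and each factor is summable.\<close>
lemma summable_on_int_times_int:
  "(\<lambda>(b::int, a::int). 1 / (1 + \<bar>real_of_int a\<bar> + \<bar>real_of_int b\<bar>) ^ 3) summable_on UNIV"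
proof -
  let ?w = "\<lambda>a::int. (1 + \<bar>real_of_int a\<bar>) powr (- (3/2))"
  have "(\<lambda>x. norm ((\<lambda>(b, a). ?w b * ?w a) x)) summable_on UNIV \<times> UNIV"
    unfolding Infinite_Sum.abs_summable_on_Sigma_iff using summable_on_int_powr
    by (simp add: abs_mult infsum_cmult_right' summable_on_cmult_right summable_on_cmult_left infsum_nonneg)
  then have "(\<lambda>(b, a). ?w b * ?w a) summable_on UNIV"
    by (simp add: case_prod_unfold abs_mult)
  then show ?thesis
  proof (rule summable_on_comparison_test, safe)
    fix b a :: int
    define A B where "A = 1 + \<bar>real_of_int a\<bar>" and "B = 1 + \<bar>real_of_int b\<bar>"
    define C where "C = 1 + \<bar>real_of_int a\<bar> + \<bar>real_of_int b\<bar>"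
    have pos: "A \<ge> 1" "B \<ge> 1" "C \<ge> 1" "A \<le> C" "B \<le> C" by (auto simp: A_def B_def C_def)
    have "A * B \<le> C ^ 2" unfolding power2_eq_square using pos by (intro mult_mono) auto
    then have "(A * B) powr (3/2) \<le> (C ^ 2) powr (3/2)" using pos by (intro powr_mono2) auto
    also have "(C ^ 2) powr (3/2) = (C powr 2) powr (3/2)" using pos by simp
    also have "\<dots> = C ^ 3" unfolding powr_powr using pos by simp
    finally have "1 / C ^ 3 \<le> 1 / (A * B) powr (3/2)"
      using pos by (intro divide_left_mono) auto
    also have "\<dots> = B powr (- (3/2)) * A powr (- (3/2))"
      using pos unfolding powr_minus_divide by (simp add: powr_mult)
    finally show "1 / (1 + \<bar>real_of_int a\<bar> + \<bar>real_of_int b\<bar>) ^ 3 \<le> ?w b * ?w a"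
      by (simp add: A_def B_def C_def)
  qed auto
qed

lemma lattice_norm_ge:
  assumes "Im \<tau> > 0"
  obtains c where "c > 0" "\<And>a b::int. c * (\<bar>real_of_int a\<bar> + \<bar>real_of_int b\<bar>) \<le> norm (of_int a + of_int b * \<tau>)"
proof
  define D where "D = 1 + (norm \<tau> + 1) / Im \<tau>"
  have D: "D > 0" using assms by (simp add: D_def add_pos_pos divide_pos_pos add_nonneg_pos)
  then show "1 / D > 0" by simp
  fix a b :: int
  let ?w = "of_int a + of_int b * \<tau>"
  have "\<bar>real_of_int b\<bar> * Im \<tau> = \<bar>Im ?w\<bar>" using assms by (simp add: abs_mult)
  also have "\<dots> \<le> norm ?w" by (rule abs_Im_le_cmod)
  finally have b: "\<bar>real_of_int b\<bar> \<le> norm ?w / Im \<tau>" using assms by (simp add: field_simps)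
  have "\<bar>real_of_int a\<bar> = norm (?w - of_int b * \<tau>)" by simp
  also have "\<dots> \<le> norm ?w + \<bar>real_of_int b\<bar> * norm \<tau>"
    using norm_triangle_ineq4[of ?w "of_int b * \<tau>"] by (simp add: norm_mult)
  finally have "\<bar>real_of_int a\<bar> + \<bar>real_of_int b\<bar> \<le> norm ?w + \<bar>real_of_int b\<bar> * (norm \<tau> + 1)"
    by (simp add: algebra_simps)
  also have "\<dots> \<le> norm ?w + (norm ?w / Im \<tau>) * (norm \<tau> + 1)"
    by (intro add_left_mono mult_right_mono b) auto
  also have "\<dots> = norm ?w * D" by (simp add: D_def algebra_simps add_divide_distrib)
  finally show "1 / D * (\<bar>real_of_int a\<bar> + \<bar>real_of_int b\<bar>) \<le> norm ?w"
    using D by (simp add: field_simps)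
qed

lemma weierstrass_term_le:
  fixes z w :: complex
  assumes "w \<noteq> 0" "2 * norm z \<le> norm w"
  shows "norm (1 / (z - w) ^ 2 - 1 / w ^ 2) \<le> 10 * norm z / norm w ^ 3"
proof -
  have w: "norm w > 0" using assms by simp
  have zw: "norm w / 2 \<le> norm (z - w)"
    using norm_triangle_ineq2[of w z] assms by (simp add: norm_minus_commute)
  then have ne: "z - w \<noteq> 0" using w by auto
  have "1 / (z - w) ^ 2 - 1 / w ^ 2 = z * (2 * w - z) / ((z - w) ^ 2 * w ^ 2)"
  proof -
    have "(z - w) ^ 2 \<noteq> 0" "w ^ 2 \<noteq> 0" using ne assms(1) by simp_all
    then show ?thesis by (subst diff_frac_eq) (simp_all add: power2_eq_square algebra_simps)
  qed
  then have "norm (1 / (z - w) ^ 2 - 1 / w ^ 2) = norm z * norm (2 * w - z) / (norm (z - w) ^ 2 * norm w ^ 2)"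
    by (simp add: norm_divide norm_mult norm_power)
  also have "\<dots> \<le> norm z * (5 / 2 * norm w) / ((norm w / 2) ^ 2 * norm w ^ 2)"
  proof (intro frac_le mult_left_mono mult_right_mono power_mono zw)
    show "norm (2 * w - z) \<le> 5 / 2 * norm w"
      using norm_triangle_ineq4[of "2 * w" z] assms by (simp add: norm_mult)
  qed (use w in auto)
  also have "\<dots> = 10 * norm z / norm w ^ 3" using w by (simp add: field_simps power2_eq_square power3_eq_cube)
  finally show ?thesis .
qed

text \<open>The value \<open>1 / 0 = 0\<close> makes the term of the lattice point \<open>0\<close> equal to \<open>1 / z\<^sup>2\<close>, so that the
  Weierstrass function is the sum over the whole lattice. The first index counts the multiples of \<open>\<tau>\<close>,
  so a row has constant imaginary part and is summed by the squared cosecant.\<close>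
definition wp_term :: "complex \<Rightarrow> complex \<Rightarrow> int \<Rightarrow> int \<Rightarrow> complex" where
  "wp_term \<tau> z b a = 1 / (z - (of_int a + of_int b * \<tau>)) ^ 2 - 1 / (of_int a + of_int b * \<tau>) ^ 2"

lemma wp_term_summable:
  assumes "Im \<tau> > 0"
  shows "(\<lambda>(b, a). wp_term \<tau> z b a) summable_on UNIV"
proof -
  obtain c where c: "c > 0" "\<And>a b::int. c * (\<bar>real_of_int a\<bar> + \<bar>real_of_int b\<bar>) \<le> norm (of_int a + of_int b * \<tau>)"
    using lattice_norm_ge[OF assms] by blast
  define N where "N = \<lceil>2 * norm z / c\<rceil> + 1"
  let ?A = "{- N..N} \<times> {- N..N}"
  have "(\<lambda>x. norm ((\<lambda>(b, a). wp_term \<tau> z b a) x)) summable_on - ?A"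
  proof (rule summable_on_comparison_test)
    have "(\<lambda>(b::int, a::int). 1 / (1 + \<bar>real_of_int a\<bar> + \<bar>real_of_int b\<bar>) ^ 3) summable_on - ?A"
      using summable_on_int_times_int by (rule summable_on_subset) auto
    then show "(\<lambda>x. 80 * norm z / c ^ 3 * (case x of (b::int, a::int) \<Rightarrow> 1 / (1 + \<bar>real_of_int a\<bar> + \<bar>real_of_int b\<bar>) ^ 3))
        summable_on - ?A"
      by (rule summable_on_cmult_right)
    fix x :: "int \<times> int" assume x: "x \<in> - ?A"
    obtain b a where ba: "x = (b, a)" by force
    define s where "s = \<bar>real_of_int a\<bar> + \<bar>real_of_int b\<bar>"
    define w where "w = of_int a + of_int b * \<tau>"
    have "\<bar>a\<bar> > N \<or> \<bar>b\<bar> > N" using x ba by auto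
    then have "s \<ge> real_of_int N" unfolding s_def by linarith
    then have s: "s \<ge> 2 * norm z / c" "s \<ge> 1" using c(1) unfolding N_def
      by (auto simp: ceiling_le_iff) (smt (verit) divide_nonneg_pos le_of_int_ceiling norm_ge_zero of_int_add of_int_1, smt (verit) divide_nonneg_pos le_of_int_ceiling norm_ge_zero of_int_add of_int_1)
    have ws: "c * s \<le> norm w" using c(2)[of a b] by (simp add: s_def w_def)
    moreover have "2 * norm z \<le> c * s" using s c(1) by (simp add: field_simps)
    moreover have cs: "c * s > 0" using s c(1) by simp
    ultimately have "w \<noteq> 0" "2 * norm z \<le> norm w" by auto
    then have "norm (wp_term \<tau> z b a) \<le> 10 * norm z / norm w ^ 3"
      using weierstrass_term_le by (simp add: wp_term_def w_def)
    also have "\<dots> \<le> 10 * norm z / (c * ((1 + s) / 2)) ^ 3"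
    proof (intro divide_left_mono power_mono)
      show "c * ((1 + s) / 2) \<le> norm w"
        using order_trans[OF mult_left_mono[of "(1 + s) / 2" s c] ws] s c(1) by simp
      have "norm w > 0" using cs ws by linarith
      moreover have "c * ((1 + s) / 2) > 0" using s c(1) by simp
      ultimately show "0 < norm w ^ 3 * (c * ((1 + s) / 2)) ^ 3" by simp
    qed (use s c(1) cs ws in auto)
    also have "\<dots> = 80 * norm z / c ^ 3 * (1 / (1 + s) ^ 3)"
      by (simp add: power_mult_distrib power_divide)
    finally show "norm (case x of (b, a) \<Rightarrow> wp_term \<tau> z b a)
        \<le> 80 * norm z / c ^ 3 * (case x of (b, a) \<Rightarrow> 1 / (1 + \<bar>real_of_int a\<bar> + \<bar>real_of_int b\<bar>) ^ 3)"
      by (simp add: ba s_def add.assoc)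
  qed auto
  then have "(\<lambda>(b, a). wp_term \<tau> z b a) summable_on - ?A" by (rule abs_summable_summable)
  moreover have "(\<lambda>(b, a). wp_term \<tau> z b a) summable_on ?A" by (rule summable_on_finite) auto
  ultimately have "(\<lambda>(b, a). wp_term \<tau> z b a) summable_on - ?A \<union> ?A" by (rule summable_on_Un_disjoint) auto
  then show ?thesis by simp
qed

lemma wp_eq_infsum:
  assumes "Im \<tau> > 0"
  shows "wp \<tau> z = (\<Sum>\<^sub>\<infinity>(b, a)\<in>UNIV. wp_term \<tau> z b a)"
proof -
  let ?h = "\<lambda>(b::int, a::int). of_int a + of_int b * \<tau>"
  let ?f = "\<lambda>w. 1 / (z - w) ^ 2 - 1 / w ^ 2"
  have inj: "inj ?h"
  proof (rule injI, clarify)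
    fix b a b' a' :: int assume e: "of_int a + of_int b * \<tau> = of_int a' + of_int b' * \<tau>"
    then have "Im (of_int a + of_int b * \<tau>) = Im (of_int a' + of_int b' * \<tau>)" by simp
    then have "b = b'" using assms by simp
    then show "b = b' \<and> a = a'" using e by simp
  qed
  have L: "period_lattice \<tau> = range ?h" by (auto simp: period_lattice_def)
  have 0: "0 \<in> range ?h" by (rule range_eqI[of _ _ "(0, 0)"]) simp
  have S: "?f summable_on range ?h"
    unfolding summable_on_reindex[OF inj] using wp_term_summable[OF assms, of z]
    by (simp add: o_def case_prod_unfold wp_term_def)
  have "infsum ?f (range ?h) = infsum ?f (insert 0 (range ?h - {0}))" using 0 by (simp add: insert_absorb)
  also have "\<dots> = ?f 0 + infsum ?f (range ?h - {0})"
    by (subst infsum_insert) (use summable_on_subset_banach[OF S] in auto)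
  finally have "wp \<tau> z = infsum ?f (range ?h)" by (simp add: wp_def L)
  also have "\<dots> = (\<Sum>\<^sub>\<infinity>(b, a)\<in>UNIV. wp_term \<tau> z b a)"
    by (subst infsum_reindex[OF inj]) (simp add: o_def case_prod_unfold wp_term_def)
  finally show ?thesis .
qed

lemma norm_cos_sin_le:
  shows "norm (cos w) \<le> exp \<bar>Im w\<bar>" and "norm (sin w) \<le> exp \<bar>Im w\<bar>"
proof -
  have e: "norm (exp (\<i> * w)) \<le> exp \<bar>Im w\<bar>" "norm (exp (- (\<i> * w))) \<le> exp \<bar>Im w\<bar>" by simp_all
  have "norm (exp (\<i> * w) + exp (- (\<i> * w))) \<le> 2 * exp \<bar>Im w\<bar>"
    using norm_triangle_ineq[of "exp (\<i> * w)" "exp (- (\<i> * w))"] e by linarith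
  then show "norm (cos w) \<le> exp \<bar>Im w\<bar>" by (simp add: cos_exp_eq)
  have "norm (exp (\<i> * w) - exp (- (\<i> * w))) \<le> 2 * exp \<bar>Im w\<bar>"
    using norm_triangle_ineq4[of "exp (\<i> * w)" "exp (- (\<i> * w))"] e by linarith
  then show "norm (sin w) \<le> exp \<bar>Im w\<bar>" by (simp add: sin_exp_eq norm_divide norm_mult)
qed

lemma norm_cos_multiple_le:
  "norm (cos (2 * of_real pi * of_nat n * x)) \<le> exp (2 * pi * \<bar>Im x\<bar>) ^ n"
proof -
  have "\<bar>Im (2 * of_real pi * of_nat n * x)\<bar> = real n * (2 * pi * \<bar>Im x\<bar>)"
    by (simp add: abs_mult)
  then show ?thesis using norm_cos_sin_le(1)[of "2 * of_real pi * of_nat n * x"]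
    by (simp add: exp_of_nat_mult)
qed

lemma has_sum_minus:
  fixes f g :: "'a \<Rightarrow> complex"
  assumes "(f has_sum a) A" "(g has_sum b) A"
  shows "((\<lambda>x. f x - g x) has_sum (a - b)) A"
  using has_sum_add[OF assms(1), of "\<lambda>x. - g x" "- b"] assms(2) by (simp add: has_sum_uminus)

lemma wp_row_0:
  assumes "z \<notin> \<int>"
  shows "(wp_term \<tau> z 0 has_sum (of_real pi ^ 2 / sin (of_real pi * z) ^ 2 - of_real pi ^ 2 / 3)) UNIV"
  using has_sum_minus[OF has_sum_inverse_squares_int[OF assms] has_sum_zeta_2_int]
  by (simp add: wp_term_def [abs_def])

lemma wp_row:
  assumes "z - of_int b * \<tau> \<notin> \<int>" "of_int b * \<tau> \<notin> \<int>"
  shows "(wp_term \<tau> z b has_sum (of_real pi ^ 2 / sin (of_real pi * (z - of_int b * \<tau>)) ^ 2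
      - of_real pi ^ 2 / sin (of_real pi * (of_int b * \<tau>)) ^ 2)) UNIV"
proof -
  have "- (of_int b * \<tau>) \<notin> \<int>" using assms(2) minus_in_Ints_iff by blast
  from has_sum_inverse_squares_int[OF this]
  have "((\<lambda>a. 1 / (of_int a + of_int b * \<tau>) ^ 2) has_sum
      (of_real pi ^ 2 / sin (of_real pi * (of_int b * \<tau>)) ^ 2)) UNIV"
    by (simp add: power2_commute[of "- (of_int b * \<tau>)"])
  from has_sum_minus[OF has_sum_inverse_squares_int[OF assms(1)] this]
  show ?thesis by (simp add: wp_term_def [abs_def] algebra_simps)
qed

lemma norm_nome: "norm (exp (2 * of_real pi * \<i> * \<tau>)) = exp (- 2 * pi * Im \<tau>)"
  by simp

text \<open>Summing the lattice row by row gives squared cosecants at \<open>z - b\<tau>\<close>. Those of \<open>b\<close> and \<open>-b\<close>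
  together expand into powers of \<open>p ^ b\<close>, which are then summed over \<open>b\<close> as geometric series.\<close>
theorem wp_fourier:
  assumes \<tau>: "Im \<tau> > 0" and p: "p = exp (2 * of_real pi * \<i> * \<tau>)" and z: "z \<in> strip p" "z \<notin> \<int>"
  shows "(\<lambda>n. of_nat n * (p ^ n / (1 - p ^ n)) * (cos (2 * of_real pi * of_nat n * z) - 1)) sums
    ((of_real pi ^ 2 / sin (of_real pi * z) ^ 2 - of_real pi ^ 2 / 3 - wp \<tau> z) / (8 * of_real pi ^ 2))"
proof -
  define c where "c n = cos (2 * of_real pi * of_nat n * z)" for n
  define t where "t = exp (2 * pi * \<bar>Im z\<bar>)"
  define row where "row b = infsum (wp_term \<tau> z b) UNIV" for b
  have norm_p: "norm p = exp (- 2 * pi * Im \<tau>)" using norm_nome p by simp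
  then have Im_z: "\<bar>Im z\<bar> < Im \<tau>" using z(1) by (simp add: strip_def)
  have p1: "norm p < 1" using \<tau> norm_p by simp
  have pt: "norm p * t < 1"
    using Im_z unfolding norm_p t_def by (simp flip: exp_add add: algebra_simps)
  have t: "1 \<le> t" by (simp add: t_def)
  have row_0: "row 0 = of_real pi ^ 2 / sin (of_real pi * z) ^ 2 - of_real pi ^ 2 / 3"
    unfolding row_def by (rule infsumI[OF wp_row_0[OF z(2)]])
  have "(row has_sum wp \<tau> z) UNIV"
  proof -
    note S = wp_term_summable[OF \<tau>, of z, folded UNIV_Times_UNIV]
    have "row summable_on UNIV"
      using summable_on_Sigma_banach[OF S] by (simp add: row_def [abs_def])
    moreover have "infsum row UNIV = wp \<tau> z"
      using infsum_Sigma_banach[OF S] by (simp add: row_def [abs_def] wp_eq_infsum[OF \<tau>])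
    ultimately show ?thesis by (simp add: has_sum_iff)
  qed
  note row_sum = this
  have "(\<lambda>n. row (int (Suc n)) + row (- int (Suc n))) sums (wp \<tau> z - row 0)"
  proof -
    have sub: "row summable_on A" for A
      using summable_on_subset_banach[OF has_sum_imp_summable[OF row_sum]] by blast
    have 1: "(\<lambda>n. row (int n)) summable_on UNIV"
      using sub[of "range int"] by (subst (asm) summable_on_reindex) (auto simp: o_def)
    have 2: "(\<lambda>n. row (- int (Suc n))) summable_on UNIV"
      using sub[of "range (\<lambda>n. - int (Suc n))"] by (subst (asm) summable_on_reindex) (auto simp: o_def inj_on_def)
    note h = has_sum_infsum[OF 1] has_sum_infsum[OF 2]
    have tot: "wp \<tau> z = infsum (\<lambda>n. row (int n)) UNIV + infsum (\<lambda>n. row (- int (Suc n))) UNIV"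
      by (rule has_sum_unique[OF row_sum has_sum_int_from_nat[OF h]])
    have "(\<lambda>n. row (int (Suc n))) sums (infsum (\<lambda>n. row (int n)) UNIV - row 0)"
      using has_sum_imp_sums[OF h(1)] by (subst sums_Suc_iff) simp
    from sums_add[OF this has_sum_imp_sums[OF h(2)]] show ?thesis
      unfolding tot by (simp add: algebra_simps)
  qed
  note pairs = this
  have pair: "(\<lambda>n. of_nat n * (p ^ Suc b) ^ n * (c n - 1)) sums
      ((row (int (Suc b)) + row (- int (Suc b))) / (- 8 * of_real pi ^ 2))" for b
  proof -
    define \<beta> where "\<beta> = of_nat (Suc b) * \<tau>"
    have Im_\<beta>: "Im \<beta> = real (Suc b) * Im \<tau>" by (simp add: \<beta>_def)
    have "Im \<tau> \<le> Im \<beta>" unfolding Im_\<beta> using mult_right_mono[of 1 "real (Suc b)" "Im \<tau>"] \<tau> by simp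
    then have Im: "Im (\<beta> - z) > 0" "Im (\<beta> + z) > 0" "Im \<beta> > 0" using Im_z \<tau> by auto
    have not_Int: "w \<notin> \<int>" if "Im w \<noteq> 0" for w using that by (auto elim!: Ints_cases)
    have e: "exp (2 * of_real pi * \<i> * \<beta>) = p ^ Suc b"
      unfolding p \<beta>_def exp_of_nat_mult[symmetric] by (simp add: mult_ac)
    define u where "u = exp (2 * of_real pi * \<i> * z)"
    have u0: "u \<noteq> 0" by (simp add: u_def)
    have e1: "exp (2 * of_real pi * \<i> * (\<beta> - z)) = p ^ Suc b / u"
      by (simp add: u_def right_diff_distrib exp_diff e)
    have e2: "exp (2 * of_real pi * \<i> * (\<beta> + z)) = p ^ Suc b * u"
      by (simp add: u_def distrib_left exp_add e)
    have c_eq: "c n = (u ^ n + 1 / u ^ n) / 2" for n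
    proof -
      have "exp (\<i> * (2 * of_real pi * of_nat n * z)) = u ^ n"
        unfolding u_def exp_of_nat_mult[symmetric] by (simp add: mult_ac)
      moreover have "exp (- (\<i> * (2 * of_real pi * of_nat n * z))) = 1 / u ^ n"
        unfolding exp_minus calculation by (simp add: divide_inverse)
      ultimately show ?thesis unfolding c_def cos_exp_eq by simp
    qed
    let ?S = "\<lambda>w. 1 / (4 * sin (of_real pi * w) ^ 2) :: complex"
    have "(\<lambda>n. (of_nat n * (p ^ Suc b / u) ^ n + of_nat n * (p ^ Suc b * u) ^ n)
        - 2 * (of_nat n * (p ^ Suc b) ^ n)) sums ((- ?S (\<beta> - z) + - ?S (\<beta> + z)) - 2 * - ?S \<beta>)"
      using inverse_sin_sq_expansion[OF Im(1)] inverse_sin_sq_expansion[OF Im(2)]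
        inverse_sin_sq_expansion[OF Im(3)] unfolding e e1 e2
      by (intro sums_diff sums_add sums_mult) simp_all
    then have "(\<lambda>n. 1 / 2 * ((of_nat n * (p ^ Suc b / u) ^ n + of_nat n * (p ^ Suc b * u) ^ n)
        - 2 * (of_nat n * (p ^ Suc b) ^ n))) sums (1 / 2 * ((- ?S (\<beta> - z) + - ?S (\<beta> + z)) - 2 * - ?S \<beta>))"
      by (rule sums_mult)
    moreover have "1 / 2 * ((of_nat n * (p ^ Suc b / u) ^ n + of_nat n * (p ^ Suc b * u) ^ n)
        - 2 * (of_nat n * (p ^ Suc b) ^ n)) = of_nat n * (p ^ Suc b) ^ n * (c n - 1)" for n
      unfolding c_eq power_divide power_mult_distrib using u0 by (simp add: field_simps)
    moreover have "1 / 2 * ((- ?S (\<beta> - z) + - ?S (\<beta> + z)) - 2 * - ?S \<beta>)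
        = (row (int (Suc b)) + row (- int (Suc b))) / (- 8 * of_real pi ^ 2)"
    proof -
      have b1: "of_int (int (Suc b)) * \<tau> = \<beta>" and b2: "of_int (- int (Suc b)) * \<tau> = - \<beta>"
        by (simp_all add: \<beta>_def algebra_simps)
      have r1: "row (int (Suc b)) = of_real pi ^ 2 / sin (of_real pi * (z - \<beta>)) ^ 2
          - of_real pi ^ 2 / sin (of_real pi * \<beta>) ^ 2"
        unfolding row_def using wp_row[of z "int (Suc b)" \<tau>, unfolded b1]
        by (intro infsumI) (use not_Int Im in auto)
      have r2: "row (- int (Suc b)) = of_real pi ^ 2 / sin (of_real pi * (z - - \<beta>)) ^ 2
          - of_real pi ^ 2 / sin (of_real pi * - \<beta>) ^ 2"
        unfolding row_def using wp_row[of z "- int (Suc b)" \<tau>, unfolded b2]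
        by (intro infsumI) (use not_Int Im in auto)
      have s1: "sin (of_real pi * (z - \<beta>)) ^ 2 = sin (of_real pi * (\<beta> - z)) ^ 2"
        using power2_minus[of "sin (of_real pi * (\<beta> - z))"] unfolding sin_minus[symmetric]
        by (simp add: algebra_simps)
      have s2: "sin (of_real pi * - \<beta>) ^ 2 = sin (of_real pi * \<beta>) ^ 2" by simp
      have s3: "z - - \<beta> = \<beta> + z" by simp
      have alg: "1 / 2 * ((- (1 / (4 * A)) + - (1 / (4 * B))) - 2 * - (1 / (4 * C)))
          = ((P / A - P / C) + (P / B - P / C)) / (- 8 * P)" if "P \<noteq> 0" for A B C P :: complex
      proof -
        have "1 / 2 * ((- (a / 4) + - (b / 4)) - 2 * - (c / 4)) = ((P * a - P * c) + (P * b - P * c)) / (- 8 * P)"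
          for a b c :: complex
          using that by (simp add: field_simps)
        note this[of "1 / A" "1 / B" "1 / C"]
        moreover have "1 / (4 * X) = 1 / X / 4" "P / X = P * (1 / X)" for X by simp_all
        ultimately show ?thesis by (simp only:)
      qed
      show ?thesis unfolding r1 r2 s1 s2 s3 by (rule alg) simp
    qed
    ultimately show ?thesis by (simp only:)
  qed
  \<comment> \<open>The double series in \<open>n\<close> and \<open>b\<close> converges absolutely exactly because \<open>z\<close> lies in the strip.\<close>
  let ?f = "\<lambda>n b. of_nat n * (p ^ Suc b) ^ n * (c n - 1)"
  have f_le: "norm (?f n b) \<le> 2 * (real n * (norm p * t) ^ n) * norm p ^ b" for n b
  proof (cases "n = 0")
    case False
    have "(norm p ^ Suc b) ^ n = norm p ^ n * (norm p ^ b) ^ n"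
      by (simp add: power_mult_distrib)
    also have "\<dots> \<le> norm p ^ n * norm p ^ b"
    proof (rule mult_left_mono)
      have "(norm p ^ b) ^ n \<le> (norm p ^ b) ^ 1"
        using False p1 by (intro power_decreasing) (auto simp: power_le_one)
      then show "(norm p ^ b) ^ n \<le> norm p ^ b" by simp
    qed simp
    finally have 1: "(norm p ^ Suc b) ^ n \<le> norm p ^ n * norm p ^ b" .
    have "norm (c n - 1) \<le> norm (c n) + 1" using norm_triangle_ineq4[of "c n" 1] by simp
    also have "\<dots> \<le> t ^ n + t ^ n"
      using norm_cos_multiple_le[of n z] t by (intro add_mono) (simp_all add: c_def t_def)
    finally have 2: "norm (c n - 1) \<le> 2 * t ^ n" by simp
    have "norm (?f n b) = real n * (norm p ^ Suc b) ^ n * norm (c n - 1)"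
      by (simp add: norm_mult norm_power del: power_Suc)
    also have "\<dots> \<le> real n * (norm p ^ n * norm p ^ b) * (2 * t ^ n)"
      by (intro mult_mono 1 2 order_refl) auto
    finally show ?thesis by (simp add: power_mult_distrib mult_ac)
  qed simp
  have sn: "summable (\<lambda>n. real n * (norm p * t) ^ n)"
    by (rule summable_nat_mult_power) (use pt t in \<open>simp add: abs_mult\<close>)
  then have sn': "summable (\<lambda>n. 2 * (real n * (norm p * t) ^ n) * norm p ^ b)" for b
    by (intro summable_mult2 summable_mult)
  have col: "summable (\<lambda>n. norm (?f n b))" for b
    by (rule summable_comparison_test'[OF sn', of 0]) (use f_le in auto)
  have col_le: "(\<Sum>n. norm (?f n b)) \<le> (\<Sum>n. 2 * (real n * (norm p * t) ^ n)) * norm p ^ b" for b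
  proof -
    have "(\<Sum>n. norm (?f n b)) \<le> (\<Sum>n. 2 * (real n * (norm p * t) ^ n) * norm p ^ b)"
      by (intro suminf_le f_le col sn')
    also have "\<dots> = (\<Sum>n. 2 * (real n * (norm p * t) ^ n)) * norm p ^ b"
      by (rule suminf_mult2[symmetric]) (intro summable_mult sn)
    finally show ?thesis .
  qed
  have H: "summable (\<lambda>b. (\<Sum>n. 2 * (real n * (norm p * t) ^ n)) * norm p ^ b)"
    by (intro summable_mult summable_geometric) (use p1 in simp)
  have "(\<lambda>n. \<Sum>b. ?f n b) sums (\<Sum>b. \<Sum>n. ?f n b)"
    by (rule double_series_swap(1)[OF col col_le H])
  moreover have "(\<Sum>b. ?f n b) = of_nat n * (p ^ n / (1 - p ^ n)) * (c n - 1)" for n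
  proof (cases "n = 0")
    case False
    have "(\<lambda>b. (p ^ n) ^ b) sums (1 / (1 - p ^ n))"
      by (rule geometric_sums) (use False p1 in \<open>simp add: norm_power power_less_one_iff\<close>)
    then have "(\<lambda>b. (of_nat n * (c n - 1) * p ^ n) * (p ^ n) ^ b) sums ((of_nat n * (c n - 1) * p ^ n) * (1 / (1 - p ^ n)))"
      by (rule sums_mult)
    moreover have "(p ^ Suc b) ^ n = p ^ n * (p ^ n) ^ b" for b
      by (simp add: power_mult_distrib flip: power_mult) (simp add: mult.commute)
    ultimately show ?thesis by (simp add: sums_iff mult_ac)
  qed simp
  moreover have "(\<Sum>b. \<Sum>n. ?f n b) = (wp \<tau> z - row 0) / (- 8 * of_real pi ^ 2)"
    using sums_divide[OF pairs, of "- 8 * of_real pi ^ 2"] by (simp only: sums_iff sums_unique[OF pair, symmetric])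
  moreover have "(wp \<tau> z - row 0) / (- 8 * of_real pi ^ 2) = (row 0 - wp \<tau> z) / (8 * of_real pi ^ 2)"
    by (simp add: divide_simps)
  ultimately show ?thesis unfolding row_0 c_def by simp
qed

section \<open>The trigonometric operator on cosines\<close>

definition cos_mode :: "nat \<Rightarrow> complex \<Rightarrow> complex" where
  "cos_mode k x = cos (2 * of_real pi * of_nat k * x)"

definition sin_mode :: "nat \<Rightarrow> complex \<Rightarrow> complex" where
  "sin_mode k x = sin (2 * of_real pi * of_nat k * x)"

definition cos_mode_D :: "nat \<Rightarrow> complex \<Rightarrow> complex" where
  "cos_mode_D k x = - (2 * of_real pi * of_nat k) * sin_mode k x"

definition cos_mode_DD :: "nat \<Rightarrow> complex \<Rightarrow> complex" where
  "cos_mode_DD k x = - ((2 * of_real pi * of_nat k) ^ 2) * cos_mode k x"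

lemma DERIV_cos_mode: "(cos_mode k has_field_derivative cos_mode_D k x) (at x)"
  unfolding cos_mode_def [abs_def] cos_mode_D_def sin_mode_def
  by (rule derivative_eq_intros refl)+ (simp add: algebra_simps)

lemma DERIV_cos_mode_D: "(cos_mode_D k has_field_derivative cos_mode_DD k x) (at x)"
  unfolding cos_mode_def cos_mode_D_def [abs_def] cos_mode_DD_def sin_mode_def
  by (rule derivative_eq_intros refl)+ (simp add: algebra_simps power2_eq_square)

lemma cos_mode_0 [simp]: "cos_mode 0 x = 1" by (simp add: cos_mode_def)

lemma cos_mode_mult: "cos_mode n x * cos_mode j x = (cos_mode (n + j) x + cos_mode ((n - j) + (j - n)) x) / 2"
proof -
  have *: "cos_mode n x * cos_mode j x = (cos_mode (n + j) x + cos_mode (n - j) x) / 2" if "j \<le> n" for n j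
    using that unfolding cos_mode_def cos_times_cos by (simp add: of_nat_diff algebra_simps)
  show ?thesis
  proof (cases "j \<le> n")
    case False
    then show ?thesis using *[of n j] by (simp add: mult.commute add.commute)
  qed (use * in simp)
qed

lemma half_shift:
  "cos_mode k (x + 1/2) = (- 1) ^ k * cos_mode k x" "sin_mode k (x + 1/2) = (- 1) ^ k * sin_mode k x"
  "sin (of_real pi * (x + 1/2)) = cos (of_real pi * x)" "cos (of_real pi * (x + 1/2)) = - sin (of_real pi * x)"
proof -
  have e: "2 * of_real pi * of_nat k * (x + 1/2) = 2 * of_real pi * of_nat k * x + of_nat k * complex_of_real pi"
    by (simp add: algebra_simps)
  have c: "cos (of_nat k * complex_of_real pi) = (- 1) ^ k" "sin (of_nat k * complex_of_real pi) = 0"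
    using cos_npi[of k] sin_npi[of k] by (metis cos_of_real of_real_minus of_real_1 of_real_power of_real_mult of_real_of_nat_eq, metis sin_of_real of_real_0 of_real_mult of_real_of_nat_eq)
  show "cos_mode k (x + 1/2) = (- 1) ^ k * cos_mode k x" "sin_mode k (x + 1/2) = (- 1) ^ k * sin_mode k x"
    unfolding cos_mode_def sin_mode_def e cos_add sin_add c by simp_all
  have p: "of_real pi * (x + 1/2) = of_real pi * x + complex_of_real pi / 2" by (simp add: algebra_simps)
  have q: "cos (complex_of_real pi / 2) = 0" "sin (complex_of_real pi / 2) = 1"
    using cos_of_real[of "pi/2"] sin_of_real[of "pi/2"] by simp_all
  show "sin (of_real pi * (x + 1/2)) = cos (of_real pi * x)" "cos (of_real pi * (x + 1/2)) = - sin (of_real pi * x)"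
    unfolding p cos_add sin_add q by simp_all
qed

text \<open>In the Dirichlet kernel a positive frequency occurs with both signs, the constant mode only once.\<close>
definition mode_weight :: "nat \<Rightarrow> complex" where
  "mode_weight j = (if j = 0 then 1 else 2)"

text \<open>This is the closed form of the Dirichlet kernel with its last term halved. Passing from \<open>k\<close> to
  \<open>k + 1\<close> adds the two cosines of frequencies \<open>k\<close> and \<open>k + 1\<close>.\<close>
lemma cot_times_sin_mode:
  "cos (of_real pi * x) * sin_mode (Suc k) x
    = sin (of_real pi * x) * (cos_mode (Suc k) x + (\<Sum>j<Suc k. mode_weight j * cos_mode j x))"
proof (induction k)
  case 0
  have "sin_mode (Suc 0) x = sin (2 * (of_real pi * x))" "cos_mode (Suc 0) x = cos (2 * (of_real pi * x))"
    by (simp_all add: sin_mode_def cos_mode_def mult.assoc)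
  then show ?case
    unfolding sin_double cos_double_cos by (simp add: mode_weight_def power2_eq_square)
next
  case (Suc k)
  define s c A where "s = sin (of_real pi * x)" and "c = cos (of_real pi * x)"
    and "A = 2 * of_real pi * of_nat (Suc k) * x + of_real pi * x"
  have e: "2 * of_real pi * of_nat (Suc (Suc k)) * x = A + of_real pi * x"
    "2 * of_real pi * of_nat (Suc k) * x = A - of_real pi * x"
    by (simp_all add: A_def algebra_simps)
  have 1: "sin_mode (Suc (Suc k)) x = sin_mode (Suc k) x + 2 * cos A * s"
    unfolding sin_mode_def e sin_add sin_diff s_def by simp
  have 2: "cos_mode (Suc (Suc k)) x = 2 * cos A * c - cos_mode (Suc k) x"
    unfolding cos_mode_def e cos_add cos_diff c_def by simp
  have "c * sin_mode (Suc (Suc k)) x = c * sin_mode (Suc k) x + s * (2 * cos A * c)"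
    unfolding 1 by (simp add: algebra_simps)
  also have "c * sin_mode (Suc k) x = s * (cos_mode (Suc k) x + (\<Sum>j<Suc k. mode_weight j * cos_mode j x))"
    using Suc.IH by (simp add: c_def s_def)
  also have "\<dots> + s * (2 * cos A * c) = s * (cos_mode (Suc (Suc k)) x + (\<Sum>j<Suc (Suc k). mode_weight j * cos_mode j x))"
    unfolding 2 sum.lessThan_Suc[of _ "Suc k"] by (simp add: mode_weight_def algebra_simps)
  finally show ?case by (simp add: c_def s_def)
qed

text \<open>The previous identity translated by a half period.\<close>
lemma tan_times_sin_mode:
  "- sin (of_real pi * x) * sin_mode (Suc k) x
    = cos (of_real pi * x) * (cos_mode (Suc k) x + (\<Sum>j<Suc k. mode_weight j * (- 1) ^ (j + Suc k) * cos_mode j x))"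
proof -
  let ?e = "(- 1) ^ Suc k :: complex"
  have e: "?e * ?e = 1" by (simp flip: power_add)
  have "- sin (of_real pi * x) * (?e * sin_mode (Suc k) x)
      = cos (of_real pi * x) * (?e * cos_mode (Suc k) x + (\<Sum>j<Suc k. mode_weight j * ((- 1) ^ j * cos_mode j x)))"
    using cot_times_sin_mode[of "x + 1/2" k] unfolding half_shift .
  then have "?e * (- sin (of_real pi * x) * (?e * sin_mode (Suc k) x))
      = ?e * (cos (of_real pi * x) * (?e * cos_mode (Suc k) x + (\<Sum>j<Suc k. mode_weight j * ((- 1) ^ j * cos_mode j x))))"
    by (simp only:)
  then have "(?e * ?e) * (- sin (of_real pi * x) * sin_mode (Suc k) x)
      = cos (of_real pi * x) * ((?e * ?e) * cos_mode (Suc k) x + ?e * (\<Sum>j<Suc k. mode_weight j * ((- 1) ^ j * cos_mode j x)))"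
    by (simp only: algebra_simps)
  then show ?thesis
    unfolding e sum_distrib_left by (simp add: power_add mult_ac)
qed

text \<open>Conjugation of the trigonometric operator by its ground state \<open>Phi\<close> removes the singular
  potential at the price of a first order term. Apart from an additive constant the result is this
  expression in the first and second derivative \<open>d1\<close>, \<open>d2\<close> of the conjugated function at \<open>x\<close>.\<close>
definition gauged :: "nat \<Rightarrow> nat \<Rightarrow> complex \<Rightarrow> complex \<Rightarrow> complex \<Rightarrow> complex" where
  "gauged l0 l1 x d1 d2 = - d2 - 2 * of_real pi * (of_nat (l0 + 1) * (cos (of_real pi * x) / sin (of_real pi * x))
     - of_nat (l1 + 1) * (sin (of_real pi * x) / cos (of_real pi * x))) * d1"

lemma gauged_sum: "gauged l0 l1 x (\<Sum>k\<in>A. a k * d1 k) (\<Sum>k\<in>A. a k * d2 k) = (\<Sum>k\<in>A. a k * gauged l0 l1 x (d1 k) (d2 k))"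
proof -
  define K where "K = 2 * of_real pi * (of_nat (l0 + 1) * (cos (of_real pi * x) / sin (of_real pi * x))
     - of_nat (l1 + 1) * (sin (of_real pi * x) / cos (of_real pi * x)))"
  have g: "gauged l0 l1 x p q = - q - K * p" for p q by (simp add: gauged_def K_def)
  show ?thesis unfolding g by (simp add: sum_distrib_left sum_subtractf sum_negf algebra_simps)
qed

text \<open>The gauged operator is triangular on cosines: these are its entries above the diagonal, in
  units of \<open>4 \<pi>\<^sup>2\<close>. They grow only linearly in \<open>k\<close>, while the diagonal grows quadratically.\<close>
definition trig_coupling :: "nat \<Rightarrow> nat \<Rightarrow> nat \<Rightarrow> nat \<Rightarrow> complex" where
  "trig_coupling l0 l1 j k =
     (if j < k then of_nat k * mode_weight j * (of_nat (l0 + 1) + (- 1) ^ (j + k) * of_nat (l1 + 1)) else 0)"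

lemma half_integers_iff: "x \<in> half_integers \<longleftrightarrow> sin (of_real pi * x) = 0 \<or> cos (of_real pi * x) = 0"
proof -
  have "sin (of_real pi * x) = 0 \<or> cos (of_real pi * x) = 0 \<longleftrightarrow> sin (2 * (of_real pi * x)) = 0"
    by (simp add: sin_double)
  also have "\<dots> \<longleftrightarrow> (\<exists>n::int. 2 * (of_real pi * x) = of_real (of_int n * pi))" by (rule sin_eq_0)
  also have "\<dots> \<longleftrightarrow> (\<exists>n::int. x = of_int n / 2)"
  proof (rule arg_cong[of _ _ Ex], rule ext)
    fix n :: int
    have "2 * (of_real pi * x) = of_real (of_int n * pi) \<longleftrightarrow> of_real pi * (2 * x) = of_real pi * of_int n"
      by (simp add: mult_ac)
    also have "\<dots> \<longleftrightarrow> x = of_int n / 2" by (simp add: field_simps)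
    finally show "(2 * (of_real pi * x) = of_real (of_int n * pi)) = (x = of_int n / 2)" .
  qed
  finally show ?thesis by (auto simp: half_integers_def)
qed

lemma open_not_half_integers: "open (- half_integers)"
proof -
  have "half_integers = {x. sin (of_real pi * x) * cos (of_real pi * x) = 0}"
    using half_integers_iff by auto
  moreover have "closed {x::complex. sin (of_real pi * x) * cos (of_real pi * x) = 0}"
    by (intro closed_Collect_eq continuous_intros)
  ultimately show ?thesis by (simp add: closed_def)
qed

lemma gauged_cos_mode:
  assumes "x \<notin> half_integers"
  shows "gauged l0 l1 x (cos_mode_D k x) (cos_mode_DD k x)
    = 4 * of_real pi ^ 2 * (of_nat (k * (k + (l0 + l1 + 2))) * cos_mode k x + (\<Sum>j<k. trig_coupling l0 l1 j k * cos_mode j x))"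
proof (cases k)
  case 0
  then show ?thesis by (simp add: gauged_def cos_mode_D_def cos_mode_DD_def)
next
  case (Suc i)
  define s c S where "s = sin (of_real pi * x)" and "c = cos (of_real pi * x)" and "S = sin_mode k x"
  define A B where "A = (\<Sum>j<k. mode_weight j * cos_mode j x)"
    and "B = (\<Sum>j<k. mode_weight j * (- 1) ^ (j + k) * cos_mode j x)"
  have nz: "s \<noteq> 0" "c \<noteq> 0" using assms half_integers_iff by (auto simp: s_def c_def)
  have 1: "c / s * S = cos_mode k x + A"
    using cot_times_sin_mode[of x i] nz by (simp add: Suc s_def c_def S_def A_def field_simps)
  have 2: "s / c * S = - (cos_mode k x + B)"
    using tan_times_sin_mode[of x i] nz by (simp add: Suc s_def c_def S_def B_def field_simps)
  have "gauged l0 l1 x (cos_mode_D k x) (cos_mode_DD k x) =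
    4 * of_real pi ^ 2 * of_nat k * (of_nat (l0 + 1) * (c / s * S) - of_nat (l1 + 1) * (s / c * S) + of_nat k * cos_mode k x)"
  proof -
    define p q where "p = c / s" and "q = s / c"
    show ?thesis
      unfolding gauged_def cos_mode_D_def cos_mode_DD_def s_def [symmetric] c_def [symmetric]
        S_def [symmetric] p_def [symmetric] q_def [symmetric]
      by (simp add: algebra_simps power2_eq_square)
  qed
  also have "\<dots> = 4 * of_real pi ^ 2 * (of_nat (k * (k + (l0 + l1 + 2))) * cos_mode k x
      + of_nat k * (of_nat (l0 + 1) * A + of_nat (l1 + 1) * B))"
    unfolding 1 2 by (simp add: algebra_simps)
  also have "of_nat k * (of_nat (l0 + 1) * A + of_nat (l1 + 1) * B) = (\<Sum>j<k. trig_coupling l0 l1 j k * cos_mode j x)"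
    unfolding A_def B_def sum_distrib_left sum.distrib[symmetric]
    by (intro sum.cong) (auto simp: trig_coupling_def algebra_simps)
  finally show ?thesis .
qed

text \<open>With \<open>P = Phi' / Phi\<close> one has \<open>(Phi u)'' = Phi ((P\<^sup>2 + P') u + 2 P u' + u'')\<close>, and \<open>P\<^sup>2 + P'\<close> is the
  potential up to the ground state energy.\<close>
lemma hamiltonian_T_gauge:
  assumes S: "open S" "x \<in> S" and x: "x \<notin> half_integers"
    and u: "\<And>y. y \<in> S \<Longrightarrow> (u has_field_derivative u' y) (at y)" and u': "(u' has_field_derivative u'') (at x)"
  shows "hamiltonian_T l0 l1 (\<lambda>x. Phi l0 l1 x * u x) x
    = Phi l0 l1 x * (of_real pi ^ 2 * of_nat (l0 + l1 + 2) ^ 2 * u x + gauged l0 l1 x (u' x) u'')"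
proof -
  define T where "T = S - half_integers"
  have T: "open T" "x \<in> T" using S x open_not_half_integers by (auto simp: T_def Diff_eq)
  define s c where "s y = sin (of_real pi * y)" and "c y = cos (of_real pi * y)" for y :: complex
  define P where "P y = of_real pi * (of_nat (l0 + 1) * (c y / s y) - of_nat (l1 + 1) * (s y / c y))" for y
  have nz: "s y \<noteq> 0" "c y \<noteq> 0" if "y \<in> T" for y
    using that half_integers_iff by (auto simp: T_def s_def c_def)
  have sc: "s y ^ 2 + c y ^ 2 = 1" for y unfolding s_def c_def by (rule sin_cos_squared_add)
  have ds: "(s has_field_derivative of_real pi * c y) (at y)" and dc: "(c has_field_derivative - of_real pi * s y) (at y)" for y
    unfolding s_def [abs_def] c_def [abs_def] by (rule derivative_eq_intros refl | simp)+
  have Phi: "Phi l0 l1 y = s y ^ (l0 + 1) * c y ^ (l1 + 1)" for y by (simp add: Phi_def s_def c_def)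
  have dPhi: "(Phi l0 l1 has_field_derivative Phi l0 l1 y * P y) (at y)" if "y \<in> T" for y
  proof -
    have "((\<lambda>y. s y ^ (l0 + 1) * c y ^ (l1 + 1)) has_field_derivative
      (of_nat (l0 + 1) * (of_real pi * c y) * s y ^ l0) * c y ^ (l1 + 1)
      + (of_nat (l1 + 1) * (- of_real pi * s y) * c y ^ l1) * s y ^ (l0 + 1)) (at y)"
      by (rule DERIV_mult' DERIV_power ds dc derivative_eq_intros refl | simp add: mult_ac)+
    moreover have "(of_nat (l0 + 1) * (of_real pi * c y) * s y ^ l0) * c y ^ (l1 + 1)
      + (of_nat (l1 + 1) * (- of_real pi * s y) * c y ^ l1) * s y ^ (l0 + 1) = Phi l0 l1 y * P y"
      unfolding Phi P_def using nz[OF that] by (simp add: field_simps)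
    ultimately show ?thesis by (simp add: Phi [abs_def])
  qed
  have dP: "(P has_field_derivative - (of_real pi ^ 2) * (of_nat (l0 + 1) / s x ^ 2 + of_nat (l1 + 1) / c x ^ 2)) (at x)"
  proof -
    have "(P has_field_derivative of_real pi * (of_nat (l0 + 1) * ((- of_real pi * s x * s x - c x * (of_real pi * c x)) / (s x * s x))
       - of_nat (l1 + 1) * ((of_real pi * c x * c x - s x * (- of_real pi * s x)) / (c x * c x)))) (at x)"
      unfolding P_def [abs_def]
      by (intro DERIV_cmult DERIV_diff DERIV_divide ds dc nz T)
    moreover have "- of_real pi * s x * s x - c x * (of_real pi * c x) = - of_real pi * (s x ^ 2 + c x ^ 2)"
      "of_real pi * c x * c x - s x * (- of_real pi * s x) = of_real pi * (s x ^ 2 + c x ^ 2)"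
      by (simp_all add: algebra_simps power2_eq_square)
    ultimately have "(P has_field_derivative of_real pi * (of_nat (l0 + 1) * ((- of_real pi) / (s x * s x))
       - of_nat (l1 + 1) * ((of_real pi) / (c x * c x)))) (at x)"
      unfolding sc by (simp only: mult_1_right)
    moreover have "p * (N * ((- p) / X) - M * (p / Y)) = - (p ^ 2) * (N / X + M / Y)" for p N M X Y :: complex
      by (simp add: algebra_simps power2_eq_square)
    ultimately show ?thesis by (simp only: power2_eq_square)
  qed
  let ?g = "\<lambda>y. Phi l0 l1 y * u y" and ?g' = "\<lambda>y. Phi l0 l1 y * (P y * u y + u' y)"
  have d1: "(?g has_field_derivative ?g' y) (at y)" if "y \<in> T" for y
    using DERIV_mult[OF dPhi[OF that] u[of y]] that by (simp add: T_def algebra_simps)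
  define P' where "P' = - (of_real pi ^ 2) * (of_nat (l0 + 1) / s x ^ 2 + of_nat (l1 + 1) / c x ^ 2)"
  have "(?g' has_field_derivative Phi l0 l1 x * P x * (P x * u x + u' x)
      + (P' * u x + u' x * P x + u'') * Phi l0 l1 x) (at x)"
    by (intro DERIV_mult DERIV_add dPhi T dP[folded P'_def] u S u')
  then have d2: "(?g' has_field_derivative Phi l0 l1 x * ((P x ^ 2 + P') * u x + 2 * P x * u' x + u'')) (at x)"
    by (simp add: algebra_simps power2_eq_square)
  have "deriv ?g y = ?g' y" if "y \<in> T" for y using d1[OF that] by (rule DERIV_imp_deriv)
  then have "(deriv ?g has_field_derivative Phi l0 l1 x * ((P x ^ 2 + P') * u x + 2 * P x * u' x + u'')) (at x)"
    by (intro has_field_derivative_transform_within_open[OF d2 T]) simp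
  then have dd: "(deriv ^^ 2) ?g x = Phi l0 l1 x * ((P x ^ 2 + P') * u x + 2 * P x * u' x + u'')"
    by (simp add: numeral_2_eq_2 DERIV_imp_deriv)
  have "P x ^ 2 + P' = of_nat (l0 * (l0 + 1)) * (of_real pi ^ 2 / s x ^ 2)
      + of_nat (l1 * (l1 + 1)) * (of_real pi ^ 2 / c x ^ 2) - of_real pi ^ 2 * of_nat (l0 + l1 + 2) ^ 2"
  proof -
    define N M where "N = (of_nat (l0 + 1) :: complex)" and "M = (of_nat (l1 + 1) :: complex)"
    define a b where "a = 1 / s x ^ 2" and "b = 1 / c x ^ 2"
    have "(c x / s x) ^ 2 = a - 1" "(s x / c x) ^ 2 = b - 1"
      using sc[of x] nz[OF T(2)] by (simp_all add: a_def b_def field_simps)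
    moreover have "(c x / s x) * (s x / c x) = 1" using nz[OF T(2)] by simp
    moreover have "P x ^ 2 = of_real pi ^ 2 * (N ^ 2 * (c x / s x) ^ 2 - 2 * N * M * ((c x / s x) * (s x / c x)) + M ^ 2 * (s x / c x) ^ 2)"
      unfolding P_def N_def [symmetric] M_def [symmetric] by (simp add: algebra_simps power2_eq_square)
    ultimately have "P x ^ 2 = of_real pi ^ 2 * (N ^ 2 * (a - 1) - 2 * N * M + M ^ 2 * (b - 1))" by simp
    moreover have "P' = - (of_real pi ^ 2) * (N * a + M * b)" by (simp add: P'_def N_def M_def a_def b_def)
    moreover have "of_nat (l0 * (l0 + 1)) = N ^ 2 - N" "of_nat (l1 * (l1 + 1)) = M ^ 2 - M" "of_nat (l0 + l1 + 2) = N + M"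
      by (simp_all add: N_def M_def algebra_simps power2_eq_square)
    moreover have "of_real pi ^ 2 / s x ^ 2 = of_real pi ^ 2 * a" "of_real pi ^ 2 / c x ^ 2 = of_real pi ^ 2 * b"
      by (simp_all add: a_def b_def)
    ultimately show ?thesis by (simp only:) (simp add: algebra_simps power2_eq_square)
  qed
  note * = this
  have g: "gauged l0 l1 x (u' x) u'' = - u'' - 2 * P x * u' x"
    by (simp add: gauged_def P_def s_def c_def mult.assoc)
  show ?thesis unfolding hamiltonian_T_def dd g * s_def c_def
    by (simp add: algebra_simps)
qed

text \<open>On the imaginary axis the modes are \<open>(Q\<^sup>k + Q\<^sup>-\<^sup>k) / 2\<close> with \<open>Q > 1\<close> arbitrary, so after
  multiplication by \<open>2 Q\<^sup>n\<close> the relation says that a polynomial vanishes on a half line.\<close>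
lemma cos_mode_independent:
  assumes zero: "\<And>x. x \<notin> half_integers \<Longrightarrow> (\<Sum>k\<le>n. d k * cos_mode k x) = 0" and k: "k \<le> n"
  shows "d k = 0"
proof -
  define P where "P = (\<Sum>k\<le>n. monom (d k) (n + k) + monom (d k) (n - k))"
  have root: "poly P (of_real q) = 0" if q: "q > 1" for q :: real
  proof -
    define y where "y = ln q / (2 * pi)"
    have y: "y > 0" using q by (simp add: y_def)
    have "\<i> * of_real y \<notin> half_integers"
      using y by (auto simp: half_integers_def complex_eq_iff)
    note z = zero[OF this]
    define Q where "Q = complex_of_real q"
    have Q0: "Q \<noteq> 0" using q by (simp add: Q_def)
    have eQ: "exp (of_nat k * of_real (ln q)) = Q ^ k" for k
      using q by (simp add: Q_def exp_of_nat_mult exp_of_real)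
    have c: "cos_mode k (\<i> * of_real y) = (1 / Q ^ k + Q ^ k) / 2" for k
    proof -
      have e1: "\<i> * (2 * of_real pi * of_nat k * (\<i> * of_real y)) = - (of_nat k * of_real (ln q))"
      proof -
        have "complex_of_real (2 * pi * y) = of_real (ln q)" by (simp add: y_def)
        then have "2 * of_real pi * of_real y = complex_of_real (ln q)" by simp
        then have "- (of_nat k * complex_of_real (ln q)) = (\<i> * \<i>) * (of_nat k * (2 * of_real pi * of_real y))"
          by simp
        then show ?thesis by (simp only: mult_ac)
      qed
      show ?thesis unfolding cos_mode_def cos_exp_eq e1 by (simp add: exp_minus eQ inverse_eq_divide)
    qed
    have "poly P Q = (\<Sum>k\<le>n. d k * (2 * Q ^ n * cos_mode k (\<i> * of_real y)))"
      unfolding P_def poly_sum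
    proof (rule sum.cong)
      fix k assume "k \<in> {..n}"
      then have "Q ^ n = Q ^ k * Q ^ (n - k)" by (simp flip: power_add)
      then have "2 * Q ^ n * cos_mode k (\<i> * of_real y) = Q ^ (n - k) + Q ^ (n + k)"
        using Q0 by (simp add: c power_add field_simps)
      then show "poly (monom (d k) (n + k) + monom (d k) (n - k)) Q = d k * (2 * Q ^ n * cos_mode k (\<i> * of_real y))"
        by (simp add: poly_monom algebra_simps)
    qed simp
    also have "\<dots> = 2 * Q ^ n * (\<Sum>k\<le>n. d k * cos_mode k (\<i> * of_real y))"
      by (simp add: sum_distrib_left mult_ac)
    finally show ?thesis using z by (simp add: Q_def)
  qed
  have "P = 0"
  proof (rule ccontr)
    assume "P \<noteq> 0"
    then have "finite {x. poly P x = 0}" by (rule poly_roots_finite)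
    moreover have "complex_of_real ` {1<..} \<subseteq> {x. poly P x = 0}" using root by auto
    ultimately have "finite (complex_of_real ` {1<..})" by (rule rev_finite_subset)
    then have "finite {1::real<..}" by (subst (asm) finite_image_iff) (auto intro: inj_onI)
    then show False using infinite_Ioi by blast
  qed
  have "coeff P (n + k) = (\<Sum>i\<le>n. (if i = k then d i else 0) + (if i = k \<and> k = 0 then d i else 0))"
    unfolding P_def coeff_sum by (intro sum.cong) (use k in auto)
  also have "\<dots> = d k + (if k = 0 then d k else 0)"
    unfolding sum.distrib using k by (auto simp: sum.delta)
  finally show ?thesis using \<open>P = 0\<close> by (auto split: if_splits)
qed

section \<open>Jacobi polynomials as cosine polynomials\<close>

definition cos_poly :: "nat \<Rightarrow> (complex \<Rightarrow> complex) \<Rightarrow> bool" where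
  "cos_poly n f \<longleftrightarrow> (\<exists>b. (\<forall>k>n. b k = 0) \<and> (\<forall>x. f x = (\<Sum>k\<le>n. b k * cos_mode k x)))"

lemma cos_poly_mono: "cos_poly n f \<Longrightarrow> n \<le> n' \<Longrightarrow> cos_poly n' f"
proof -
  assume "cos_poly n f" "n \<le> n'"
  then obtain b where b: "\<And>k. k > n \<Longrightarrow> b k = 0" "\<And>x. f x = (\<Sum>k\<le>n. b k * cos_mode k x)"
    by (auto simp: cos_poly_def)
  have "(\<Sum>k\<le>n. b k * cos_mode k x) = (\<Sum>k\<le>n'. b k * cos_mode k x)" for x
    using \<open>n \<le> n'\<close> by (intro sum.mono_neutral_left) (auto simp: b(1))
  then show ?thesis unfolding cos_poly_def using b \<open>n \<le> n'\<close> by (intro exI[of _ b]) auto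
qed

lemma cos_poly_cos_mode: "cos_poly k (cos_mode k)"
  unfolding cos_poly_def by (intro exI[of _ "\<lambda>j. if j = k then 1 else 0"]) (auto simp: if_distrib[of "\<lambda>c. c * _"] cong: if_cong)

lemma cos_poly_add: "cos_poly n f \<Longrightarrow> cos_poly n g \<Longrightarrow> cos_poly n (\<lambda>x. f x + g x)"
  unfolding cos_poly_def
  by (elim exE conjE, rule_tac x = "\<lambda>k. b k + ba k" in exI) (auto simp: sum.distrib algebra_simps)

lemma cos_poly_cmult: "cos_poly n f \<Longrightarrow> cos_poly n (\<lambda>x. c * f x)"
  unfolding cos_poly_def
  by (elim exE conjE, rule_tac x = "\<lambda>k. c * b k" in exI) (auto simp: sum_distrib_left algebra_simps)

lemma cos_poly_sum: "finite A \<Longrightarrow> (\<And>i. i \<in> A \<Longrightarrow> cos_poly n (f i)) \<Longrightarrow> cos_poly n (\<lambda>x. \<Sum>i\<in>A. f i x)"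
proof (induction A rule: finite_induct)
  case empty
  show ?case unfolding cos_poly_def by (intro exI[of _ "\<lambda>_. 0"]) simp
next
  case (insert a A)
  then show ?case by (simp add: cos_poly_add)
qed

lemma cos_poly_mult_cos: "cos_poly n f \<Longrightarrow> cos_poly (Suc n) (\<lambda>x. cos_mode 1 x * f x)"
proof -
  assume "cos_poly n f"
  then obtain b where b: "f x = (\<Sum>k\<le>n. b k * cos_mode k x)" for x by (auto simp: cos_poly_def)
  have "cos_poly (Suc n) (\<lambda>x. \<Sum>k\<le>n. b k * (1/2 * (cos_mode (1 + k) x + cos_mode ((1 - k) + (k - 1)) x)))"
    by (intro cos_poly_sum cos_poly_cmult cos_poly_add cos_poly_mono[OF cos_poly_cos_mode]) auto
  moreover have "(\<lambda>x. \<Sum>k\<le>n. b k * (1/2 * (cos_mode (1 + k) x + cos_mode ((1 - k) + (k - 1)) x)))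
    = (\<lambda>x. cos_mode 1 x * f x)"
    unfolding b sum_distrib_left
  proof (intro ext sum.cong refl)
    fix x k
    have "cos_mode 1 x * (b k * cos_mode k x) = b k * (cos_mode 1 x * cos_mode k x)" by simp
    also have "\<dots> = b k * (1/2 * (cos_mode (1 + k) x + cos_mode ((1 - k) + (k - 1)) x))"
      unfolding cos_mode_mult by simp
    finally show "b k * (1/2 * (cos_mode (1 + k) x + cos_mode ((1 - k) + (k - 1)) x)) = cos_mode 1 x * (b k * cos_mode k x)" ..
  qed
  ultimately show ?thesis by simp
qed

lemma sin_sq_eq: "sin (of_real pi * x) ^ 2 = (1 - cos_mode 1 x) / 2"
proof -
  have "cos_mode 1 x = cos (2 * (of_real pi * x))" by (simp add: cos_mode_def mult.assoc)
  then show ?thesis unfolding cos_double_sin by simp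
qed

lemma cos_poly_sin_power: "cos_poly n (\<lambda>x. sin (of_real pi * x) ^ (2 * n))"
proof (induction n)
  case 0
  show ?case using cos_poly_cos_mode[of 0] by (simp add: cos_mode_def [abs_def])
next
  case (Suc n)
  have "cos_poly (Suc n) (\<lambda>x. 1/2 * sin (of_real pi * x) ^ (2 * n) + (- 1/2) * (cos_mode 1 x * sin (of_real pi * x) ^ (2 * n)))"
    by (intro cos_poly_add cos_poly_cmult cos_poly_mult_cos cos_poly_mono[OF Suc.IH] Suc.IH) simp
  moreover have "(\<lambda>x. 1/2 * sin (of_real pi * x) ^ (2 * n) + (- 1/2) * (cos_mode 1 x * sin (of_real pi * x) ^ (2 * n)))
      = (\<lambda>x. sin (of_real pi * x) ^ (2 * Suc n))"
  proof
    fix x :: complex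
    have "sin (of_real pi * x) ^ (2 * Suc n) = sin (of_real pi * x) ^ 2 * sin (of_real pi * x) ^ (2 * n)"
      by (simp add: power2_eq_square)
    then show "1/2 * sin (of_real pi * x) ^ (2 * n) + (- 1/2) * (cos_mode 1 x * sin (of_real pi * x) ^ (2 * n))
      = sin (of_real pi * x) ^ (2 * Suc n)"
      unfolding sin_sq_eq by (simp add: field_simps)
  qed
  ultimately show ?case by simp
qed

definition jacobi_coeff :: "nat \<Rightarrow> nat \<Rightarrow> nat \<Rightarrow> nat \<Rightarrow> complex" where
  "jacobi_coeff l0 l1 m n = pochhammer (- of_nat m) n * pochhammer (of_nat (l0 + l1 + 2 + m)) n
     / (pochhammer (of_nat (2 * l0 + 3) / 2) n * fact n)"

lemma jacobi_coeff_0: "jacobi_coeff l0 l1 m 0 = 1"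
  by (simp add: jacobi_coeff_def)

lemma pochhammer_denominator_nonzero: "pochhammer (of_nat (2 * l0 + 3) / 2 :: complex) n \<noteq> 0"
proof
  assume "pochhammer (of_nat (2 * l0 + 3) / 2 :: complex) n = 0"
  then obtain k where "of_nat (2 * l0 + 3) / 2 = - (of_nat k :: complex)" by (auto simp: pochhammer_eq_0_iff)
  then have "Re (of_nat (2 * l0 + 3) / 2) = Re (- (of_nat k))" by simp
  then show False by simp
qed

lemma jacobi_coeff_Suc:
  "of_nat (Suc n) * (of_nat n + of_nat l0 + 3 / 2) * jacobi_coeff l0 l1 m (Suc n)
    = (of_nat (n * (n + (l0 + l1 + 2))) - of_nat (m * (m + (l0 + l1 + 2)))) * jacobi_coeff l0 l1 m n"
proof -
  define c where "c = (of_nat (2 * l0 + 3) / 2 :: complex)"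
  have c: "of_nat n + of_nat l0 + 3 / 2 = c + of_nat n" by (simp add: c_def field_simps)
  have p0: "pochhammer c k \<noteq> 0" for k unfolding c_def by (rule pochhammer_denominator_nonzero)
  from p0[of "Suc n"] have c0: "c + of_nat n \<noteq> 0" by (auto simp: pochhammer_Suc)
  have "of_nat (Suc n) * (c + of_nat n) * jacobi_coeff l0 l1 m (Suc n)
      = (- of_nat m + of_nat n) * (of_nat (l0 + l1 + 2 + m) + of_nat n) * jacobi_coeff l0 l1 m n"
  proof -
    define A B D F where "A = pochhammer (- of_nat m :: complex) n" and "B = pochhammer (of_nat (l0 + l1 + 2 + m) :: complex) n"
      and "D = pochhammer c n" and "F = (fact n :: complex)"
    have nz: "D \<noteq> 0" "F \<noteq> 0" "of_nat (Suc n) \<noteq> (0::complex)" using p0 by (simp_all add: D_def F_def del: of_nat_Suc)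
    have "jacobi_coeff l0 l1 m (Suc n) = (A * (- of_nat m + of_nat n)) * (B * (of_nat (l0 + l1 + 2 + m) + of_nat n))
      / ((D * (c + of_nat n)) * (of_nat (Suc n) * F))"
      by (simp only: jacobi_coeff_def c_def[symmetric] pochhammer_Suc fact_Suc A_def B_def D_def F_def)
    moreover have "jacobi_coeff l0 l1 m n = A * B / (D * F)"
      by (simp only: jacobi_coeff_def c_def[symmetric] A_def B_def D_def F_def)
    moreover have "N * w * ((A * u) * (B * v) / ((D * w) * (N * F))) = u * v * (A * B / (D * F))"
      if "N \<noteq> 0" "w \<noteq> 0" for N w u v :: complex
      using that nz by (simp add: field_simps)
    ultimately show ?thesis using nz(3) c0 by (simp only: not_False_eq_True)
  qed
  then show ?thesis unfolding c by (simp add: algebra_simps)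
qed

lemma jacobi_coeff_eq_0: "n > m \<Longrightarrow> jacobi_coeff l0 l1 m n = 0"
  by (simp add: jacobi_coeff_def pochhammer_of_nat_eq_0_iff)

lemma jacobi_coeff_top: "jacobi_coeff l0 l1 m m \<noteq> 0"
proof -
  have "pochhammer (- of_nat m :: complex) m \<noteq> 0" by (simp add: pochhammer_of_nat_eq_0_iff)
  moreover have "pochhammer (of_nat (l0 + l1 + 2 + m) :: complex) m \<noteq> 0"
  proof
    assume "pochhammer (of_nat (l0 + l1 + 2 + m) :: complex) m = 0"
    then obtain k where "of_nat (l0 + l1 + 2 + m) = - (of_nat k :: complex)" by (auto simp: pochhammer_eq_0_iff)
    then have "Re (of_nat (l0 + l1 + 2 + m)) = Re (- (of_nat k))" by simp
    then show False by simp
  qed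
  ultimately show ?thesis using pochhammer_denominator_nonzero by (simp add: jacobi_coeff_def)
qed

lemma jacobi_eq: "jacobi l0 l1 m x = (\<Sum>n\<le>m. jacobi_coeff l0 l1 m n * ((1 - cos_mode 1 x) / 2) ^ n)"
proof -
  have "jacobi l0 l1 m x = (\<Sum>n. jacobi_coeff l0 l1 m n * ((1 - cos_mode 1 x) / 2) ^ n)"
    by (simp add: jacobi_def hyp2F1_def jacobi_coeff_def cos_mode_def)
  also have "\<dots> = (\<Sum>n\<le>m. jacobi_coeff l0 l1 m n * ((1 - cos_mode 1 x) / 2) ^ n)"
    by (rule suminf_finite) (auto simp: jacobi_coeff_eq_0)
  finally show ?thesis .
qed

lemma jacobi_eq_sin: "jacobi l0 l1 m x = (\<Sum>n\<le>m. jacobi_coeff l0 l1 m n * sin (of_real pi * x) ^ (2 * n))"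
  unfolding jacobi_eq power_mult sin_sq_eq ..

text \<open>As a polynomial in \<open>cos (2 \<pi> x)\<close> the hypergeometric polynomial has degree exactly \<open>m\<close>, and the
  cosine takes all complex values, so the normalising constant is the inverse of the leading
  coefficient and is uniquely determined.\<close>
lemma jacobi_const_nonzero: "jacobi_const l0 l1 m \<noteq> 0"
proof -
  define q where "q = (\<Sum>n\<le>m. smult (jacobi_coeff l0 l1 m n) ([:1/2, - (1/2):] ^ n))"
  have deg: "degree ([:1/2, - (1/2):] ^ n :: complex poly) = n" for n by (simp add: degree_power_eq)
  have q_eval: "poly q (cos (2 * of_real pi * x)) = jacobi l0 l1 m x" for x
    by (simp add: q_def poly_sum jacobi_eq cos_mode_def diff_divide_distrib)
  have "degree q \<le> m" unfolding q_def
    by (intro degree_sum_le) (auto intro!: order_trans[OF degree_smult_le] simp: deg simp del: degree_smult_eq)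
  have lead: "coeff q m = jacobi_coeff l0 l1 m m * (- (1/2)) ^ m"
  proof -
    have "coeff q m = (\<Sum>n\<le>m. jacobi_coeff l0 l1 m n * coeff ([:1/2, - (1/2):] ^ n) m)"
      by (simp add: q_def coeff_sum)
    also have "\<dots> = (\<Sum>n\<in>{m}. jacobi_coeff l0 l1 m n * coeff ([:1/2, - (1/2):] ^ n) m)"
      by (rule sum.mono_neutral_right) (auto simp: coeff_eq_0 deg)
    also have "\<dots> = jacobi_coeff l0 l1 m m * coeff ([:1/2, - (1/2):] ^ m) m" by simp
    also have "coeff ([:1/2, - (1/2):] ^ m) m = (- (1/2) :: complex) ^ m"
      using lead_coeff_power[of "[:1/2, - (1/2):] :: complex poly" m] by (simp add: deg)
    finally show ?thesis by simp
  qed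
  then have lead0: "coeff q m \<noteq> 0" using jacobi_coeff_top by simp
  have q_sum: "poly q z = coeff q m * z ^ m + (\<Sum>k<m. coeff q k * z ^ k)" for z
  proof -
    have "poly q z = (\<Sum>k\<le>m. coeff q k * z ^ k)"
      unfolding poly_altdef using \<open>degree q \<le> m\<close>
      by (intro sum.mono_neutral_left) (auto simp: coeff_eq_0)
    then show ?thesis by (simp flip: lessThan_Suc_atMost)
  qed
  have "jacobi_const l0 l1 m = 1 / coeff q m"
    unfolding jacobi_const_def
  proof (rule the_equality)
    show "\<exists>a. \<forall>x. 1 / coeff q m * jacobi l0 l1 m x
        = cos (2 * of_real pi * x) ^ m + (\<Sum>k<m. a k * cos (2 * of_real pi * x) ^ k)"
      using lead0 by (intro exI[of _ "\<lambda>k. coeff q k / coeff q m"] allI)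
        (simp flip: q_eval add: q_sum sum_divide_distrib add_divide_distrib)
  next
    fix c assume "\<exists>a. \<forall>x. c * jacobi l0 l1 m x
        = cos (2 * of_real pi * x) ^ m + (\<Sum>k<m. a k * cos (2 * of_real pi * x) ^ k)"
    then obtain a where a: "c * jacobi l0 l1 m x
        = cos (2 * of_real pi * x) ^ m + (\<Sum>k<m. a k * cos (2 * of_real pi * x) ^ k)" for x by blast
    define r where "r = smult c q - (monom 1 m + (\<Sum>k<m. monom (a k) k))"
    have "poly r z = 0" for z
    proof -
      define x where "x = Arccos z / (2 * of_real pi)"
      have z: "cos (2 * of_real pi * x) = z" by (simp add: x_def)
      show ?thesis using a[of x] unfolding q_eval[symmetric] z by (simp add: r_def poly_sum poly_monom)
    qed
    then have "r = 0" using poly_all_0_iff_0 by blast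
    then have "coeff r m = 0" by simp
    then have "c * coeff q m = 1" by (simp add: r_def coeff_sum)
    then show "c = 1 / coeff q m" using lead0 by (simp add: field_simps)
  qed
  then show ?thesis using lead0 by simp
qed

text \<open>The recursion of the hypergeometric coefficients says that the Jacobi polynomial, written in powers
  of \<open>sin\<^sup>2 (\<pi> x)\<close>, is an eigenfunction of the gauged operator. Rewriting it in cosines and comparing
  coefficients yields an eigenvector of the triangular matrix. Its top entry cannot vanish: the
  diagonal entries are distinct, so otherwise all entries would vanish in turn.\<close>
lemma jacobi_cos_expansion:
  obtains b where "b m \<noteq> 0" "\<And>k. k > m \<Longrightarrow> b k = 0"
    "\<And>x. jacobi l0 l1 m x = (\<Sum>k\<le>m. b k * cos_mode k x)"
    "\<And>k. (of_nat (k * (k + (l0 + l1 + 2))) - of_nat (m * (m + (l0 + l1 + 2)))) * b k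
      + (\<Sum>j\<le>m. trig_coupling l0 l1 k j * b j) = 0"
proof -
  let ?L = "l0 + l1 + 2"
  let ?\<mu> = "\<lambda>k::nat. of_nat (k * (k + ?L)) :: complex"
  let ?J = "jacobi l0 l1 m"
  have "cos_poly m (\<lambda>x. \<Sum>n\<le>m. jacobi_coeff l0 l1 m n * sin (of_real pi * x) ^ (2 * n))"
    by (intro cos_poly_sum cos_poly_cmult cos_poly_mono[OF cos_poly_sin_power]) auto
  then have "cos_poly m ?J" by (simp add: jacobi_eq_sin [abs_def])
  then obtain b where b: "\<And>k. k > m \<Longrightarrow> b k = 0" "\<And>x. ?J x = (\<Sum>k\<le>m. b k * cos_mode k x)"
    unfolding cos_poly_def by blast
  define s c where "s x = sin (of_real pi * x)" and "c x = cos (of_real pi * x)" for x :: complex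
  have sc: "c x ^ 2 = 1 - s x ^ 2" for x unfolding s_def c_def by (rule cos_squared_eq)
  have ds: "(s has_field_derivative of_real pi * c x) (at x)" and dc: "(c has_field_derivative - of_real pi * s x) (at x)" for x
    unfolding s_def [abs_def] c_def [abs_def] by (rule derivative_eq_intros refl | simp)+
  define p1 where "p1 n x = (case n of 0 \<Rightarrow> 0 | Suc k \<Rightarrow> 2 * of_real pi * of_nat (Suc k) * (s x ^ (2 * k + 1) * c x))" for n x
  define p2 where "p2 n x = (case n of 0 \<Rightarrow> 0 | Suc k \<Rightarrow> 2 * of_real pi ^ 2 * of_nat (Suc k) *
      (of_nat (2 * k + 1) * s x ^ (2 * k) * c x ^ 2 - s x ^ (2 * k + 2)))" for n x
  have dp0: "((\<lambda>x. s x ^ (2 * n)) has_field_derivative p1 n x) (at x)" for n x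
  proof (cases n)
    case (Suc k)
    have "((\<lambda>x. s x ^ Suc (2 * k + 1)) has_field_derivative
        (1 + of_nat (2 * k + 1)) * (of_real pi * c x * s x ^ (2 * k + 1))) (at x)"
      by (rule DERIV_power_Suc[OF ds])
    then show ?thesis by (simp add: Suc p1_def algebra_simps)
  qed (simp add: p1_def)
  have dp1: "((\<lambda>x. p1 n x) has_field_derivative p2 n x) (at x)" for n x
  proof (cases n)
    case (Suc k)
    have "((\<lambda>x. 2 * of_real pi * of_nat (Suc k) * (s x ^ Suc (2 * k) * c x)) has_field_derivative
        2 * of_real pi * of_nat (Suc k) * (((1 + of_nat (2 * k)) * (of_real pi * c x * s x ^ (2 * k))) * c x
         + (- of_real pi * s x) * s x ^ Suc (2 * k))) (at x)"
      by (intro DERIV_cmult DERIV_mult DERIV_power_Suc ds dc)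
    moreover have "2 * of_real pi * of_nat (Suc k) * (((1 + of_nat (2 * k)) * (of_real pi * c x * s x ^ (2 * k))) * c x
         + (- of_real pi * s x) * s x ^ Suc (2 * k)) = p2 n x"
      by (simp add: Suc p2_def algebra_simps power2_eq_square)
    ultimately show ?thesis by (simp add: Suc p1_def)
  qed (simp add: p1_def p2_def)
  have gauged_p: "gauged l0 l1 x (p1 n x) (p2 n x) = 4 * of_real pi ^ 2 *
      (?\<mu> n * s x ^ (2 * n) - (case n of 0 \<Rightarrow> 0 | Suc k \<Rightarrow> of_nat (Suc k) * (of_nat k + of_nat l0 + 3/2) * s x ^ (2 * k)))"
    if "x \<notin> half_integers" for n x
  proof (cases n)
    case 0
    then show ?thesis by (simp add: gauged_def p1_def p2_def)
  next
    case (Suc k)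
    have nz: "s x \<noteq> 0" "c x \<noteq> 0" using that half_integers_iff by (auto simp: s_def c_def)
    define S N where "S = s x ^ (2 * k)" and "N = (of_nat (Suc k) :: complex)"
    have "c x / s x * (s x ^ (2 * k + 1) * c x) = S * c x ^ 2" "s x / c x * (s x ^ (2 * k + 1) * c x) = S * s x ^ 2"
      using nz by (simp_all add: S_def power2_eq_square)
    then have cs: "c x / s x * (s x ^ (2 * k + 1) * c x) = S * (1 - s x ^ 2)"
      "s x / c x * (s x ^ (2 * k + 1) * c x) = S * s x ^ 2" by (simp_all add: sc)
    have "gauged l0 l1 x (p1 n x) (p2 n x) = - p2 n x - 4 * of_real pi ^ 2 * N *
      (of_nat (l0 + 1) * (c x / s x * (s x ^ (2 * k + 1) * c x)) - of_nat (l1 + 1) * (s x / c x * (s x ^ (2 * k + 1) * c x)))"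
    proof -
      define p q X where "p = c x / s x" and "q = s x / c x" and "X = s x ^ (2 * k + 1) * c x"
      show ?thesis unfolding gauged_def s_def [of x, symmetric] c_def [of x, symmetric] p_def [symmetric] q_def [symmetric]
        by (simp add: Suc p1_def N_def [symmetric] X_def [symmetric] algebra_simps power2_eq_square del: of_nat_Suc power_Suc)
    qed
    also have "\<dots> = 4 * of_real pi ^ 2 * (N * S * (s x ^ 2 * (of_nat k + of_nat l0 + of_nat l1 + 3) - (of_nat k + of_nat l0 + 3/2)))"
    proof -
      have p2: "p2 n x = 2 * of_real pi ^ 2 * N * (of_nat (2 * k + 1) * S * (1 - s x ^ 2) - S * s x ^ 2)"
        unfolding sc[of x, symmetric] by (simp add: Suc p2_def S_def N_def power2_eq_square)
      show ?thesis unfolding p2 cs by (simp add: algebra_simps)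
    qed
    also have "\<dots> = 4 * of_real pi ^ 2 * (?\<mu> n * s x ^ (2 * n) - N * (of_nat k + of_nat l0 + 3/2) * S)"
    proof -
      have "?\<mu> n = N * (of_nat k + of_nat l0 + of_nat l1 + 3)" by (simp add: Suc N_def algebra_simps)
      moreover have "s x ^ (2 * n) = S * s x ^ 2" by (simp add: Suc S_def power2_eq_square)
      ultimately show ?thesis by (simp add: algebra_simps)
    qed
    finally show ?thesis by (simp add: Suc S_def N_def)
  qed
  let ?h = "jacobi_coeff l0 l1 m"
  have J1: "(?J has_field_derivative (\<Sum>n\<le>m. ?h n * p1 n x)) (at x)" for x
    unfolding jacobi_eq_sin [abs_def] s_def [symmetric] by (intro DERIV_sum DERIV_cmult dp0)
  have J1': "(?J has_field_derivative (\<Sum>k\<le>m. b k * cos_mode_D k x)) (at x)" for x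
    unfolding b(2) [abs_def] by (intro DERIV_sum DERIV_cmult DERIV_cos_mode)
  have e1: "(\<Sum>n\<le>m. ?h n * p1 n x) = (\<Sum>k\<le>m. b k * cos_mode_D k x)" for x
    by (rule DERIV_unique[OF J1 J1'])
  have e2: "(\<Sum>n\<le>m. ?h n * p2 n x) = (\<Sum>k\<le>m. b k * cos_mode_DD k x)" for x
  proof (rule DERIV_unique)
    show "((\<lambda>x. \<Sum>n\<le>m. ?h n * p1 n x) has_field_derivative (\<Sum>n\<le>m. ?h n * p2 n x)) (at x)"
      by (intro DERIV_sum DERIV_cmult dp1)
    show "((\<lambda>x. \<Sum>n\<le>m. ?h n * p1 n x) has_field_derivative (\<Sum>k\<le>m. b k * cos_mode_DD k x)) (at x)"
      unfolding e1 by (intro DERIV_sum DERIV_cmult DERIV_cos_mode_D)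
  qed
  have ode: "(\<Sum>n\<le>m. ?h n * gauged l0 l1 x (p1 n x) (p2 n x)) = 4 * of_real pi ^ 2 * (?\<mu> m * ?J x)"
    if x: "x \<notin> half_integers" for x
  proof -
    let ?g = "\<lambda>n. ?h n * (case n of 0 \<Rightarrow> 0 | Suc k \<Rightarrow> of_nat (Suc k) * (of_nat k + of_nat l0 + 3/2) * s x ^ (2 * k))"
    have "(\<Sum>n\<le>m. ?g n) = (\<Sum>n\<le>Suc m. ?g n)" by (simp add: jacobi_coeff_eq_0)
    also have "\<dots> = (\<Sum>n\<le>m. ?g (Suc n))" by (subst sum.atMost_Suc_shift) simp
    also have "\<dots> = (\<Sum>n\<le>m. (?\<mu> n - ?\<mu> m) * ?h n * s x ^ (2 * n))"
    proof (rule sum.cong[OF refl])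
      fix n
      have "?g (Suc n) = (of_nat (Suc n) * (of_nat n + of_nat l0 + 3/2) * ?h (Suc n)) * s x ^ (2 * n)" by simp
      also have "\<dots> = (?\<mu> n - ?\<mu> m) * ?h n * s x ^ (2 * n)" by (simp only: jacobi_coeff_Suc)
      finally show "?g (Suc n) = (?\<mu> n - ?\<mu> m) * ?h n * s x ^ (2 * n)" .
    qed
    finally have g: "(\<Sum>n\<le>m. ?g n) = (\<Sum>n\<le>m. (?\<mu> n - ?\<mu> m) * ?h n * s x ^ (2 * n))" .
    have "(\<Sum>n\<le>m. ?h n * gauged l0 l1 x (p1 n x) (p2 n x))
        = 4 * of_real pi ^ 2 * ((\<Sum>n\<le>m. ?\<mu> n * ?h n * s x ^ (2 * n)) - (\<Sum>n\<le>m. ?g n))"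
      unfolding gauged_p[OF x] sum_subtractf[symmetric] sum_distrib_left
      by (intro sum.cong refl) (simp only: algebra_simps)
    also have "\<dots> = 4 * of_real pi ^ 2 * (\<Sum>n\<le>m. ?\<mu> m * (?h n * s x ^ (2 * n)))"
      unfolding g sum_subtractf[symmetric] by (simp only: algebra_simps) simp
    finally show ?thesis unfolding jacobi_eq_sin s_def sum_distrib_left .
  qed
  have rec: "(?\<mu> k - ?\<mu> m) * b k + (\<Sum>j\<le>m. trig_coupling l0 l1 k j * b j) = 0" if "k \<le> m" for k
  proof (rule cos_mode_independent[OF _ that])
    fix x assume x: "x \<notin> half_integers"
    have "4 * of_real pi ^ 2 * (?\<mu> m * ?J x) = gauged l0 l1 x (\<Sum>k\<le>m. b k * cos_mode_D k x) (\<Sum>k\<le>m. b k * cos_mode_DD k x)"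
      unfolding ode[OF x, symmetric] gauged_sum[symmetric] e1 e2 ..
    also have "\<dots> = (\<Sum>k\<le>m. b k * (4 * of_real pi ^ 2 * (?\<mu> k * cos_mode k x + (\<Sum>j<k. trig_coupling l0 l1 j k * cos_mode j x))))"
      unfolding gauged_sum gauged_cos_mode[OF x] ..
    also have "\<dots> = 4 * of_real pi ^ 2 * ((\<Sum>k\<le>m. ?\<mu> k * b k * cos_mode k x) + (\<Sum>k\<le>m. \<Sum>j<k. trig_coupling l0 l1 j k * b k * cos_mode j x))"
      by (simp add: sum_distrib_left sum.distrib algebra_simps)
    also have "(\<Sum>k\<le>m. \<Sum>j<k. trig_coupling l0 l1 j k * b k * cos_mode j x)
        = (\<Sum>k\<le>m. \<Sum>j\<le>m. trig_coupling l0 l1 j k * b k * cos_mode j x)"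
      by (intro sum.cong refl sum.mono_neutral_left) (auto simp: trig_coupling_def)
    also have "\<dots> = (\<Sum>j\<le>m. \<Sum>k\<le>m. trig_coupling l0 l1 j k * b k * cos_mode j x)" by (rule sum.swap)
    finally have "?\<mu> m * ?J x = (\<Sum>k\<le>m. ?\<mu> k * b k * cos_mode k x) + (\<Sum>j\<le>m. \<Sum>k\<le>m. trig_coupling l0 l1 j k * b k * cos_mode j x)"
      by simp
    then show "(\<Sum>k\<le>m. ((?\<mu> k - ?\<mu> m) * b k + (\<Sum>j\<le>m. trig_coupling l0 l1 k j * b j)) * cos_mode k x) = 0"
      unfolding b(2) by (simp add: sum_distrib_left sum_distrib_right sum.distrib sum_subtractf algebra_simps)
  qed
  have rec': "(?\<mu> k - ?\<mu> m) * b k + (\<Sum>j\<le>m. trig_coupling l0 l1 k j * b j) = 0" for k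
    using rec[of k] by (cases "k \<le> m") (auto simp: b(1) trig_coupling_def)
  have "b m \<noteq> 0"
  proof
    assume bm: "b m = 0"
    have "b (m - i) = 0" for i
    proof (induction i rule: less_induct)
      case (less i)
      show ?case
      proof (cases "i = 0 \<or> m = 0")
        case False
        define k where "k = m - i"
        have above: "b j = 0" if "k < j" for j
        proof (cases "j \<le> m")
          case True
          have "b (m - (m - j)) = 0" by (rule less.IH) (use that True k_def False in linarith)
          then show ?thesis using True by simp
        qed (use b(1) in simp)
        have "(\<Sum>j\<le>m. trig_coupling l0 l1 k j * b j) = 0"
          by (rule sum.neutral) (auto simp: trig_coupling_def above)
        then have "(?\<mu> k - ?\<mu> m) * b k = 0" using rec'[of k] by simp
        moreover have "k * (k + ?L) < m * (m + ?L)"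
          using False by (intro mult_strict_mono) (auto simp: k_def)
        then have "?\<mu> k \<noteq> ?\<mu> m" by (metis less_irrefl of_nat_eq_iff)
        ultimately show ?thesis by (simp add: k_def)
      qed (use bm in auto)
    qed
    then have "b k = 0" for k by (metis b(1) diff_diff_cancel not_le)
    then have "?J 0 = 0" using b(2) by simp
    moreover have "?J 0 = 1"
    proof -
      have "?J 0 = (\<Sum>n\<in>{0}. ?h n * sin (of_real pi * 0) ^ (2 * n))"
        unfolding jacobi_eq_sin by (rule sum.mono_neutral_right) auto
      then show ?thesis by (simp add: jacobi_coeff_0)
    qed
    ultimately show False by simp
  qed
  then show thesis using that b rec' by blast
qed

section \<open>The matrix of the Hamiltonian on cosines\<close>

text \<open>The cosine coefficients, in units of \<open>4 \<pi>\<^sup>2\<close>, of the difference between the elliptic and the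
  trigonometric potential, without its constant term.\<close>
definition potential_coeff :: "nat \<Rightarrow> nat \<Rightarrow> complex \<Rightarrow> nat \<Rightarrow> complex" where
  "potential_coeff l0 l1 p n = - 2 * (of_nat n * (p ^ n / (1 - p ^ n))) * (of_nat (l0 * (l0 + 1)) + (- 1) ^ n * of_nat (l1 * (l1 + 1)))"

text \<open>Multiplication by the series of \<open>v n * cos_mode n x\<close> on cosines, when \<open>v 0 = 0\<close>. The frequencies
  \<open>j\<close> and \<open>n\<close> combine to \<open>n + j\<close> and \<open>\<bar>n - j\<bar>\<close>; the frequency \<open>k = 0\<close> arises only from \<open>n = j\<close>. With
  truncated subtraction \<open>(k - j) + (j - k)\<close> is the distance of \<open>k\<close> and \<open>j\<close>.\<close>
definition cos_mult_matrix :: "(nat \<Rightarrow> complex) \<Rightarrow> nat \<Rightarrow> nat \<Rightarrow> complex" where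
  "cos_mult_matrix v k j = (v ((k - j) + (j - k)) + (if k = 0 then 0 else v (k + j))) / 2"

definition hill_matrix :: "nat \<Rightarrow> nat \<Rightarrow> complex \<Rightarrow> nat \<Rightarrow> nat \<Rightarrow> complex" where
  "hill_matrix l0 l1 p k j = trig_coupling l0 l1 k j + cos_mult_matrix (potential_coeff l0 l1 p) k j"

definition coupling_size :: "nat \<Rightarrow> nat \<Rightarrow> real" where
  "coupling_size l0 l1 = real (l0 * (l0 + 1) + l1 * (l1 + 1))"

lemma norm_nome_term_le:
  fixes p :: complex
  assumes "norm p \<le> r" "r \<le> 1/2"
  shows "norm (of_nat n * (p ^ n / (1 - p ^ n))) \<le> 2 * (real n * r ^ n)"
proof (cases "n = 0")
  case False
  have "norm (p ^ n) \<le> 1/2"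
  proof -
    have "norm (p ^ n) \<le> norm p ^ 1"
      unfolding norm_power using assms False by (intro power_decreasing) auto
    then show ?thesis using assms by simp
  qed
  moreover have "1 - norm (p ^ n) \<le> norm (1 - p ^ n)" using norm_triangle_ineq2[of 1 "p ^ n"] by simp
  ultimately have d: "1/2 \<le> norm (1 - p ^ n)" by linarith
  have "norm (of_nat n * (p ^ n / (1 - p ^ n))) = real n * (norm p ^ n / norm (1 - p ^ n))"
    by (simp add: norm_mult norm_divide norm_power)
  also have "\<dots> \<le> real n * (r ^ n / (1/2))"
    using assms d order_trans[OF norm_ge_zero assms(1)] by (intro mult_left_mono frac_le power_mono) auto
  finally show ?thesis by simp
qed simp

lemma norm_potential_coeff_le:
  assumes "norm p \<le> r" "r \<le> 1/2"
  shows "norm (potential_coeff l0 l1 p n) \<le> 4 * coupling_size l0 l1 * (real n * r ^ n)"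
proof -
  have "norm (of_nat (l0 * (l0 + 1)) + (- 1) ^ n * of_nat (l1 * (l1 + 1)) :: complex)
      \<le> norm (of_nat (l0 * (l0 + 1)) :: complex) + norm ((- 1) ^ n * of_nat (l1 * (l1 + 1)) :: complex)"
    by (rule norm_triangle_ineq)
  also have "\<dots> = coupling_size l0 l1" unfolding norm_mult norm_power norm_of_nat by (simp add: coupling_size_def)
  finally have s1: "norm (of_nat (l0 * (l0 + 1)) + (- 1) ^ n * of_nat (l1 * (l1 + 1)) :: complex) \<le> coupling_size l0 l1" .
  have "norm (potential_coeff l0 l1 p n) \<le> 2 * (2 * (real n * r ^ n)) * coupling_size l0 l1"
    unfolding potential_coeff_def norm_mult[of "_ * _"] norm_mult[of "- 2"]
    using order_trans[OF norm_ge_zero norm_nome_term_le[OF assms, of n]]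
    by (intro mult_mono norm_nome_term_le[OF assms] s1) auto
  then show ?thesis by (simp add: mult_ac)
qed

lemma coupling_size_nonneg: "0 \<le> coupling_size l0 l1" by (simp add: coupling_size_def)

lemma potential_coeff_0 [simp]: "potential_coeff l0 l1 p 0 = 0" by (simp add: potential_coeff_def)

lemma potential_coeff_nome_0 [simp]: "potential_coeff l0 l1 0 n = 0"
  by (cases n) (simp_all add: potential_coeff_def)

lemma hill_matrix_nome_0: "hill_matrix l0 l1 0 k j = trig_coupling l0 l1 k j"
  by (simp add: hill_matrix_def cos_mult_matrix_def)

lemma holomorphic_nome_term:
  "(\<lambda>p. of_nat n * (p ^ n / (1 - p ^ n)) :: complex) holomorphic_on ball 0 1"
proof (cases "n = 0")
  case False
  have "1 - p ^ n \<noteq> 0" if "p \<in> ball 0 1" for p :: complex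
  proof
    assume "1 - p ^ n = 0"
    then have "norm p ^ n = 1" by (metis eq_iff_diff_eq_0 norm_one norm_power)
    moreover have "norm p ^ n < 1" using that False by (simp add: power_less_one_iff)
    ultimately show False by simp
  qed
  then show ?thesis by (intro holomorphic_intros) auto
qed simp

lemma holomorphic_hill_matrix:
  "(\<lambda>p. hill_matrix l0 l1 p k j) holomorphic_on ball 0 1"
proof -
  have P: "(\<lambda>p. potential_coeff l0 l1 p n) holomorphic_on ball 0 1" for n
    unfolding potential_coeff_def by (intro holomorphic_on_mult holomorphic_on_const holomorphic_nome_term)
  show ?thesis
    by (cases "k = 0") (auto simp: hill_matrix_def cos_mult_matrix_def intro!: holomorphic_intros P)
qed

definition arith_geom :: "real \<Rightarrow> real" where
  "arith_geom s = (\<Sum>n. real n * s ^ n)"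

lemma arith_geom_nonneg: "0 \<le> s \<Longrightarrow> s < 1 \<Longrightarrow> 0 \<le> arith_geom s"
  unfolding arith_geom_def by (intro suminf_nonneg summable_nat_mult_power) auto

lemma arith_geom_le:
  assumes "0 \<le> s" "s \<le> 1/2" shows "arith_geom s \<le> 4 * s"
proof -
  have "(\<lambda>n. real n * s ^ n) sums (s / (1 - s) ^ 2)" by (rule sums_nat_mult_power) (use assms in simp)
  then have "arith_geom s = s / (1 - s) ^ 2" by (simp add: arith_geom_def sums_iff)
  also have "\<dots> \<le> s / (1/2) ^ 2" using assms by (intro divide_left_mono power_mono) auto
  finally show ?thesis by (simp add: power2_eq_square)
qed

lemma sums_shift:
  fixes f :: "nat \<Rightarrow> 'a::real_normed_vector"
  assumes "f sums s" shows "(\<lambda>j. if k \<le> j then f (j - k) else 0) sums s"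
proof -
  have "(\<lambda>i. if k \<le> i + k then f (i + k - k) else 0) sums s" using assms by simp
  then show ?thesis by (subst (asm) sums_zero_iff_shift) auto
qed

text \<open>Bounds for the entries of row \<open>k\<close> once the modes are weighted by exponentials. The first summand
  comes from the triangular part, where \<open>x\<close> is the inverse of the decay rate; the second one comes from
  the perturbation, where \<open>s\<close> is the product of the size of \<open>p\<close> and the decay rate.\<close>
definition row_weight :: "nat \<Rightarrow> nat \<Rightarrow> real \<Rightarrow> real \<Rightarrow> nat \<Rightarrow> nat \<Rightarrow> real" where
  "row_weight l0 l1 x s k j =
     (if k \<le> j then 2 * real (l0 + l1 + 2) * (real (k + 1) * (real (j - k) * x ^ (j - k))) else 0)
     + 2 * coupling_size l0 l1 * (real ((k - j) + (j - k)) * s ^ ((k - j) + (j - k)) + real (k + j) * s ^ (k + j))"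

lemma row_weight_nonneg: "0 \<le> x \<Longrightarrow> 0 \<le> s \<Longrightarrow> 0 \<le> row_weight l0 l1 x s k j"
  by (simp add: row_weight_def coupling_size_nonneg)

lemma row_weight_sum:
  assumes x: "0 \<le> x" "x < 1" and s: "0 \<le> s" "s < 1"
  shows "summable (row_weight l0 l1 x s k)"
    and "(\<Sum>j. row_weight l0 l1 x s k j)
      \<le> 2 * real (l0 + l1 + 2) * real (k + 1) * arith_geom x + 6 * coupling_size l0 l1 * arith_geom s"
proof -
  define h where "h n = real n * s ^ n" for n
  have h: "h sums arith_geom s"
    unfolding h_def arith_geom_def by (rule summable_sums[OF summable_nat_mult_power]) (use s in simp)
  have h0: "0 \<le> h n" for n using s by (simp add: h_def)
  have fin_le: "sum h A \<le> arith_geom s" if "finite A" for A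
    using sum_le_suminf[OF sums_summable[OF h] that] h0 h by (simp add: sums_iff)
  have s1: "(\<lambda>j. if k \<le> j then real (j - k) * x ^ (j - k) else 0) sums arith_geom x"
    unfolding arith_geom_def
    by (rule sums_shift[OF summable_sums[OF summable_nat_mult_power]]) (use x in simp)
  from sums_mult[OF this, of "2 * real (l0 + l1 + 2) * real (k + 1)"]
  have s1: "(\<lambda>j. if k \<le> j then 2 * real (l0 + l1 + 2) * (real (k + 1) * (real (j - k) * x ^ (j - k))) else 0)
      sums (2 * real (l0 + l1 + 2) * real (k + 1) * arith_geom x)"
    by (simp add: if_distrib mult.assoc cong: if_cong)
  have s2: "(\<lambda>j. if k \<le> j then h (j - k) else 0) sums arith_geom s" by (rule sums_shift[OF h])
  have s3: "(\<lambda>j. if j < k then h (k - j) else 0) sums (\<Sum>j<k. h (k - j))"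
    using sums_If_finite_set[of "{..<k}" "\<lambda>j. h (k - j)"] by simp
  have s4: "(\<lambda>j. h (j + k)) sums (arith_geom s - (\<Sum>j<k. h j))"
    using sums_split_initial_segment[OF h] .
  have "(\<Sum>j<k. h (k - j)) = sum h ((\<lambda>j. k - j) ` {..<k})"
    by (subst sum.reindex) (auto intro!: inj_onI)
  also have "\<dots> \<le> arith_geom s" by (rule fin_le) simp
  finally have s3': "(\<Sum>j<k. h (k - j)) \<le> arith_geom s" .
  have s4': "arith_geom s - (\<Sum>j<k. h j) \<le> arith_geom s" using h0 by (simp add: sum_nonneg)
  have w: "row_weight l0 l1 x s k j =
      (if k \<le> j then 2 * real (l0 + l1 + 2) * (real (k + 1) * (real (j - k) * x ^ (j - k))) else 0)
     + 2 * coupling_size l0 l1 * (((if k \<le> j then h (j - k) else 0) + (if j < k then h (k - j) else 0)) + h (j + k))" for j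
    by (auto simp: row_weight_def h_def add.commute)
  have S: "row_weight l0 l1 x s k sums (2 * real (l0 + l1 + 2) * real (k + 1) * arith_geom x
      + 2 * coupling_size l0 l1 * ((arith_geom s + (\<Sum>j<k. h (k - j))) + (arith_geom s - (\<Sum>j<k. h j))))"
    unfolding w [abs_def] by (intro sums_add sums_mult s1 s2 s3 s4)
  then show "summable (row_weight l0 l1 x s k)" by (rule sums_summable)
  have "2 * coupling_size l0 l1 * ((arith_geom s + (\<Sum>j<k. h (k - j))) + (arith_geom s - (\<Sum>j<k. h j)))
      \<le> 2 * coupling_size l0 l1 * (arith_geom s + arith_geom s + arith_geom s)"
    using s3' s4' coupling_size_nonneg by (intro mult_left_mono) auto
  then show "(\<Sum>j. row_weight l0 l1 x s k j)
      \<le> 2 * real (l0 + l1 + 2) * real (k + 1) * arith_geom x + 6 * coupling_size l0 l1 * arith_geom s"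
    using S by (simp add: sums_iff)
qed

text \<open>Linear growth in \<open>k\<close> is what the quadratically growing diagonal can absorb.\<close>
lemma row_weight_sum_linear:
  assumes "0 \<le> x" "x < 1" "0 \<le> s" "s < 1"
  shows "(\<Sum>j. row_weight l0 l1 x s k j)
      \<le> (2 * real (l0 + l1 + 2) * arith_geom x + 6 * coupling_size l0 l1 * arith_geom s) * real (k + 1)"
proof -
  have "6 * coupling_size l0 l1 * arith_geom s * 1 \<le> 6 * coupling_size l0 l1 * arith_geom s * real (k + 1)"
    using arith_geom_nonneg[OF assms(3,4)] coupling_size_nonneg by (intro mult_left_mono) auto
  then show ?thesis using row_weight_sum(2)[OF assms, of l0 l1 k] by (simp add: algebra_simps)
qed

lemma norm_trig_coupling_le: "norm (trig_coupling l0 l1 k j) \<le> (if k < j then 2 * real (l0 + l1 + 2) * real j else 0)"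
proof (cases "k < j")
  case True
  have "norm (of_nat (l0 + 1) + (- 1) ^ (k + j) * of_nat (l1 + 1) :: complex)
      \<le> norm (of_nat (l0 + 1) :: complex) + norm ((- 1) ^ (k + j) * of_nat (l1 + 1) :: complex)"
    by (rule norm_triangle_ineq)
  also have "\<dots> = real (l0 + l1 + 2)" unfolding norm_mult norm_power norm_of_nat by simp
  finally have s1: "norm (of_nat (l0 + 1) + (- 1) ^ (k + j) * of_nat (l1 + 1) :: complex) \<le> real (l0 + l1 + 2)" .
  have s2: "norm (mode_weight k) \<le> 2" by (simp add: mode_weight_def)
  have "norm (trig_coupling l0 l1 k j) = real j * norm (mode_weight k)
      * norm (of_nat (l0 + 1) + (- 1) ^ (k + j) * of_nat (l1 + 1) :: complex)"
    using True by (simp add: trig_coupling_def norm_mult del: of_nat_add of_nat_Suc)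
  also have "\<dots> \<le> real j * 2 * real (l0 + l1 + 2)"
    by (intro mult_mono s1 s2) auto
  finally show ?thesis using True by (simp add: mult_ac)
qed (simp add: trig_coupling_def)

lemma norm_cos_mult_matrix_le:
  assumes "norm p \<le> r" "r \<le> 1/2"
  shows "norm (cos_mult_matrix (potential_coeff l0 l1 p) k j)
    \<le> 2 * coupling_size l0 l1 * (real ((k - j) + (j - k)) * r ^ ((k - j) + (j - k)) + real (k + j) * r ^ (k + j))"
proof -
  let ?d = "(k - j) + (j - k)"
  let ?V = "\<lambda>n. 4 * coupling_size l0 l1 * (real n * r ^ n)"
  have r: "0 \<le> r" using order_trans[OF norm_ge_zero assms(1)] .
  have "norm (if k = 0 then 0 else potential_coeff l0 l1 p (k + j)) \<le> ?V (k + j)"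
    using norm_potential_coeff_le[OF assms, of l0 l1 "k + j"] r coupling_size_nonneg[of l0 l1] by simp
  then have "norm (potential_coeff l0 l1 p ?d + (if k = 0 then 0 else potential_coeff l0 l1 p (k + j))) \<le> ?V ?d + ?V (k + j)"
    by (intro order_trans[OF norm_triangle_ineq] add_mono norm_potential_coeff_le[OF assms])
  then show ?thesis by (simp add: cos_mult_matrix_def norm_divide algebra_simps)
qed

text \<open>Two rates are needed because the entries above the diagonal act on the unknown tail of the
  eigenvector, about which less is known. Entries below the diagonal come from the perturbation alone
  and decay with the distance from the diagonal, so they can be weighted with any rate \<open>\<rho>\<close> for which
  \<open>r * \<rho> < 1\<close>.\<close>
lemma norm_hill_matrix_le:
  assumes p: "norm p \<le> r" "r \<le> 1/2" and \<rho>: "1 \<le> \<sigma>" "\<sigma> \<le> \<rho>"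
  shows "k \<le> j \<Longrightarrow> norm (hill_matrix l0 l1 p k j) \<le> row_weight l0 l1 (1 / \<sigma>) (r * \<rho>) k j * \<sigma> ^ (j - k)"
    and "j \<le> k \<Longrightarrow> norm (hill_matrix l0 l1 p k j) * \<rho> ^ (k - j) \<le> row_weight l0 l1 (1 / \<sigma>) (r * \<rho>) k j"
proof -
  let ?\<kappa> = "2 * coupling_size l0 l1"
  let ?H = "\<lambda>s n. real n * s ^ n"
  have r: "0 \<le> r" using order_trans[OF norm_ge_zero p(1)] .
  have \<rho>1: "1 \<le> \<rho>" using \<rho> by simp
  have \<kappa>: "0 \<le> ?\<kappa>" using coupling_size_nonneg by simp
  have H_le: "?H r n * \<rho> ^ i \<le> ?H (r * \<rho>) n" if "i \<le> n" for n i
  proof -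
    have "?H r n * \<rho> ^ i \<le> ?H r n * \<rho> ^ n"
      using that \<rho>1 r by (intro mult_left_mono power_increasing) auto
    then show ?thesis by (simp add: power_mult_distrib mult_ac)
  qed
  have H_ge: "?H r n \<le> ?H (r * \<rho>) n" for n using H_le[of 0 n] by simp
  {
    assume kj: "k \<le> j"
    have "norm (trig_coupling l0 l1 k j) \<le> 2 * real (l0 + l1 + 2) * (real (k + 1) * real (j - k))"
    proof (cases "k < j")
      case True
      have "real j \<le> real (k + 1) * real (j - k)"
      proof -
        obtain d where d: "j = k + Suc d" using less_imp_Suc_add[OF True] by auto
        have "real j \<le> real (k + 1) * real (Suc d)" by (simp add: d algebra_simps)
        then show ?thesis by (simp add: d)
      qed
      then show ?thesis using norm_trig_coupling_le[of l0 l1 k j] True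
        by (auto intro!: order_trans[OF norm_trig_coupling_le] mult_left_mono)
    qed (simp add: trig_coupling_def)
    then have t: "norm (trig_coupling l0 l1 k j) \<le>
        2 * real (l0 + l1 + 2) * (real (k + 1) * (real (j - k) * (1 / \<sigma>) ^ (j - k))) * \<sigma> ^ (j - k)"
      using \<rho> by (simp add: power_one_over)
    have "norm (cos_mult_matrix (potential_coeff l0 l1 p) k j) \<le> ?\<kappa> * (?H r (j - k) + ?H r (k + j))"
      using norm_cos_mult_matrix_le[OF p, of l0 l1 k j] kj by simp
    also have "\<dots> \<le> ?\<kappa> * (?H (r * \<rho>) (j - k) + ?H (r * \<rho>) (k + j)) * 1"
      unfolding mult_1_right by (rule mult_left_mono[OF add_mono[OF H_ge H_ge] \<kappa>])
    also have "\<dots> \<le> ?\<kappa> * (?H (r * \<rho>) (j - k) + ?H (r * \<rho>) (k + j)) * \<sigma> ^ (j - k)"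
      using \<rho> \<rho>1 r \<kappa> by (intro mult_left_mono) auto
    finally have "norm (cos_mult_matrix (potential_coeff l0 l1 p) k j)
      \<le> ?\<kappa> * (?H (r * \<rho>) (j - k) + ?H (r * \<rho>) (k + j)) * \<sigma> ^ (j - k)" .
    with t show "norm (hill_matrix l0 l1 p k j) \<le> row_weight l0 l1 (1 / \<sigma>) (r * \<rho>) k j * \<sigma> ^ (j - k)"
      unfolding hill_matrix_def row_weight_def using kj
      by (intro order_trans[OF norm_triangle_ineq]) (simp add: distrib_right)
  next
    assume kj: "j \<le> k"
    have "norm (hill_matrix l0 l1 p k j) \<le> ?\<kappa> * (?H r (k - j) + ?H r (k + j))"
      using norm_cos_mult_matrix_le[OF p, of l0 l1 k j] kj by (simp add: hill_matrix_def trig_coupling_def)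
    then have "norm (hill_matrix l0 l1 p k j) * \<rho> ^ (k - j) \<le> ?\<kappa> * (?H r (k - j) + ?H r (k + j)) * \<rho> ^ (k - j)"
      using \<rho>1 by (intro mult_right_mono) auto
    also have "\<dots> = ?\<kappa> * (?H r (k - j) * \<rho> ^ (k - j) + ?H r (k + j) * \<rho> ^ (k - j))" by (simp add: algebra_simps)
    also have "\<dots> \<le> ?\<kappa> * (?H (r * \<rho>) (k - j) + ?H (r * \<rho>) (k + j))"
      using \<kappa> by (intro mult_left_mono add_mono H_le) auto
    also have "\<dots> \<le> row_weight l0 l1 (1 / \<sigma>) (r * \<rho>) k j"
      using kj \<rho> by (auto simp: row_weight_def)
    finally show "norm (hill_matrix l0 l1 p k j) * \<rho> ^ (k - j) \<le> row_weight l0 l1 (1 / \<sigma>) (r * \<rho>) k j" .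
  }
qed

lemma norm_hill_matrix_weighted:
  assumes p: "norm p \<le> r" "r \<le> 1/2" and \<rho>: "1 \<le> \<rho>"
  shows "norm (hill_matrix l0 l1 p k j) * \<rho> ^ k \<le> row_weight l0 l1 (1 / \<rho>) (r * \<rho>) k j * \<rho> ^ j"
proof (cases "k \<le> j")
  case True
  have "norm (hill_matrix l0 l1 p k j) * \<rho> ^ k \<le> (row_weight l0 l1 (1 / \<rho>) (r * \<rho>) k j * \<rho> ^ (j - k)) * \<rho> ^ k"
    using \<rho> True by (intro mult_right_mono norm_hill_matrix_le[OF p]) auto
  then show ?thesis using True by (simp add: mult.assoc flip: power_add)
next
  case False
  have "(norm (hill_matrix l0 l1 p k j) * \<rho> ^ (k - j)) * \<rho> ^ j \<le> row_weight l0 l1 (1 / \<rho>) (r * \<rho>) k j * \<rho> ^ j"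
    using \<rho> False by (intro mult_right_mono norm_hill_matrix_le[OF p]) auto
  then show ?thesis using False by (simp add: mult.assoc flip: power_add)
qed

text \<open>The diagonal of the gauged operator in units of \<open>4 \<pi>\<^sup>2\<close>: four times this number is
  \<open>(l0 + l1 + 2 + 2 k)\<^sup>2 - (l0 + l1 + 2)\<^sup>2\<close>.\<close>
definition mode_energy :: "nat \<Rightarrow> nat \<Rightarrow> nat \<Rightarrow> complex" where
  "mode_energy l0 l1 k = of_nat (k * (k + (l0 + l1 + 2)))"

lemma norm_mode_energy_diff:
  "norm (mode_energy l0 l1 k - mode_energy l0 l1 m) = \<bar>real k - real m\<bar> * real (k + m + (l0 + l1 + 2))"
proof -
  have "mode_energy l0 l1 k - mode_energy l0 l1 m = of_real ((real k - real m) * real (k + m + (l0 + l1 + 2)))"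
    by (simp add: mode_energy_def algebra_simps)
  then show ?thesis by (simp only: norm_of_real abs_mult abs_of_nat)
qed

lemma mode_gap:
  assumes "k \<noteq> m"
  shows "real (k + 1) \<le> norm (mode_energy l0 l1 k - mode_energy l0 l1 m)"
proof -
  have "1 \<le> \<bar>real k - real m\<bar>" using assms by linarith
  then have "real (k + m + (l0 + l1 + 2)) \<le> \<bar>real k - real m\<bar> * real (k + m + (l0 + l1 + 2))"
    using mult_right_mono[of 1 "\<bar>real k - real m\<bar>" "real (k + m + (l0 + l1 + 2))"] by simp
  moreover have "real (k + 1) \<le> real (k + m + (l0 + l1 + 2))" by simp
  ultimately show ?thesis unfolding norm_mode_energy_diff by (rule order_trans[rotated])
qed

text \<open>The abstract perturbation lemma applies after weighting the modes by \<open>\<rho> ^ k\<close>. The entries above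
  the diagonal, which are not small, become small when \<open>\<rho>\<close> is large, and so do the entries of the
  unperturbed eigenvector below its top one. With \<open>\<rho>\<close> fixed, the perturbation is small for small \<open>p\<close>.\<close>
lemma hill_eigenpair:
  obtains r \<rho> A e a where "0 < r" "r \<le> 1/2" "1 < \<rho>" "r * \<rho> < 1" "0 \<le> A"
    "e holomorphic_on ball 0 r" "\<And>k. (\<lambda>p. a p k) holomorphic_on ball 0 r"
    "\<And>p k. p \<in> ball 0 r \<Longrightarrow> norm (a p k) * \<rho> ^ k \<le> A"
    "\<And>p. p \<in> ball 0 r \<Longrightarrow> norm (e p) \<le> 1" "e 0 = 0"
    "\<And>p k. p \<in> ball 0 r \<Longrightarrow> (mode_energy l0 l1 k - mode_energy l0 l1 m) * a p k
        + (\<Sum>j. hill_matrix l0 l1 p k j * a p j) = e p * a p k"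
    "\<And>x. psi l0 l1 m x = (\<Sum>k. a 0 k * cos_mode k x)"
proof -
  let ?\<mu> = "\<lambda>k. mode_energy l0 l1 k - mode_energy l0 l1 m"
  let ?R = "hill_matrix l0 l1"
  obtain b where b: "b m \<noteq> 0" "\<And>k. k > m \<Longrightarrow> b k = 0"
    "\<And>x. jacobi l0 l1 m x = (\<Sum>k\<le>m. b k * cos_mode k x)"
    "\<And>k. ?\<mu> k * b k + (\<Sum>j\<le>m. trig_coupling l0 l1 k j * b j) = 0"
    unfolding mode_energy_def using jacobi_cos_expansion[of m l0 l1] by blast
  define L where "L = real (l0 + l1 + 2)"
  define \<kappa> where "\<kappa> = coupling_size l0 l1"
  \<comment> \<open>The summand \<open>160 * L * (m + 1)\<close> makes the triangular part contribute at most \<open>1/20\<close> of the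
    gap to each row, and at most \<open>1/20\<close> to the row of index \<open>m\<close>; the other summand bounds the weighted
    entries of the unperturbed eigenvector by 1. With \<open>r\<close> as below the perturbation contributes at
    most \<open>1/20\<close> to every row.\<close>
  define \<rho> where "\<rho> = 160 * L * real (m + 1) + (\<Sum>k\<le>m. norm (b k / b m))"
  define r where "r = 1 / (2 * \<rho> * (1 + 240 * \<kappa>))"
  let ?w = "\<lambda>k. complex_of_real \<rho> ^ k"
  have \<kappa>: "0 \<le> \<kappa>" by (simp add: \<kappa>_def coupling_size_nonneg)
  have L: "2 \<le> L" by (simp add: L_def)
  have "160 * 2 * 1 \<le> 160 * L * real (m + 1)" using L by (intro mult_mono) auto
  then have \<rho>_ge: "160 * L * real (m + 1) \<le> \<rho>" "320 \<le> \<rho>" by (auto simp: \<rho>_def sum_nonneg intro: add_increasing2)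
  have \<rho>_b: "norm (b k / b m) \<le> \<rho>" for k
  proof (cases "k \<le> m")
    case True
    have "norm (b k / b m) \<le> (\<Sum>k\<le>m. norm (b k / b m))"
      using True by (intro member_le_sum) auto
    then show ?thesis using \<open>160 * 2 * 1 \<le> 160 * L * real (m + 1)\<close> by (simp add: \<rho>_def)
  qed (use b(2) \<rho>_ge in simp)
  have r_\<rho>: "r * \<rho> = 1 / (2 * (1 + 240 * \<kappa>))" using \<rho>_ge by (simp add: r_def)
  have r_\<rho>': "0 \<le> r * \<rho>" "r * \<rho> \<le> 1/2" "24 * \<kappa> * (r * \<rho>) \<le> 1/20"
    unfolding r_\<rho> using \<kappa> by (auto simp: field_simps)
  have r: "0 < r" using \<rho>_ge \<kappa> by (simp add: r_def)
  have "r * 1 \<le> r * \<rho>" using r \<rho>_ge by (intro mult_left_mono) auto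
  then have r2: "r \<le> 1/2" using r_\<rho>' by simp
  define G where "G = row_weight l0 l1 (1 / \<rho>) (r * \<rho>)"
  have G_sum: "summable (G k)" "(\<Sum>j. G k j) \<le> real (k + 1) / (20 * real (m + 1)) + 1/20" for k
  proof -
    have x: "0 \<le> 1 / \<rho>" "1 / \<rho> \<le> 1/2" using \<rho>_ge by (auto simp: field_simps)
    show "summable (G k)" unfolding G_def by (rule row_weight_sum) (use x r_\<rho>' in auto)
    have "(\<Sum>j. G k j) \<le> 2 * L * real (k + 1) * arith_geom (1 / \<rho>) + 6 * \<kappa> * arith_geom (r * \<rho>)"
      unfolding G_def L_def \<kappa>_def by (rule row_weight_sum) (use x r_\<rho>' in auto)
    also have "\<dots> \<le> 2 * L * real (k + 1) * (4 * (1 / \<rho>)) + 6 * \<kappa> * (4 * (r * \<rho>))"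
      using x r_\<rho>' L \<kappa> by (intro add_mono mult_left_mono arith_geom_le) auto
    also have "2 * L * real (k + 1) * (4 * (1 / \<rho>)) \<le> real (k + 1) / (20 * real (m + 1))"
    proof -
      have "real (k + 1) * (160 * L * real (m + 1)) \<le> real (k + 1) * \<rho>" using \<rho>_ge by (intro mult_left_mono) auto
      then show ?thesis using \<rho>_ge by (simp add: divide_simps) (simp add: algebra_simps)
    qed
    also have "6 * \<kappa> * (4 * (r * \<rho>)) \<le> 1/20" using r_\<rho>'(3) by simp
    finally show "(\<Sum>j. G k j) \<le> real (k + 1) / (20 * real (m + 1)) + 1/20" by simp
  qed
  interpret I: eigenpair_iteration "ball 0 r" "\<lambda>p k j. ?R p k j * (?w k / ?w j)" ?\<mu>
    "\<lambda>k. b k / b m * (?w k / ?w m)" G m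
  proof
    show "open (ball 0 r :: complex set)" "0 \<in> ball (0::complex) r" using r by simp_all
    show "(\<lambda>p. ?R p k j * (?w k / ?w j)) holomorphic_on ball 0 r" for k j
      by (intro holomorphic_on_mult holomorphic_on_const holomorphic_on_subset[OF holomorphic_hill_matrix])
         (use r2 in auto)
    show "norm (?R p k j * (?w k / ?w j)) \<le> G k j" if "p \<in> ball 0 r" for p k j
    proof -
      have p: "norm p \<le> r" using that by simp
      from norm_hill_matrix_weighted[OF p r2, of \<rho> l0 l1 k j] \<rho>_ge show ?thesis
        by (simp add: norm_mult norm_divide norm_power G_def pos_divide_le_eq)
    qed
    show "summable (G k)" for k by (rule G_sum)
    have "real (m + 1) / (20 * real (m + 1)) = 1/20" by simp
    then show "(\<Sum>j. G m j) \<le> 1/10" using G_sum(2)[of m] by linarith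
    show "(\<Sum>j. G k j) \<le> norm (?\<mu> k) / 10" if "k \<noteq> m" for k
    proof -
      have "real (k + 1) / (20 * real (m + 1)) \<le> real (k + 1) / 20" by (intro divide_left_mono) auto
      moreover have "1/20 \<le> real (k + 1) / 20" by simp
      ultimately have "(\<Sum>j. G k j) \<le> real (k + 1) / 10" using G_sum(2)[of k] by linarith
      then show ?thesis using mode_gap[OF that, of l0 l1] by simp
    qed
    show "?\<mu> m = 0" by simp
    show "1 \<le> norm (?\<mu> k)" if "k \<noteq> m" for k using mode_gap[OF that, of l0 l1] by simp
    show "b m / b m * (?w m / ?w m) = 1" using b(1) \<rho>_ge by simp
    show "norm (b k / b m * (?w k / ?w m)) \<le> 1" for k
    proof -
      consider "k = m" | "k > m" | "k < m" by linarith
      then show ?thesis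
      proof cases
        case 3
        then obtain d where d: "m = k + Suc d" using less_imp_Suc_add by auto
        have "norm (b k / b m) \<le> \<rho> ^ 1" using \<rho>_b by simp
        also have "\<dots> \<le> \<rho> ^ Suc d" using \<rho>_ge by (intro power_increasing) auto
        finally have "norm (b k / b m) \<le> \<rho> ^ Suc d" .
        moreover have "norm (b k / b m * (?w k / ?w m)) = norm (b k / b m) / \<rho> ^ Suc d"
          using \<rho>_ge by (simp add: norm_mult norm_divide norm_power d power_add)
        ultimately show ?thesis using \<rho>_ge by (simp add: divide_le_eq_1)
      qed (use b \<rho>_ge in auto)
    qed
    show "?\<mu> k * (b k / b m * (?w k / ?w m))
        + (\<Sum>j. ?R 0 k j * (?w k / ?w j) * (b j / b m * (?w j / ?w m))) = 0" for k
    proof -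
      have "(\<Sum>j. ?R 0 k j * (?w k / ?w j) * (b j / b m * (?w j / ?w m)))
          = (\<Sum>j\<le>m. ?R 0 k j * (?w k / ?w j) * (b j / b m * (?w j / ?w m)))"
        by (rule suminf_finite) (auto simp: b(2))
      also have "\<dots> = ?w k / ?w m / b m * (\<Sum>j\<le>m. trig_coupling l0 l1 k j * b j)"
        unfolding sum_distrib_left hill_matrix_nome_0 using \<rho>_ge by (intro sum.cong refl) (simp add: mult_ac)
      finally have sum_eq: "(\<Sum>j. ?R 0 k j * (?w k / ?w j) * (b j / b m * (?w j / ?w m)))
          = ?w k / ?w m / b m * (\<Sum>j\<le>m. trig_coupling l0 l1 k j * b j)" .
      have "M * (B / b0 * F) + F / b0 * S = F / b0 * (M * B + S)" for M B b0 F S :: complex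
        by (simp add: algebra_simps)
      then have "?\<mu> k * (b k / b m * (?w k / ?w m))
          + ?w k / ?w m / b m * (\<Sum>j\<le>m. trig_coupling l0 l1 k j * b j)
        = ?w k / ?w m / b m * (?\<mu> k * b k + (\<Sum>j\<le>m. trig_coupling l0 l1 k j * b j))" .
      then show ?thesis unfolding sum_eq b(4) by simp
    qed
  qed
  obtain e a where ea: "e holomorphic_on ball 0 r" "\<And>k. (\<lambda>p. a p k) holomorphic_on ball 0 r"
    "\<And>p k. p \<in> ball 0 r \<Longrightarrow> norm (a p k) \<le> 2" "\<And>p. p \<in> ball 0 r \<Longrightarrow> norm (e p) \<le> 1" "e 0 = 0"
    "a 0 = (\<lambda>k. b k / b m * (?w k / ?w m))"
    "\<And>p. p \<in> ball 0 r \<Longrightarrow> a p m = 1"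
    "\<And>p k. p \<in> ball 0 r \<Longrightarrow> ?\<mu> k * a p k + (\<Sum>j. ?R p k j * (?w k / ?w j) * a p j) = e p * a p k"
    using I.holomorphic_eigenpair by blast
  \<comment> \<open>The eigenvector with entry 1 at \<open>m\<close> is rescaled so that it gives \<open>psi\<close> at \<open>p = 0\<close>.\<close>
  define \<beta> where "\<beta> = jacobi_const l0 l1 m * b m * ?w m"
  define a' where "a' p k = \<beta> * a p k / ?w k" for p k
  show thesis
  proof (rule that[of r \<rho> "2 * norm \<beta>" e a'])
    show "0 < r" "r \<le> 1/2" "1 < \<rho>" "r * \<rho> < 1" "0 \<le> 2 * norm \<beta>" using r r2 \<rho>_ge r_\<rho>' by auto
    show "e holomorphic_on ball 0 r" "e 0 = 0" "\<And>p. p \<in> ball 0 r \<Longrightarrow> norm (e p) \<le> 1" by (fact ea)+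
    show "(\<lambda>p. a' p k) holomorphic_on ball 0 r" for k
      unfolding a'_def using \<rho>_ge by (intro holomorphic_intros ea) auto
    show "norm (a' p k) * \<rho> ^ k \<le> 2 * norm \<beta>" if "p \<in> ball 0 r" for p k
      using mult_left_mono[OF ea(3)[OF that, of k], of "norm \<beta>"] \<rho>_ge
      by (simp add: a'_def norm_mult norm_divide norm_power)
    show "?\<mu> k * a' p k + (\<Sum>j. ?R p k j * a' p j) = e p * a' p k" if p: "p \<in> ball 0 r" for p k
    proof -
      have "(\<Sum>j. ?R p k j * a' p j) = (\<Sum>j. \<beta> / ?w k * (?R p k j * (?w k / ?w j) * a p j))"
        using \<rho>_ge by (simp add: a'_def mult_ac)
      also have "\<dots> = \<beta> / ?w k * (\<Sum>j. ?R p k j * (?w k / ?w j) * a p j)"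
        by (rule suminf_mult, rule I.row_sum_summable[OF p ea(3)[OF p]])
      also have "(\<Sum>j. ?R p k j * (?w k / ?w j) * a p j) = e p * a p k - ?\<mu> k * a p k"
        using ea(8)[OF p, of k] by (simp only: eq_diff_eq add.commute)
      finally have sum_eq: "(\<Sum>j. ?R p k j * a' p j) = \<beta> / ?w k * (e p * a p k - ?\<mu> k * a p k)" .
      have "M * (B * z / F) + B / F * (E * z - M * z) = E * (B * z / F)" for M B z F E :: complex
        by (simp add: algebra_simps diff_divide_distrib)
      then show ?thesis unfolding sum_eq unfolding a'_def .
    qed
    show "psi l0 l1 m x = (\<Sum>k. a' 0 k * cos_mode k x)" for x
    proof -
      have a'0: "a' 0 k = jacobi_const l0 l1 m * b k" for k
        unfolding a'_def ea(6) \<beta>_def using b(1) \<rho>_ge by simp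
      have "(\<Sum>k. a' 0 k * cos_mode k x) = (\<Sum>k\<le>m. a' 0 k * cos_mode k x)"
        by (rule suminf_finite) (auto simp: a'0 b(2))
      also have "\<dots> = psi l0 l1 m x"
        unfolding psi_def b(3) a'0 sum_distrib_left by (simp add: mult_ac)
      finally show ?thesis ..
    qed
  qed
qed

text \<open>Every rate \<open>\<rho>\<close> with \<open>r1 * \<rho> < 1\<close> is attained, uniformly for \<open>norm p \<le> r1\<close>. This is what extends
  the eigenfunction to the full strip: there \<open>exp (2 \<pi> \<bar>Im x\<bar>)\<close> may come arbitrarily close to
  \<open>1 / norm p\<close>.\<close>
lemma mode_decay:
  fixes a :: "complex \<Rightarrow> nat \<Rightarrow> complex"
  assumes r1: "0 \<le> r1" "r1 \<le> 1/2" and \<rho>: "1 < \<sigma>" "\<sigma> \<le> \<rho>" "r1 * \<rho> < 1" and A: "0 \<le> A"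
    and a: "\<And>p k. norm p \<le> r1 \<Longrightarrow> norm (a p k) * \<sigma> ^ k \<le> A"
    and e: "\<And>p. norm p \<le> r1 \<Longrightarrow> norm (e p) \<le> 1"
    and eq: "\<And>p k. norm p \<le> r1 \<Longrightarrow> (mode_energy l0 l1 k - mode_energy l0 l1 m) * a p k
        + (\<Sum>j. hill_matrix l0 l1 p k j * a p j) = e p * a p k"
  obtains B where "0 \<le> B" "\<And>p k. norm p \<le> r1 \<Longrightarrow> norm (a p k) * \<rho> ^ k \<le> B"
proof -
  let ?\<mu> = "\<lambda>k. mode_energy l0 l1 k - mode_energy l0 l1 m"
  let ?G = "row_weight l0 l1 (1 / \<sigma>) (r1 * \<rho>)"
  have x: "0 \<le> 1 / \<sigma>" "1 / \<sigma> < 1" and s: "0 \<le> r1 * \<rho>" using \<rho> r1 by auto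
  define C where "C = 2 * real (l0 + l1 + 2) * arith_geom (1 / \<sigma>) + 6 * coupling_size l0 l1 * arith_geom (r1 * \<rho>)"
  have ag: "0 \<le> arith_geom (1 / \<sigma>)" "0 \<le> arith_geom (r1 * \<rho>)" using x s \<rho> by (auto intro: arith_geom_nonneg)
  then have C: "0 \<le> C" unfolding C_def using coupling_size_nonneg by (intro add_nonneg_nonneg mult_nonneg_nonneg) auto
  have G: "summable (?G k)" "(\<Sum>j. ?G k j) \<le> C * real (k + 1)" for k
    unfolding C_def by (rule row_weight_sum(1)[OF x s \<rho>(3)], rule row_weight_sum_linear[OF x s \<rho>(3)])
  define N where "N = m + 2 + nat \<lceil>2 * C\<rceil>"
  have large: "2 * C * real (k + 1) \<le> norm (e p - ?\<mu> k)" "e p - ?\<mu> k \<noteq> 0" if p: "norm p \<le> r1" and k: "N \<le> k" for p k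
  proof -
    have km: "real m + 2 + 2 * C \<le> real k" using k unfolding N_def by linarith
    then have km': "2 * C + 2 \<le> real k - real m" by simp
    have "(2 * C + 2) * real (k + 1) \<le> (real k - real m) * real (k + m + (l0 + l1 + 2))"
      using km' C by (intro mult_mono) auto
    also have "\<dots> = norm (?\<mu> k)" unfolding norm_mode_energy_diff using km C by simp
    also have "\<dots> \<le> norm (e p - ?\<mu> k) + norm (e p)" by norm
    also have "norm (e p) \<le> 1" by (rule e[OF p])
    finally have *: "2 * C * real (k + 1) + 2 * real (k + 1) \<le> norm (e p - ?\<mu> k) + 1" by (simp add: distrib_right)
    then show "2 * C * real (k + 1) \<le> norm (e p - ?\<mu> k)" by simp
    have "0 < z" if "0 \<le> d" "1 \<le> y" "d + 2 * y \<le> z + 1" for d y z :: real using that by linarith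
    from this[OF _ _ *] have "0 < norm (e p - ?\<mu> k)" using C by simp
    then show "e p - ?\<mu> k \<noteq> 0" by auto
  qed
  have "norm (a p K) * \<rho> ^ K \<le> A * \<rho> ^ N" if p: "norm p \<le> r1" for p K
  proof (rule decay_improvement[where \<sigma> = \<sigma> and R = "hill_matrix l0 l1 p" and G = ?G and N = N and c = "\<lambda>k. e p - ?\<mu> k"])
    show "(e p - ?\<mu> k) * a p k = (\<Sum>j. hill_matrix l0 l1 p k j * a p j)" for k
      using eq[OF p, of k] by (simp add: algebra_simps)
    show "norm (hill_matrix l0 l1 p k j) \<le> ?G k j * \<sigma> ^ (j - k)" if "k \<le> j" for k j
      by (rule norm_hill_matrix_le[OF p r1(2)]) (use \<rho> that in auto)
    show "norm (hill_matrix l0 l1 p k j) * \<rho> ^ (k - j) \<le> ?G k j" if "j \<le> k" for k j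
      by (rule norm_hill_matrix_le[OF p r1(2)]) (use \<rho> that in auto)
    show "(\<Sum>j. ?G k j) \<le> norm (e p - ?\<mu> k) / 2" if "N \<le> k" for k
      using G(2)[of k] large(1)[OF p that] by linarith
    show "norm (a p k) * \<rho> ^ k \<le> A * \<rho> ^ N" if "k < N" for k
    proof -
      have "norm (a p k) * 1 \<le> norm (a p k) * \<sigma> ^ k" using \<rho> by (intro mult_left_mono) auto
      then have "norm (a p k) \<le> A" using a[OF p, of k] by simp
      then show ?thesis using that \<rho> A by (intro mult_mono power_increasing) auto
    qed
    show "summable (?G k)" for k by (rule G)
    show "e p - ?\<mu> k \<noteq> 0" if "N \<le> k" for k by (rule large(2)[OF p that])
    show "norm (a p k) * \<sigma> ^ k \<le> A" for k by (rule a[OF p])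
    show "0 < \<sigma>" "\<sigma> \<le> \<rho>" "0 \<le> A * \<rho> ^ N" using \<rho> A by auto
  qed
  then show thesis using that[of "A * \<rho> ^ N"] A \<rho> by simp
qed

section \<open>From eigenvectors to solutions of the differential equation\<close>

text \<open>The product formula for cosines splits the product of the series with \<open>cos_mode j\<close> into two series,
  with frequencies \<open>n + j\<close> and \<open>\<bar>n - j\<bar>\<close>. Sorted by the resulting frequency they form the column \<open>j\<close>.\<close>
lemma cos_mult_matrix_column:
  assumes v: "v 0 = 0" and s: "0 \<le> s" "s * t < 1" and t: "0 \<le> t" and v_le: "\<And>n. norm (v n) \<le> C * (real n * s ^ n)"
    and c_le: "\<And>n. norm (cos_mode n x) \<le> t ^ n" and t1: "1 \<le> t"
  shows "(\<lambda>k. cos_mult_matrix v k j * cos_mode k x) sums ((\<Sum>n. v n * cos_mode n x) * cos_mode j x)"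
proof -
  let ?c = "\<lambda>n. cos_mode n x"
  have sm: "summable (\<lambda>n. C * (real n * (s * t) ^ n) * t ^ j)"
    using s t by (intro summable_mult2 summable_mult summable_nat_mult_power) auto
  have vc: "norm (v n * ?c i) \<le> C * (real n * (s * t) ^ n) * t ^ j" if "i \<le> n + j" for n i
  proof -
    have "norm (v n * ?c i) \<le> C * (real n * s ^ n) * t ^ (n + j)"
      unfolding norm_mult
    proof (intro mult_mono v_le)
      show "norm (?c i) \<le> t ^ (n + j)"
        by (rule order_trans[OF c_le power_increasing[OF that t1]])
      show "0 \<le> C * (real n * s ^ n)" by (rule order_trans[OF norm_ge_zero v_le])
    qed auto
    then show ?thesis by (simp add: power_mult_distrib power_add mult_ac)
  qed
  have smv: "summable (\<lambda>n. v n * ?c (g n))" if "\<And>n. g n \<le> n + j" for g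
    by (rule summable_comparison_test'[OF sm, of 0]) (use vc that in auto)
  have W: "(\<lambda>n. v n * ?c n) sums (\<Sum>n. v n * ?c n)" by (rule summable_sums[OF smv]) simp
  define \<alpha> \<beta> where "\<alpha> = (\<Sum>n. v n * ?c (n + j))" and "\<beta> = (\<Sum>n. v n * ?c ((n - j) + (j - n)))"
  have \<alpha>: "(\<lambda>n. v n * ?c (n + j)) sums \<alpha>" and \<beta>: "(\<lambda>n. v n * ?c ((n - j) + (j - n))) sums \<beta>"
    unfolding \<alpha>_def \<beta>_def by (rule summable_sums[OF smv]; simp)+
  have "(\<lambda>n. (v n * ?c (n + j) + v n * ?c ((n - j) + (j - n))) / 2) sums ((\<alpha> + \<beta>) / 2)"
    by (intro sums_divide sums_add \<alpha> \<beta>)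
  moreover have "(v n * ?c (n + j) + v n * ?c ((n - j) + (j - n))) / 2 = v n * ?c n * ?c j" for n
    using cos_mode_mult[of n x j] by (simp add: field_simps)
  ultimately have "(\<lambda>n. v n * ?c n * ?c j) sums ((\<alpha> + \<beta>) / 2)" by simp
  then have total: "(\<Sum>n. v n * ?c n) * ?c j = (\<alpha> + \<beta>) / 2"
    using sums_unique2[OF sums_mult2[OF W, of "?c j"]] by blast
  have up: "(\<lambda>k. if j \<le> k then v (k - j) * ?c k else 0) sums \<alpha>"
    using sums_shift[OF \<alpha>, of j] by (rule sums_cong[THEN iffD1, rotated]) auto
  have low: "(\<lambda>k. if k < j then v (j - k) * ?c k else 0) sums (\<Sum>k<j. v (j - k) * ?c k)"
    using sums_If_finite_set[of "{..<j}" "\<lambda>k. v (j - k) * ?c k"] by simp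
  have "(\<lambda>k. v (k + j) * ?c ((k + j - j) + (j - (k + j)))) sums (\<beta> - (\<Sum>n<j. v n * ?c ((n - j) + (j - n))))"
    by (rule sums_split_initial_segment[OF \<beta>])
  then have far: "(\<lambda>k. v (k + j) * ?c k) sums (\<beta> - (\<Sum>n<j. v n * ?c (j - n)))" by simp
  have "(\<lambda>k. if k = 0 then v (k + j) * ?c k else 0) sums (v (0 + j) * ?c 0)"
    by (rule sums_single)
  from sums_diff[OF far this]
  have far': "(\<lambda>k. if k = 0 then 0 else v (k + j) * ?c k) sums (\<beta> - (\<Sum>n<j. v n * ?c (j - n)) - v (0 + j) * ?c 0)"
    by (rule sums_cong[THEN iffD1, rotated]) simp
  have fin: "(\<Sum>k<j. v (j - k) * ?c k) = (\<Sum>n<j. v n * ?c (j - n)) + v j"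
  proof -
    have "(\<Sum>k<j. v (j - k) * ?c k) = (\<Sum>k\<le>j. v (j - k) * ?c k)"
      using v by (simp flip: lessThan_Suc_atMost)
    also have "\<dots> = (\<Sum>n\<le>j. v n * ?c (j - n))"
      by (rule sum.reindex_bij_witness[of _ "\<lambda>k. j - k" "\<lambda>k. j - k"]) auto
    also have "\<dots> = (\<Sum>n<j. v n * ?c (j - n)) + v j" by (simp flip: lessThan_Suc_atMost)
    finally show ?thesis .
  qed
  have "(\<lambda>k. (((if j \<le> k then v (k - j) * ?c k else 0) + (if k < j then v (j - k) * ?c k else 0))
      + (if k = 0 then 0 else v (k + j) * ?c k)) / 2) sums
      (((\<alpha> + (\<Sum>k<j. v (j - k) * ?c k)) + (\<beta> - (\<Sum>n<j. v n * ?c (j - n)) - v (0 + j) * ?c 0)) / 2)"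
    by (intro sums_divide sums_add up low far')
  moreover have "((if j \<le> k then v (k - j) * ?c k else 0) + (if k < j then v (j - k) * ?c k else 0)
      + (if k = 0 then 0 else v (k + j) * ?c k)) / 2 = cos_mult_matrix v k j * ?c k" for k
    by (auto simp: cos_mult_matrix_def algebra_simps add_divide_distrib)
  ultimately show ?thesis unfolding total fin by simp
qed

lemma summable_Suc_mult_power: "0 \<le> s \<Longrightarrow> s < 1 \<Longrightarrow> summable (\<lambda>n. real (n + 1) * s ^ n)"
  using sums_summable[OF geometric_deriv_sums[of s]] by simp

lemma cos_series_derivs:
  assumes \<rho>: "1 < \<rho>" and a: "\<And>k. norm (a k) * \<rho> ^ k \<le> B"
  obtains u u' u'' where
    "\<And>x. exp (2 * pi * \<bar>Im x\<bar>) < \<rho> \<Longrightarrow> (\<lambda>k. a k * cos_mode k x) sums u x"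
    "\<And>x. exp (2 * pi * \<bar>Im x\<bar>) < \<rho> \<Longrightarrow> (\<lambda>k. a k * cos_mode_D k x) sums u' x"
    "\<And>x. exp (2 * pi * \<bar>Im x\<bar>) < \<rho> \<Longrightarrow> (\<lambda>k. a k * cos_mode_DD k x) sums u'' x"
    "\<And>x. exp (2 * pi * \<bar>Im x\<bar>) < \<rho> \<Longrightarrow> (u has_field_derivative u' x) (at x)"
    "\<And>x. exp (2 * pi * \<bar>Im x\<bar>) < \<rho> \<Longrightarrow> (u' has_field_derivative u'' x) (at x)"
proof -
  define S where "S = {x::complex. exp (2 * pi * \<bar>Im x\<bar>) < \<rho>}"
  have open_lt: "open {x::complex. exp (2 * pi * \<bar>Im x\<bar>) < t}" for t
    by (intro open_Collect_less continuous_intros)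
  have S: "open S" unfolding S_def by (rule open_lt)
  have a_le: "norm (a k) \<le> B * (1 / \<rho>) ^ k" for k
    using a[of k] \<rho> by (simp add: power_one_over field_simps)
  have B: "0 \<le> B" using order_trans[OF _ a[of 0]] by simp
  have near: "\<exists>d t. 0 < d \<and> 1 \<le> t \<and> t < \<rho> \<and> (\<forall>y\<in>ball x d. exp (2 * pi * \<bar>Im y\<bar>) \<le> t)" if "x \<in> S" for x
  proof -
    obtain t where t: "exp (2 * pi * \<bar>Im x\<bar>) < t" "t < \<rho>" using \<open>x \<in> S\<close> dense by (auto simp: S_def)
    moreover have "1 \<le> exp (2 * pi * \<bar>Im x\<bar>)" by simp
    ultimately have "1 \<le> t" by linarith
    obtain d where "0 < d" "ball x d \<subseteq> {x. exp (2 * pi * \<bar>Im x\<bar>) < t}"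
      using open_contains_ball[of "{x::complex. exp (2 * pi * \<bar>Im x\<bar>) < t}"] open_lt t by blast
    then show ?thesis using t \<open>1 \<le> t\<close> by (intro exI[of _ d] exI[of _ t]) (auto simp: subset_iff less_imp_le)
  qed
  have dom: "\<exists>d h. 0 < d \<and> summable h \<and> range h \<subseteq> \<real>\<^sub>\<ge>\<^sub>0 \<and> (\<forall>\<^sub>F n in sequentially. \<forall>y\<in>ball x d \<inter> S. cmod (f n y) \<le> cmod (h n))"
    if x: "x \<in> S" and f: "\<And>n y. norm (f n y) \<le> norm (a n) * (C * real (n + 1) * exp (2 * pi * \<bar>Im y\<bar>) ^ n)" and C: "0 \<le> C"
    for f :: "nat \<Rightarrow> complex \<Rightarrow> complex" and x C
  proof -
    obtain d t where dt: "0 < d" "1 \<le> t" "t < \<rho>" "\<And>y. y \<in> ball x d \<Longrightarrow> exp (2 * pi * \<bar>Im y\<bar>) \<le> t"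
      using near[OF x] by blast
    define h where "h n = C * B * (real (n + 1) * (t / \<rho>) ^ n)" for n
    have h0: "0 \<le> h n" for n using B C dt \<rho> by (simp add: h_def)
    have "summable h" unfolding h_def using dt \<rho> by (intro summable_mult summable_Suc_mult_power) auto
    then have "summable (\<lambda>n. complex_of_real (h n))" by (rule summable_of_real)
    moreover have "norm (f n y) \<le> norm (complex_of_real (h n))" if "y \<in> ball x d" for n y
    proof -
      have "norm (f n y) \<le> (B * (1 / \<rho>) ^ n) * (C * real (n + 1) * t ^ n)"
        by (rule order_trans[OF f], intro mult_mono a_le power_mono dt that) (use B C dt \<rho> in auto)
      also have "\<dots> = h n" by (simp add: h_def power_divide)
      finally show ?thesis using h0[of n] by simp
    qed
    ultimately show ?thesis using dt(1) h0
      by (intro exI[of _ d] exI[of _ "\<lambda>n. complex_of_real (h n)"]) (auto simp: complex_nonneg_Reals_iff)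
  qed
  have 1: "norm (a n * cos_mode n y) \<le> norm (a n) * (1 * real (n + 1) * exp (2 * pi * \<bar>Im y\<bar>) ^ n)" for n y
  proof -
    have "norm (cos_mode n y) \<le> 1 * exp (2 * pi * \<bar>Im y\<bar>) ^ n" unfolding cos_mode_def using norm_cos_multiple_le by simp
    also have "\<dots> \<le> real (n + 1) * exp (2 * pi * \<bar>Im y\<bar>) ^ n" by (intro mult_right_mono) auto
    finally show ?thesis unfolding norm_mult by (intro mult_left_mono) auto
  qed
  have 2: "norm (a n * cos_mode_D n y) \<le> norm (a n) * (2 * pi * real (n + 1) * exp (2 * pi * \<bar>Im y\<bar>) ^ n)" for n y
  proof -
    have "norm (sin_mode n y) \<le> exp (2 * pi * \<bar>Im y\<bar>) ^ n"
      using norm_cos_sin_le(2)[of "2 * of_real pi * of_nat n * y"]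
      unfolding sin_mode_def exp_of_nat_mult[symmetric] by (simp add: abs_mult mult_ac)
    moreover have "norm (- (2 * of_real pi * of_nat n) :: complex) = 2 * pi * real n" by (simp add: norm_mult)
    ultimately have "norm (cos_mode_D n y) \<le> 2 * pi * real (n + 1) * exp (2 * pi * \<bar>Im y\<bar>) ^ n"
      unfolding cos_mode_D_def norm_mult[of _ "sin_mode n y"] by (intro mult_mono) auto
    then show ?thesis unfolding norm_mult by (intro mult_left_mono) auto
  qed
  have "\<exists>u v. \<forall>x\<in>S. (\<lambda>n. a n * cos_mode n x) sums u x \<and> (\<lambda>n. a n * cos_mode_D n x) sums v x
      \<and> (u has_field_derivative v x) (at x)"
  proof (rule series_and_derivative_comparison_complex[OF S])
    show "((\<lambda>x. a n * cos_mode n x) has_field_derivative a n * cos_mode_D n x) (at x)" for n x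
      by (rule DERIV_cmult[OF DERIV_cos_mode])
  qed (rule dom[OF _ 1], auto)
  then obtain u v where u: "\<And>x. x \<in> S \<Longrightarrow> (\<lambda>n. a n * cos_mode n x) sums u x \<and> (\<lambda>n. a n * cos_mode_D n x) sums v x
      \<and> (u has_field_derivative v x) (at x)" by blast
  have "\<exists>v w. \<forall>x\<in>S. (\<lambda>n. a n * cos_mode_D n x) sums v x \<and> (\<lambda>n. a n * cos_mode_DD n x) sums w x
      \<and> (v has_field_derivative w x) (at x)"
  proof (rule series_and_derivative_comparison_complex[OF S])
    show "((\<lambda>x. a n * cos_mode_D n x) has_field_derivative a n * cos_mode_DD n x) (at x)" for n x
      by (rule DERIV_cmult[OF DERIV_cos_mode_D])
  qed (rule dom[OF _ 2], auto)
  then obtain v2 w where v: "\<And>x. x \<in> S \<Longrightarrow> (\<lambda>n. a n * cos_mode_D n x) sums v2 x \<and> (\<lambda>n. a n * cos_mode_DD n x) sums w x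
      \<and> (v2 has_field_derivative w x) (at x)" by blast
  have uv: "v x = v2 x" if "x \<in> S" for x using u[OF that] v[OF that] sums_unique2 by blast
  have v': "(v has_field_derivative w x) (at x)" if "x \<in> S" for x
    by (rule has_field_derivative_transform_within_open[of v2 _ _ S]) (use v uv S that in auto)
  show thesis by (rule that[of u v w]) (use u v v' in \<open>auto simp: S_def\<close>)
qed

lemma norm_mode_term_le:
  assumes "norm a * \<rho> ^ n \<le> B" "0 < \<rho>" "exp (2 * pi * \<bar>Im x\<bar>) \<le> t"
  shows "norm (a * cos_mode n x) \<le> B * (t / \<rho>) ^ n"
proof -
  have 1: "norm a \<le> B / \<rho> ^ n" using assms by (simp add: pos_le_divide_eq)
  have "norm (cos_mode n x) \<le> t ^ n"
    unfolding cos_mode_def by (rule order_trans[OF norm_cos_multiple_le power_mono[OF assms(3)]]) simp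
  then have "norm (a * cos_mode n x) \<le> (B / \<rho> ^ n) * t ^ n"
    unfolding norm_mult using order_trans[OF norm_ge_zero 1] by (intro mult_mono 1) auto
  then show ?thesis by (simp add: power_divide)
qed

text \<open>Apply the matrix to the vector of modes column by column, which yields the operator, and row by
  row, which yields the eigenvalue equation. The double series converges absolutely because the bounds
  of \<open>row_weight\<close> leave the factor \<open>(t / \<rho>) ^ k\<close> with \<open>t < \<rho>\<close>.\<close>
lemma cos_series_ode:
  assumes p: "norm p \<le> r1" "r1 \<le> 1/2" and \<rho>: "1 < \<rho>" "r1 * \<rho> < 1" and a: "\<And>k. norm (a k) * \<rho> ^ k \<le> B"
    and eq: "\<And>k. (mode_energy l0 l1 k - mode_energy l0 l1 m) * a k + (\<Sum>j. hill_matrix l0 l1 p k j * a j) = e * a k"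
    and x: "exp (2 * pi * \<bar>Im x\<bar>) < \<rho>" "x \<notin> half_integers"
    and u: "(\<lambda>k. a k * cos_mode k x) sums u" "(\<lambda>k. a k * cos_mode_D k x) sums u'" "(\<lambda>k. a k * cos_mode_DD k x) sums u''"
  shows "gauged l0 l1 x u' u''
    = 4 * of_real pi ^ 2 * ((mode_energy l0 l1 m + e - (\<Sum>n. potential_coeff l0 l1 p n * cos_mode n x)) * u)"
proof -
  let ?c = "\<lambda>k. cos_mode k x" and ?R = "hill_matrix l0 l1 p" and ?v = "potential_coeff l0 l1 p"
  let ?M = "mode_energy l0 l1" and ?T = "\<lambda>j. \<Sum>k<j. trig_coupling l0 l1 k j * cos_mode k x"
  define t where "t = exp (2 * pi * \<bar>Im x\<bar>)"
  define W where "W = (\<Sum>n. ?v n * ?c n)"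
  have t: "1 \<le> t" "t < \<rho>" using x by (auto simp: t_def)
  have r1: "0 \<le> r1" using order_trans[OF norm_ge_zero p(1)] .
  have B: "0 \<le> B" using order_trans[OF _ a[of 0]] by simp
  have c_le: "norm (?c n) \<le> t ^ n" for n unfolding cos_mode_def t_def by (rule norm_cos_multiple_le)
  have "r1 * t \<le> r1 * \<rho>" using t r1 by (intro mult_left_mono) auto
  then have r1t: "r1 * t < 1" using \<rho> by simp
  have conv: "(\<lambda>k. cos_mult_matrix ?v k j * ?c k) sums (W * ?c j)" for j
    unfolding W_def
    by (rule cos_mult_matrix_column[where s = r1 and t = t and C = "4 * coupling_size l0 l1"])
       (use r1 r1t t c_le norm_potential_coeff_le[OF p] in auto)
  have trig: "(\<lambda>k. trig_coupling l0 l1 k j * ?c k) sums ?T j" for j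
    using sums_If_finite_set[of "{..<j}" "\<lambda>k. trig_coupling l0 l1 k j * ?c k"]
    by (rule sums_cong[THEN iffD1, rotated, OF _ ]) (auto simp: trig_coupling_def)
  have col: "(\<lambda>k. ?R k j * ?c k) sums (?T j + W * ?c j)" for j
    using sums_add[OF trig[of j] conv[of j]] by (simp add: hill_matrix_def distrib_right)
  let ?G = "row_weight l0 l1 (1 / \<rho>) (r1 * \<rho>)"
  have xs: "0 \<le> 1 / \<rho>" "1 / \<rho> < 1" "0 \<le> r1 * \<rho>" using \<rho> r1 by auto
  have G: "summable (?G k)" for k by (rule row_weight_sum[OF xs \<rho>(2)])
  define C where "C = 2 * real (l0 + l1 + 2) * arith_geom (1 / \<rho>) + 6 * coupling_size l0 l1 * arith_geom (r1 * \<rho>)"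
  have G_sum: "(\<Sum>j. ?G k j) \<le> C * real (k + 1)" for k
    unfolding C_def by (rule row_weight_sum_linear[OF xs \<rho>(2)])
  have entry0: "norm (?R k j * a j) \<le> B / \<rho> ^ k * ?G k j" for k j
  proof -
    have 1: "norm (?R k j) \<le> ?G k j * \<rho> ^ j / \<rho> ^ k"
      using norm_hill_matrix_weighted[OF p, of \<rho> l0 l1 k j] \<rho> by (simp add: field_simps)
    have 2: "norm (a j) \<le> B / \<rho> ^ j" using a[of j] \<rho> by (simp add: field_simps)
    have "norm (?R k j * a j) \<le> (?G k j * \<rho> ^ j / \<rho> ^ k) * (B / \<rho> ^ j)"
      unfolding norm_mult using order_trans[OF norm_ge_zero 1] by (intro mult_mono 1 2) auto
    then show ?thesis using \<rho> by (simp add: mult_ac)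
  qed
  have entry: "norm (?R k j * a j * ?c k) \<le> (B * (t / \<rho>) ^ k) * ?G k j" for k j
  proof -
    have "norm (?R k j * a j * ?c k) \<le> (B / \<rho> ^ k * ?G k j) * t ^ k"
      unfolding norm_mult[of _ "?c k"]
      using order_trans[OF norm_ge_zero entry0] by (intro mult_mono entry0 c_le) auto
    then show ?thesis by (simp add: power_divide mult_ac)
  qed
  have sG: "summable (\<lambda>j. (B * (t / \<rho>) ^ k) * ?G k j)" for k by (intro summable_mult G)
  have rows: "summable (\<lambda>j. norm (?R k j * a j * ?c k))" for k
    by (rule summable_comparison_test'[OF sG, of 0]) (use entry in auto)
  have rows_le: "(\<Sum>j. norm (?R k j * a j * ?c k)) \<le> B * C * (real (k + 1) * (t / \<rho>) ^ k)" for k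
  proof -
    have "(\<Sum>j. norm (?R k j * a j * ?c k)) \<le> (\<Sum>j. (B * (t / \<rho>) ^ k) * ?G k j)"
      by (intro suminf_le entry rows sG)
    also have "\<dots> = (B * (t / \<rho>) ^ k) * (\<Sum>j. ?G k j)" by (rule suminf_mult[OF G])
    also have "\<dots> \<le> (B * (t / \<rho>) ^ k) * (C * real (k + 1))"
      using B t \<rho> by (intro mult_left_mono G_sum) auto
    finally show ?thesis by (simp add: mult_ac)
  qed
  have H: "summable (\<lambda>k. B * C * (real (k + 1) * (t / \<rho>) ^ k))"
    using t \<rho> by (intro summable_mult summable_Suc_mult_power) auto
  note swap = double_series_swap[of "\<lambda>j k. ?R k j * a j * ?c k", OF rows rows_le H]
  have Ra: "summable (\<lambda>j. ?R k j * a j)" for k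
    by (rule summable_comparison_test'[OF summable_mult[OF G[of k], of "B / \<rho> ^ k"], of 0]) (use entry0 in auto)
  have inner: "(\<Sum>k. ?R k j * a j * ?c k) = a j * (?T j + W * ?c j)" for j
    using sums_mult[OF col[of j], of "a j"] by (simp add: sums_iff mult_ac)
  have outer: "(\<Sum>j. ?R k j * a j * ?c k) = (e - (?M k - ?M m)) * a k * ?c k" for k
  proof -
    have "(\<Sum>j. ?R k j * a j) = (e - (?M k - ?M m)) * a k" using eq[of k] by (simp add: algebra_simps)
    then show ?thesis using suminf_mult2[OF Ra[of k], of "?c k"] by simp
  qed
  define X where "X = (\<Sum>k. (e - (?M k - ?M m)) * a k * ?c k)"
  have s1: "(\<lambda>j. a j * (?T j + W * ?c j)) sums X" using swap(1) unfolding inner outer X_def .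
  have s2: "(\<lambda>k. (e - (?M k - ?M m)) * a k * ?c k) sums X"
    unfolding X_def by (rule summable_sums) (use swap(3) in \<open>simp only: outer\<close>)
  define K where "K = 2 * of_real pi * (of_nat (l0 + 1) * (cos (of_real pi * x) / sin (of_real pi * x))
     - of_nat (l1 + 1) * (sin (of_real pi * x) / cos (of_real pi * x)))"
  have gauged_eq: "gauged l0 l1 x y z = - z - K * y" for y z by (simp add: gauged_def K_def)
  have "(\<lambda>k. - (a k * cos_mode_DD k x) - K * (a k * cos_mode_D k x)) sums (- u'' - K * u')"
    by (intro sums_diff sums_minus sums_mult u)
  moreover have "- (a k * cos_mode_DD k x) - K * (a k * cos_mode_D k x) = 4 * of_real pi ^ 2 * (a k * (?M k * ?c k + ?T k))" for k
  proof -
    have "- (a k * cos_mode_DD k x) - K * (a k * cos_mode_D k x) = a k * gauged l0 l1 x (cos_mode_D k x) (cos_mode_DD k x)"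
      unfolding gauged_eq by (simp add: algebra_simps)
    also have "\<dots> = 4 * of_real pi ^ 2 * (a k * (?M k * ?c k + ?T k))"
      unfolding gauged_cos_mode[OF x(2)] mode_energy_def by simp
    finally show ?thesis .
  qed
  ultimately have s3: "(\<lambda>k. 4 * of_real pi ^ 2 * (a k * (?M k * ?c k + ?T k))) sums gauged l0 l1 x u' u''"
    unfolding gauged_eq by simp
  have "(\<lambda>k. 4 * of_real pi ^ 2 * (a k * (?M k * ?c k + ?T k)) - 4 * of_real pi ^ 2 * (a k * (?T k + W * ?c k))
      + 4 * of_real pi ^ 2 * ((e - (?M k - ?M m)) * a k * ?c k)) sums
      (gauged l0 l1 x u' u'' - 4 * of_real pi ^ 2 * X + 4 * of_real pi ^ 2 * X)"
    by (intro sums_add sums_diff sums_mult s1 s2 s3)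
  moreover have "4 * of_real pi ^ 2 * (a k * (?M k * ?c k + ?T k)) - 4 * of_real pi ^ 2 * (a k * (?T k + W * ?c k))
      + 4 * of_real pi ^ 2 * ((e - (?M k - ?M m)) * a k * ?c k)
      = 4 * of_real pi ^ 2 * ((?M m + e - W) * (a k * ?c k))" for k
    by (simp add: algebra_simps)
  ultimately have "(\<lambda>k. 4 * of_real pi ^ 2 * ((?M m + e - W) * (a k * ?c k))) sums gauged l0 l1 x u' u''"
    by simp
  moreover have "(\<lambda>k. 4 * of_real pi ^ 2 * ((?M m + e - W) * (a k * ?c k))) sums (4 * of_real pi ^ 2 * ((?M m + e - W) * u))"
    by (intro sums_mult u)
  ultimately show ?thesis unfolding W_def by (rule sums_unique2)
qed

section \<open>Eigenfunctions of the Hamiltonian\<close>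

lemma strip_iff: "x \<in> strip p \<longleftrightarrow> norm p * exp (2 * pi * \<bar>Im x\<bar>) < 1"
proof -
  have "exp (- 2 * pi * \<bar>Im x\<bar>) = 1 / exp (2 * pi * \<bar>Im x\<bar>)" by (simp add: exp_minus inverse_eq_divide)
  then show ?thesis by (simp add: strip_def pos_less_divide_eq)
qed

lemma half_integer_shift: "x \<notin> half_integers \<Longrightarrow> x \<notin> \<int>" "x \<notin> half_integers \<Longrightarrow> x + 1/2 \<notin> \<int>"
proof -
  assume x: "x \<notin> half_integers"
  show "x \<notin> \<int>"
  proof
    assume "x \<in> \<int>"
    then obtain n where "x = of_int n" by (auto elim: Ints_cases)
    then have "x = of_int (2 * n) / 2" by simp
    then show False using x unfolding half_integers_def by blast
  qed
  show "x + 1/2 \<notin> \<int>"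
  proof
    assume "x + 1/2 \<in> \<int>"
    then obtain n where "x + 1/2 = of_int n" by (auto elim: Ints_cases)
    then have "x = of_int (2 * n - 1) / 2" by (simp add: field_simps)
    then show False using x unfolding half_integers_def by blast
  qed
qed

text \<open>The constant terms of the Fourier expansion, which shift the eigenvalue. The coefficient of
  \<open>p ^ n\<close> is the sum of the divisors of \<open>n\<close>.\<close>
definition nome_series :: "complex \<Rightarrow> complex" where
  "nome_series p = (\<Sum>n. of_nat n * (p ^ n / (1 - p ^ n)))"

lemma nome_series_summable:
  fixes p :: complex
  assumes "norm p \<le> 1/2" shows "summable (\<lambda>n. of_nat n * (p ^ n / (1 - p ^ n)))"
proof (rule summable_comparison_test'[of "\<lambda>n. 2 * (real n * (1/2) ^ n)" 0])
  show "summable (\<lambda>n. 2 * (real n * (1/2) ^ n))" by (intro summable_mult summable_nat_mult_power) simp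
qed (use norm_nome_term_le[OF assms] in simp)

lemma holomorphic_nome_series: "nome_series holomorphic_on ball 0 (1/2)"
  unfolding nome_series_def [abs_def]
proof (rule holomorphic_on_suminf)
  show "(\<lambda>p. of_nat n * (p ^ n / (1 - p ^ n)) :: complex) holomorphic_on ball 0 (1/2)" for n
    by (rule holomorphic_on_subset[OF holomorphic_nome_term]) auto
  show "norm (of_nat n * (p ^ n / (1 - p ^ n)) :: complex) \<le> 2 * (real n * (1/2) ^ n)" if "p \<in> ball 0 (1/2)" for n p
    by (rule norm_nome_term_le) (use that in auto)
  show "summable (\<lambda>n. 2 * (real n * (1/2 :: real) ^ n))" by (intro summable_mult summable_nat_mult_power) simp
qed simp

lemma nome_series_0 [simp]: "nome_series 0 = 0"
proof -
  have "of_nat n * (0 ^ n / (1 - 0 ^ n)) = (0::complex)" for n by (cases n) auto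
  then show ?thesis unfolding nome_series_def by (simp only: suminf_zero)
qed

text \<open>Subtract the squared cosecant from the Fourier expansion at \<open>x\<close> and at \<open>x + 1/2\<close>. The translation by
  the half period produces the signs \<open>(-1) ^ n\<close> in \<open>potential_coeff\<close>.\<close>
lemma hamiltonian_eq:
  assumes \<tau>: "Im \<tau> > 0" and p: "p = exp (2 * of_real pi * \<i> * \<tau>)" "norm p \<le> 1/2" and x: "x \<in> strip p" "x \<notin> half_integers"
  shows "hamiltonian l0 l1 \<tau> f x = hamiltonian_T l0 l1 f x
    + (4 * of_real pi ^ 2 * (\<Sum>n. potential_coeff l0 l1 p n * cos_mode n x)
       + 8 * of_real pi ^ 2 * of_real (coupling_size l0 l1) * nome_series p - of_real (const_T l0 l1)) * f x"
proof -
  define q where "q n = of_nat n * (p ^ n / (1 - p ^ n))" for n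
  define \<kappa>0 \<kappa>1 where "\<kappa>0 = (of_nat (l0 * (l0 + 1)) :: complex)" and "\<kappa>1 = (of_nat (l1 * (l1 + 1)) :: complex)"
  define s c P where "s = sin (of_real pi * x)" and "c = cos (of_real pi * x)" and "P = (of_real pi ^ 2 :: complex)"
  define w0 w1 where "w0 = (P / s ^ 2 - P / 3 - wp \<tau> x) / (8 * P)" and "w1 = (P / c ^ 2 - P / 3 - wp \<tau> (x + 1/2)) / (8 * P)"
  have P0: "P \<noteq> 0" by (simp add: P_def)
  have "x + 1/2 \<in> strip p" using x(1) by (simp add: strip_def)
  note W = wp_fourier[OF \<tau> p(1) x(1) half_integer_shift(1)[OF x(2)], folded cos_mode_def]
    wp_fourier[OF \<tau> p(1) this half_integer_shift(2)[OF x(2)], folded cos_mode_def, unfolded half_shift]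
  have s0: "(\<lambda>n. q n * (cos_mode n x - 1)) sums w0" using W(1) by (simp only: q_def w0_def s_def P_def)
  have s1: "(\<lambda>n. q n * ((- 1) ^ n * cos_mode n x - 1)) sums w1" using W(2) by (simp only: q_def w1_def c_def P_def)
  have sZ: "q sums nome_series p"
    unfolding q_def [abs_def] nome_series_def by (rule summable_sums[OF nome_series_summable[OF p(2)]])
  have "(\<lambda>n. - 2 * (\<kappa>0 * (q n * (cos_mode n x - 1)) + \<kappa>1 * (q n * ((- 1) ^ n * cos_mode n x - 1)) + (\<kappa>0 + \<kappa>1) * q n))
      sums (- 2 * (\<kappa>0 * w0 + \<kappa>1 * w1 + (\<kappa>0 + \<kappa>1) * nome_series p))"
    by (intro sums_mult sums_add s0 s1 sZ)
  moreover have "- 2 * (\<kappa>0 * (q n * (cos_mode n x - 1)) + \<kappa>1 * (q n * ((- 1) ^ n * cos_mode n x - 1)) + (\<kappa>0 + \<kappa>1) * q n)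
      = potential_coeff l0 l1 p n * cos_mode n x" for n
    unfolding potential_coeff_def q_def[symmetric] \<kappa>0_def[symmetric] \<kappa>1_def[symmetric] by (simp add: algebra_simps)
  ultimately have V: "(\<Sum>n. potential_coeff l0 l1 p n * cos_mode n x)
      = - 2 * (\<kappa>0 * w0 + \<kappa>1 * w1 + (\<kappa>0 + \<kappa>1) * nome_series p)"
    by (simp add: sums_iff)
  have wp0: "wp \<tau> x = P / s ^ 2 - P / 3 - 8 * P * w0" and wp1: "wp \<tau> (x + 1/2) = P / c ^ 2 - P / 3 - 8 * P * w1"
    using P0 by (simp_all add: w0_def w1_def)
  have C: "of_real (const_T l0 l1) = P / 3 * (\<kappa>0 + \<kappa>1)" by (simp add: const_T_def P_def \<kappa>0_def \<kappa>1_def)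
  have K: "of_real (coupling_size l0 l1) = \<kappa>0 + \<kappa>1" by (simp add: coupling_size_def \<kappa>0_def \<kappa>1_def)
  show ?thesis
    unfolding hamiltonian_def hamiltonian_T_def V C K wp0 wp1 \<kappa>0_def[symmetric] \<kappa>1_def[symmetric] s_def[symmetric] c_def[symmetric] P_def[symmetric]
    by (simp add: algebra_simps)
qed

theorem theorem5p1:
  fixes l0 l1 m :: nat
  shows "\<exists>\<epsilon>::real. 0 < \<epsilon> \<and> \<epsilon> \<le> 1 \<and>
    (\<exists>(E :: complex \<Rightarrow> complex) (g :: complex \<Rightarrow> complex \<Rightarrow> complex).
       (\<forall>\<tau> p. Im \<tau> > 0 \<and> p = exp (2 * of_real pi * \<i> * \<tau>) \<and> norm p < \<epsilon> \<longrightarrow>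
          eigenfunction_on (strip p) (hamiltonian l0 l1 \<tau>) (E p) (\<lambda>x. g x p)) \<and>
       eigenfunction_on (strip 0) (hamiltonian_0 l0 l1) (E 0) (\<lambda>x. g x 0) \<and>
       (\<forall>p. norm p < \<epsilon> \<longrightarrow>
          set_integrable lborel {0..1} (\<lambda>x::real. (norm (g (of_real x) p)) ^ 2)) \<and>
       E holomorphic_on ball 0 \<epsilon> \<and>
       (\<forall>x. (\<lambda>p. g x p) holomorphic_on {p \<in> ball 0 \<epsilon>. x \<in> strip p}) \<and>
       (E \<longlongrightarrow> of_real (pi ^ 2 * real (l0 + l1 + 2 + 2 * m) ^ 2
           - pi ^ 2 / 3 * real (l0 * (l0 + 1) + l1 * (l1 + 1)))) (at 0) \<and>
       (\<forall>K. compact K \<longrightarrow>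
          uniform_limit K (\<lambda>p x. g x p) (\<lambda>x. Phi l0 l1 x * psi l0 l1 m x) (at 0)))"
proof -
  obtain r \<sigma> A e a where r: "0 < r" "r \<le> 1/2" and \<sigma>: "1 < \<sigma>" "r * \<sigma> < 1" and A: "0 \<le> A"
    and e_holo: "e holomorphic_on ball 0 r" and a_holo: "\<And>k. (\<lambda>p. a p k) holomorphic_on ball 0 r"
    and a_le: "\<And>p k. p \<in> ball 0 r \<Longrightarrow> norm (a p k) * \<sigma> ^ k \<le> A"
    and e_le: "\<And>p. p \<in> ball 0 r \<Longrightarrow> norm (e p) \<le> 1" and e_0: "e 0 = 0"
    and eq: "\<And>p k. p \<in> ball 0 r \<Longrightarrow> (mode_energy l0 l1 k - mode_energy l0 l1 m) * a p k
        + (\<Sum>j. hill_matrix l0 l1 p k j * a p j) = e p * a p k"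
    and psi: "\<And>x. psi l0 l1 m x = (\<Sum>k. a 0 k * cos_mode k x)"
  proof (rule hill_eigenpair[of l0 l1 m], goal_cases)
    case (1 r \<sigma> A e a)
    show ?case by (rule that[OF 1(2-13)])
  qed
  define u where "u x p = (\<Sum>k. a p k * cos_mode k x)" for x p
  define g where "g x p = Phi l0 l1 x * u x p" for x p
  define E where "E p = of_real pi ^ 2 * of_nat (l0 + l1 + 2 + 2 * m) ^ 2 + 4 * of_real pi ^ 2 * e p
     + 8 * of_real pi ^ 2 * of_real (coupling_size l0 l1) * nome_series p - of_real (const_T l0 l1)" for p
  \<comment> \<open>Near any parameter \<open>q\<close> there is room for a slightly larger disc of parameters and a slightly
    larger strip on which the cosine series is dominated by one geometric series.\<close>
  have bounds: "\<exists>r1 \<rho> B. norm q < r1 \<and> r1 < r \<and> t < \<rho> \<and> 1 < \<rho> \<and> r1 * \<rho> < 1 \<and>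
      (\<forall>p k. norm p \<le> r1 \<longrightarrow> norm (a p k) * \<rho> ^ k \<le> B)"
    if q: "norm q < r" "norm q * t < 1" for q :: complex and t :: real
  proof -
    define T where "T = max t \<sigma>"
    have T: "t \<le> T" "\<sigma> \<le> T" "1 < T" using \<sigma> by (auto simp: T_def)
    have "norm q * \<sigma> \<le> r * \<sigma>" using q \<sigma> by (intro mult_right_mono) auto
    then have "norm q * \<sigma> < 1" using \<sigma>(2) by linarith
    then have "norm q * T < 1" using q(2) by (simp add: T_def max_def)
    then have "norm q < 1 / T" using T by (simp add: field_simps)
    then obtain r1 where r1: "norm q < r1" "r1 < min r (1 / T)"
      using q(1) dense[of "norm q" "min r (1 / T)"] by auto
    have r1_pos: "0 < r1" using r1(1) norm_ge_zero[of q] by linarith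
    have "T < 1 / r1" using r1 r1_pos T by (simp add: field_simps)
    then obtain \<rho> where \<rho>: "T < \<rho>" "\<rho> < 1 / r1" using dense by blast
    then have \<rho>r: "r1 * \<rho> < 1" using r1_pos by (simp add: field_simps)
    have mem: "p \<in> ball 0 r" if "norm p \<le> r1" for p :: complex using that r1 by simp
    obtain B where "0 \<le> B" "\<And>p k. norm p \<le> r1 \<Longrightarrow> norm (a p k) * \<rho> ^ k \<le> B"
      by (rule mode_decay[of r1 \<sigma> \<rho> A a e l0 l1 m]) (use r1 r1_pos r \<sigma> \<rho> \<rho>r T A a_le[OF mem] e_le[OF mem] eq[OF mem] in auto)
    then show ?thesis using r1 \<rho> \<rho>r T by (intro exI[of _ r1] exI[of _ \<rho>] exI[of _ B]) auto
  qed
  have local: "\<exists>S u' u''. open S \<and> x \<in> S \<and> (\<forall>y\<in>S. ((\<lambda>x. u x p) has_field_derivative u' y) (at y)) \<and>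
      (u' has_field_derivative u'') (at x) \<and> (x \<notin> half_integers \<longrightarrow> gauged l0 l1 x (u' x) u'' =
        4 * of_real pi ^ 2 * ((mode_energy l0 l1 m + e p - (\<Sum>n. potential_coeff l0 l1 p n * cos_mode n x)) * u x p))"
    if p: "norm p < r" and x: "x \<in> strip p" for x p
  proof -
    obtain r1 \<rho> B where b: "norm p < r1" "r1 < r" "exp (2 * pi * \<bar>Im x\<bar>) < \<rho>" "1 < \<rho>" "r1 * \<rho> < 1"
      "\<And>p k. norm p \<le> r1 \<Longrightarrow> norm (a p k) * \<rho> ^ k \<le> B"
      using bounds[OF p, of "exp (2 * pi * \<bar>Im x\<bar>)"] x strip_iff by blast
    have ap: "norm (a p k) * \<rho> ^ k \<le> B" for k using b by simp
    define S where "S = {y::complex. exp (2 * pi * \<bar>Im y\<bar>) < \<rho>}"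
    have S: "open S" "x \<in> S" unfolding S_def using b(3) by (auto intro!: open_Collect_less continuous_intros)
    obtain U u' u'' where U: "\<And>y. y \<in> S \<Longrightarrow> (\<lambda>k. a p k * cos_mode k y) sums U y"
      "\<And>y. y \<in> S \<Longrightarrow> (\<lambda>k. a p k * cos_mode_D k y) sums u' y"
      "\<And>y. y \<in> S \<Longrightarrow> (\<lambda>k. a p k * cos_mode_DD k y) sums u'' y"
      "\<And>y. y \<in> S \<Longrightarrow> (U has_field_derivative u' y) (at y)" "\<And>y. y \<in> S \<Longrightarrow> (u' has_field_derivative u'' y) (at y)"
      using cos_series_derivs[OF b(4) ap] unfolding S_def mem_Collect_eq by blast
    have Uu: "U y = u y p" if "y \<in> S" for y using U(1)[OF that] by (simp add: u_def sums_iff)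
    have "((\<lambda>x. u x p) has_field_derivative u' y) (at y)" if "y \<in> S" for y
      by (rule has_field_derivative_transform_within_open[OF U(4)[OF that] S(1) that]) (use Uu in auto)
    moreover have "gauged l0 l1 x (u' x) (u'' x) =
        4 * of_real pi ^ 2 * ((mode_energy l0 l1 m + e p - (\<Sum>n. potential_coeff l0 l1 p n * cos_mode n x)) * u x p)"
      if "x \<notin> half_integers"
      unfolding Uu[OF S(2), symmetric]
      by (rule cos_series_ode[of p r1 \<rho> "a p" B]) (use b ap r p eq that U S in \<open>auto simp: S_def\<close>)
    ultimately show ?thesis using S U(5)[OF S(2)] by blast
  qed
  have g_holo: "(\<lambda>x. g x p) holomorphic_on strip p" if p: "norm p < r" for p
  proof -
    have "(\<lambda>x. u x p) holomorphic_on strip p"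
      unfolding holomorphic_on_def field_differentiable_def
      using local[OF p] has_field_derivative_at_within by blast
    then show ?thesis unfolding g_def Phi_def by (intro holomorphic_intros)
  qed
  have H_T: "hamiltonian_T l0 l1 (\<lambda>x. g x p) x
      = (E p - 8 * of_real pi ^ 2 * of_real (coupling_size l0 l1) * nome_series p + of_real (const_T l0 l1)
        - 4 * of_real pi ^ 2 * (\<Sum>n. potential_coeff l0 l1 p n * cos_mode n x)) * g x p"
    if p: "norm p < r" and x: "x \<in> strip p" "x \<notin> half_integers" for p x
  proof -
    let ?W = "\<Sum>n. potential_coeff l0 l1 p n * cos_mode n x"
    obtain S u' u'' where S: "open S" "x \<in> S" "\<And>y. y \<in> S \<Longrightarrow> ((\<lambda>x. u x p) has_field_derivative u' y) (at y)"
      "(u' has_field_derivative u'') (at x)"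
      "gauged l0 l1 x (u' x) u'' = 4 * of_real pi ^ 2 * ((mode_energy l0 l1 m + e p - ?W) * u x p)"
      using local[OF p x(1)] x(2) by blast
    have "hamiltonian_T l0 l1 (\<lambda>x. g x p) x = Phi l0 l1 x * (of_real pi ^ 2 * of_nat (l0 + l1 + 2) ^ 2 * u x p + gauged l0 l1 x (u' x) u'')"
      unfolding g_def by (rule hamiltonian_T_gauge[OF S(1,2) x(2) S(3,4)])
    also have "\<dots> = (of_real pi ^ 2 * (of_nat (l0 + l1 + 2) ^ 2 + 4 * mode_energy l0 l1 m) + 4 * of_real pi ^ 2 * e p
        - 4 * of_real pi ^ 2 * ?W) * g x p"
      unfolding S(5) g_def by (simp add: algebra_simps)
    also have "of_nat (l0 + l1 + 2) ^ 2 + 4 * mode_energy l0 l1 m = of_nat (l0 + l1 + 2 + 2 * m) ^ 2"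
      by (simp add: mode_energy_def algebra_simps power2_eq_square)
    finally show ?thesis by (simp add: E_def)
  qed
  have strip_real: "complex_of_real x \<in> strip p" if "norm p < r" for x p
    using that r by (simp add: strip_def)
  have g0: "g x 0 = Phi l0 l1 x * psi l0 l1 m x" for x by (simp add: g_def u_def psi)
  have g_holo_p: "(\<lambda>p. g x p) holomorphic_on {p \<in> ball 0 \<epsilon>. x \<in> strip p}" if "\<epsilon> \<le> r" for x \<epsilon>
  proof -
    have "(\<lambda>p. u x p) field_differentiable (at q)" if q: "norm q < r" "x \<in> strip q" for q
    proof -
      define t where "t = exp (2 * pi * \<bar>Im x\<bar>)"
      have t: "0 < t" by (simp add: t_def)
      obtain r1 \<rho> B where b: "norm q < r1" "r1 < r" "t < \<rho>" "1 < \<rho>" "r1 * \<rho> < 1"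
        "\<And>p k. norm p \<le> r1 \<Longrightarrow> norm (a p k) * \<rho> ^ k \<le> B"
        using bounds[OF q(1), of t] q(2) strip_iff unfolding t_def by blast
      have "(\<lambda>p. u x p) holomorphic_on ball 0 r1"
        unfolding u_def
      proof (rule holomorphic_on_suminf)
        show "(\<lambda>p. a p n * cos_mode n x) holomorphic_on ball 0 r1" for n
          by (intro holomorphic_on_mult holomorphic_on_const holomorphic_on_subset[OF a_holo]) (use b in auto)
        show "norm (a p n * cos_mode n x) \<le> B * (t / \<rho>) ^ n" if "p \<in> ball 0 r1" for n p
          by (rule norm_mode_term_le) (use b that in \<open>auto simp: t_def\<close>)
        show "summable (\<lambda>n. B * (t / \<rho>) ^ n)" using b t by (intro summable_mult summable_geometric) auto
      qed simp
      then show ?thesis using b(1) by (auto simp: holomorphic_on_open field_differentiable_def)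
    qed
    note diff = this
    have "(\<lambda>p. u x p) holomorphic_on {p \<in> ball 0 \<epsilon>. x \<in> strip p}"
    proof (rule holomorphic_onI, rule field_differentiable_at_within, rule diff)
      fix q assume "q \<in> {p \<in> ball 0 \<epsilon>. x \<in> strip p}"
      then show "norm q < r" "x \<in> strip q" using that by simp_all
    qed
    then show ?thesis unfolding g_def by (intro holomorphic_intros)
  qed
  \<comment> \<open>A point at which the limit does not vanish; by continuity the eigenfunction does not vanish
    there for small \<open>p\<close>.\<close>
  obtain x0 :: real where x0: "Phi l0 l1 (of_real x0) * psi l0 l1 m (of_real x0) \<noteq> 0"
  proof -
    have cont: "continuous_on UNIV (\<lambda>x. jacobi l0 l1 m (complex_of_real x))"
      unfolding jacobi_eq cos_mode_def by (intro continuous_intros) auto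
    have "jacobi l0 l1 m 0 = (\<Sum>n\<in>{0}. jacobi_coeff l0 l1 m n * ((1 - cos_mode 1 0) / 2) ^ n)"
      unfolding jacobi_eq by (rule sum.mono_neutral_right) (auto simp: cos_mode_def)
    then have "jacobi l0 l1 m (complex_of_real 0) \<noteq> 0" by (simp add: jacobi_coeff_0)
    then obtain d where d: "d > 0" "\<And>x. dist 0 x < d \<Longrightarrow> jacobi l0 l1 m (complex_of_real x) \<noteq> 0"
      using continuous_on_open_avoid[OF cont open_UNIV UNIV_I, of 0 0] by blast
    define x where "x = min (d / 2) (1/4)"
    have x: "0 < x" "x < 1/2" "x < d" using d(1) by (auto simp: x_def)
    have "complex_of_real x \<notin> half_integers"
    proof
      assume "complex_of_real x \<in> half_integers"
      then obtain n :: int where "complex_of_real x = of_int n / 2" by (auto simp: half_integers_def)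
      then have "complex_of_real x = complex_of_real (real_of_int n / 2)" by simp
      then have "x = real_of_int n / 2" by (simp only: of_real_eq_iff)
      then show False using x by simp
    qed
    then have "Phi l0 l1 (of_real x) \<noteq> 0" using half_integers_iff by (auto simp: Phi_def)
    moreover have "psi l0 l1 m (of_real x) \<noteq> 0"
      using d(2)[of x] x jacobi_const_nonzero by (simp add: psi_def)
    ultimately show thesis using that[of x] by simp
  qed
  have cont: "continuous_on (ball 0 r) (\<lambda>p. g (of_real x0) p)"
    by (rule continuous_on_subset[OF holomorphic_on_imp_continuous_on[OF g_holo_p[OF order_refl]]])
       (use strip_real in auto)
  have "g (of_real x0) 0 \<noteq> 0" using x0 g0 by simp
  then obtain \<delta> where \<delta>: "\<delta> > 0" "\<And>p. dist 0 p < \<delta> \<Longrightarrow> p \<in> ball 0 r \<Longrightarrow> g (of_real x0) p \<noteq> 0"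
    using continuous_on_open_avoid[OF cont open_ball centre_in_ball[THEN iffD2, OF r(1)]] by blast
  define \<epsilon> where "\<epsilon> = min r \<delta>"
  have \<epsilon>: "0 < \<epsilon>" "\<epsilon> \<le> r" "\<epsilon> \<le> \<delta>" using r \<delta> by (auto simp: \<epsilon>_def)
  have nonzero: "\<exists>x\<in>strip p. g x p \<noteq> 0" if "norm p < \<epsilon>" for p
    using \<delta>(2)[of p] strip_real[of p x0] that \<epsilon> by (intro bexI[of _ "of_real x0"]) auto
  have E_holo: "E holomorphic_on ball 0 \<epsilon>"
    unfolding E_def
    by (intro holomorphic_intros holomorphic_on_subset[OF e_holo] holomorphic_on_subset[OF holomorphic_nome_series])
       (use \<epsilon> r in auto)
  have E0: "E 0 = of_real (pi ^ 2 * real (l0 + l1 + 2 + 2 * m) ^ 2 - pi ^ 2 / 3 * real (l0 * (l0 + 1) + l1 * (l1 + 1)))"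
    by (simp add: E_def e_0 const_T_def)
  show ?thesis
  proof (rule exI[of _ \<epsilon>], intro conjI exI[of _ E] exI[of _ g] allI impI)
    show "0 < \<epsilon>" "\<epsilon> \<le> 1" using \<epsilon> r by auto
    show "E holomorphic_on ball 0 \<epsilon>" by (rule E_holo)
    show "(\<lambda>p. g x p) holomorphic_on {p \<in> ball 0 \<epsilon>. x \<in> strip p}" for x
      using g_holo_p[OF \<epsilon>(2)] .
  next
    fix \<tau> p assume *: "Im \<tau> > 0 \<and> p = exp (2 * of_real pi * \<i> * \<tau>) \<and> norm p < \<epsilon>"
    then have p: "norm p < r" "norm p \<le> 1/2" using \<epsilon> r by auto
    have "hamiltonian l0 l1 \<tau> (\<lambda>x. g x p) x = E p * g x p" if "x \<in> strip p" "x \<notin> half_integers" for x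
      using hamiltonian_eq[OF _ _ p(2) that, of \<tau> l0 l1 "\<lambda>x. g x p"] H_T[OF p(1) that] *
      by (simp add: algebra_simps)
    then show "eigenfunction_on (strip p) (hamiltonian l0 l1 \<tau>) (E p) (\<lambda>x. g x p)"
      unfolding eigenfunction_on_def using g_holo[OF p(1)] nonzero * by auto
  next
    have "hamiltonian_0 l0 l1 (\<lambda>x. g x 0) x = E 0 * g x 0" if "x \<in> strip 0" "x \<notin> half_integers" for x
      using H_T[of 0, OF _ that] r by (simp add: hamiltonian_0_def algebra_simps)
    then show "eigenfunction_on (strip 0) (hamiltonian_0 l0 l1) (E 0) (\<lambda>x. g x 0)"
      unfolding eigenfunction_on_def using g_holo[of 0] nonzero[of 0] r \<epsilon> by auto
  next
    fix p :: complex assume "norm p < \<epsilon>"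
    then have p: "norm p < r" using \<epsilon> by simp
    have "continuous_on {0..1} (\<lambda>x. g (complex_of_real x) p)"
      by (rule continuous_on_compose2[OF holomorphic_on_imp_continuous_on[OF g_holo[OF p]]])
         (use strip_real[OF p] in \<open>auto intro!: continuous_intros\<close>)
    then show "set_integrable lborel {0..1} (\<lambda>x::real. (norm (g (of_real x) p)) ^ 2)"
      unfolding set_integrable_def by (intro borel_integrable_compact continuous_intros) auto
  next
    have "continuous (at 0) E"
      using holomorphic_on_imp_continuous_on[OF E_holo] \<epsilon> by (simp add: continuous_on_eq_continuous_at)
    then show "(E \<longlongrightarrow> of_real (pi ^ 2 * real (l0 + l1 + 2 + 2 * m) ^ 2
        - pi ^ 2 / 3 * real (l0 * (l0 + 1) + l1 * (l1 + 1)))) (at 0)"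
      unfolding isCont_def E0 .
  next
    fix K :: "complex set" assume K: "compact K"
    then obtain h where h: "\<And>x. x \<in> K \<Longrightarrow> norm x \<le> h" using compact_imp_bounded bounded_iff by metis
    define t where "t = exp (2 * pi * h)"
    have t: "exp (2 * pi * \<bar>Im x\<bar>) \<le> t" if "x \<in> K" for x
      using abs_Im_le_cmod[of x] h[OF that] by (simp add: t_def)
    have t0: "0 < t" by (simp add: t_def)
    have "norm (0::complex) < r" "norm (0::complex) * t < 1" using r by simp_all
    from bounds[OF this] obtain r1 \<rho> B where b0: "norm (0::complex) < r1"
      and b: "r1 < r" "t < \<rho>" "1 < \<rho>" "\<And>p k. norm p \<le> r1 \<Longrightarrow> norm (a p k) * \<rho> ^ k \<le> B"
      by blast
    have r1: "0 < r1" using b0 by simp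
    \<comment> \<open>Joint continuity in \<open>(p, x)\<close> on a compact set implies convergence uniform in \<open>x\<close>.\<close>
    define D where "D = cball (0::complex) r1 \<times> K"
    have D: "compact D" unfolding D_def by (intro compact_Times compact_cball K)
    have term_le: "norm (a (fst z) k * cos_mode k (snd z)) \<le> B * (t / \<rho>) ^ k" if "z \<in> D" for z k
      by (rule norm_mode_term_le) (use b t that in \<open>auto simp: D_def\<close>)
    have "uniform_limit D (\<lambda>n z. \<Sum>k<n. a (fst z) k * cos_mode k (snd z)) (\<lambda>z. u (snd z) (fst z)) sequentially"
      unfolding u_def
      by (rule Weierstrass_m_test[OF term_le]) (use b t0 in \<open>auto intro!: summable_mult summable_geometric\<close>)
    moreover have "continuous_on D (\<lambda>z. \<Sum>k<n. a (fst z) k * cos_mode k (snd z))" for n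
    proof (intro continuous_on_sum continuous_on_mult)
      fix k
      have "continuous_on (cball 0 r1) (\<lambda>p. a p k)"
        by (rule continuous_on_subset[OF holomorphic_on_imp_continuous_on[OF a_holo]]) (use b in auto)
      then show "continuous_on D (\<lambda>z. a (fst z) k)"
        by (rule continuous_on_compose2) (auto simp: D_def intro!: continuous_intros)
      show "continuous_on D (\<lambda>z. cos_mode k (snd z))"
        unfolding cos_mode_def by (intro continuous_intros)
    qed
    ultimately have "continuous_on D (\<lambda>z. u (snd z) (fst z))"
      by (intro uniform_limit_theorem[of D "\<lambda>n z. \<Sum>k<n. a (fst z) k * cos_mode k (snd z)"]) auto
    then have "continuous_on D (\<lambda>z. g (snd z) (fst z))"
      unfolding g_def Phi_def by (intro continuous_intros)
    then have unif: "uniformly_continuous_on D (\<lambda>z. g (snd z) (fst z))"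
      using D by (rule compact_uniformly_continuous)
    show "uniform_limit K (\<lambda>p x. g x p) (\<lambda>x. Phi l0 l1 x * psi l0 l1 m x) (at 0)"
    proof (rule uniform_limitI)
      fix \<eta> :: real assume "\<eta> > 0"
      then obtain d where d: "d > 0" "\<And>z z'. z \<in> D \<Longrightarrow> z' \<in> D \<Longrightarrow> dist z' z < d \<Longrightarrow>
          dist (g (snd z') (fst z')) (g (snd z) (fst z)) < \<eta>"
        using unif[unfolded uniformly_continuous_on_def, rule_format, OF \<open>\<eta> > 0\<close>] by blast
      have "\<forall>\<^sub>F p in at (0::complex). dist p 0 < min d r1"
        unfolding eventually_at using r1 d(1) by (intro exI[of _ "min d r1"]) auto
      then show "\<forall>\<^sub>F p in at 0. \<forall>x\<in>K. dist (g x p) (Phi l0 l1 x * psi l0 l1 m x) < \<eta>"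
      proof eventually_elim
        case (elim p)
        show ?case
        proof
          fix x assume x: "x \<in> K"
          have "dist (p, x) (0, x) < d" using elim by (simp add: dist_prod_def dist_norm)
          then have "dist (g x p) (g x 0) < \<eta>"
            using d(2)[of "(0, x)" "(p, x)"] x elim r1 by (simp add: D_def)
          then show "dist (g x p) (Phi l0 l1 x * psi l0 l1 m x) < \<eta>" by (simp add: g0)
        qed
      qed
    qed
  qed
qed

end
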